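(* Let $H$ be a finite dimensional Hopf algebra over a field $k$, and let $G=\mathrm{Aut}_{Hopf}(H)\times \mathrm{Aut}_{Hopf}(H)$ with multiplication $(\alpha,\beta)*(\gamma,\delta)=(\alpha\gamma,\ \delta\gamma^{-1}\beta\gamma)$. For $(\alpha,\beta)\in G$ put $DT(H)_{(\alpha,\beta)}=H^*\bowtie H(\alpha,\beta)$. Then $DT(H)=\{DT(H)_{(\alpha,\beta)}\}_{(\alpha,\beta)\in G}$ is a quasitriangular T-coalgebra over $G$, with the following structure: - comultiplications $\Delta_{(\alpha,\beta),(\gamma,\delta)}:H^*\bowtie H((\alpha,\beta)*(\gamma,\delta))\to(H^*\bowtie H(\alpha,\beta))\otimes(H^*\bowtie H(\gamma,\delta))$, $\Delta_{(\alpha,\beta),(\gamma,\delta)}(p\bowtie h)=(p_2\bowtie\gamma(h_1))\otimes(p_1\bowtie\gamma^{-1}\beta\gamma(h_2))$; - counit $\varepsilon$ on $DT(H)_{(\mathrm{id},\mathrm{id})}=D(H)$ equal to that of the Drinfeld double $D(H)$, i.e. $\varepsilon(p\bowtie h)=p(1)\varepsilon(h)$; - conjugation $\varphi_{(\alpha,\beta)}^{(\gamma,\delta)}:H^*\bowtie H(\gamma,\delta)\to H^*\bowtie H((\alpha,\beta)*(\gamma,\delta)*(\alpha,\beta)^{-1})$, $\varphi_{(\alpha,\beta)}^{(\gamma,\delta)}(p\bowtie h)=p\circ\beta\alpha^{-1}\bowtie\alpha\gamma^{-1}\beta^{-1}\gamma(h)$; - antipode $S_{(\alpha,\beta)}:H^*\bowtie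 H(\alpha,\beta)\to H^*\bowtie H((\alpha,\beta)^{-1})$, $S_{(\alpha,\beta)}(p\bowtie h)=(\varepsilon\bowtie\alpha\beta(S(h)))\cdot(S^{*-1}(p)\bowtie 1)$, the product on the right being taken in $H^*\bowtie H((\alpha,\beta)^{-1})$; - universal $R$-matrix $R_{(\alpha,\beta),(\gamma,\delta)}=\sum_i(\varepsilon\bowtie\beta^{-1}(e_i))\otimes(e^i\bowtie 1)\in(H^*\bowtie H(\alpha,\beta))\otimes(H^*\bowtie H(\gamma,\delta))$, where $\{e_i\}$, $\{e^i\}$ are dual bases of $H$ and $H^*$.
   Context: $\otimes=\otimes_k$; $S$ is the antipode of $H$ (bijective); $\Delta(h)=h_1\otimes h_2$ is Sweedler notation. $\mathrm{Aut}_{Hopf}(H)$ is the group of Hopf algebra automorphisms of $H$. $(G,* )$ is a group with unit $(\mathrm{id},\mathrm{id})$ and $(\alpha,\beta)^{-1}=(\alpha^{-1},\alpha\beta^{-1}\alpha^{-1})$. $H^*$ is the dual Hopf algebra with convolution product, coproduct $p\mapsto p_1\otimes p_2$ determined by $p(hl)=p_1(h)p_2(l)$, and $S^{*-1}(p)=p\circ S^{-1}$. The regular actions of $H$ on $H^*$ are $(h\rightharpoonup p)(l)=p(lh)$ and $(p\leftharpoonup h)(l)=p(hl)$. For $\alpha,\beta\in\mathrm{Aut}_{Hopf}(H)$, the diagonal crossed product $H^*\bowtie H(\alpha,\beta)$ is the associative algebra with underlying vector space $H^*\otimes H$ (elements written $p\bowtie h$), unit $\varepsilon\bowtie 1$ and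 multiplication $$(p\bowtie h)(q\bowtie l)=p\big(\alpha(h_1)\rightharpoonup q\leftharpoonup S^{-1}(\beta(h_3))\big)\bowtie h_2l.$$ For $\alpha=\beta=\mathrm{id}$ this is the algebra of the Drinfeld double $D(H)$. A T-coalgebra over a group $G$ is a family $\{A_a\}_{a\in G}$ of associative unital $k$-algebras together with: algebra maps $\Delta_{a,b}:A_{ab}\to A_a\otimes A_b$ and $\varepsilon:A_1\to k$ with $(\Delta_{a,b}\otimes\mathrm{id})\Delta_{ab,c}=(\mathrm{id}\otimes\Delta_{b,c})\Delta_{a,bc}$ and $(\mathrm{id}\otimes\varepsilon)\Delta_{a,1}=\mathrm{id}=(\varepsilon\otimes\mathrm{id})\Delta_{1,a}$; linear maps (antipode) $S_a:A_a\to A_{a^{-1}}$ with $\mu_a(S_{a^{-1}}\otimes\mathrm{id})\Delta_{a^{-1},a}=\varepsilon(\cdot)1_{A_a}=\mu_a(\mathrm{id}\otimes S_{a^{-1}})\Delta_{a,a^{-1}}$ ($\mu_a$ the multiplication of $A_a$); and algebra isomorphisms (conjugation) $\varphi_b=\varphi_b^a:A_a\to A_{bab^{-1}}$ with $\varphi_{bc}=\varphi_b\varphi_c$, $(\varphi_b\otimes\varphi_b)\Delta_{a,c}=\Delta_{bab^{-1},bcb^{-1}}\varphi_b$ and $\varepsilon\varphi_b=\varepsilon$. It is quasitriangular if it is equipped with invertible elements $R_{a,b}\in A_a\otimes A_b$ ($a,b\in G$) such that, for all $a,b,c\in G$: (i) $R_{a,b}\,\Delta_{a,b}(x)=\tau\big((\varphi_{a^{-1}}\otimes\mathrm{id}_{A_a})\Delta_{aba^{-1},a}(x)\big)\,R_{a,b}$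 for $x\in A_{ab}$, with $\tau:A_b\otimes A_a\to A_a\otimes A_b$ the flip; (ii) $(\mathrm{id}_{A_a}\otimes\Delta_{b,c})(R_{a,bc})=(R_{a,c})_{13}\,(R_{a,b})_{12}$ in $A_a\otimes A_b\otimes A_c$; (iii) $(\Delta_{a,b}\otimes\mathrm{id}_{A_c})(R_{ab,c})=\big[(\mathrm{id}_{A_a}\otimes\varphi_{b^{-1}})(R_{a,bcb^{-1}})\big]_{13}\,(R_{b,c})_{23}$ in $A_a\otimes A_b\otimes A_c$; (iv) $(\varphi_b\otimes\varphi_b)(R_{a,c})=R_{bab^{-1},bcb^{-1}}$. Here subscripts $12,13,23$ denote the legs of the tensor product in which the element is placed, with $1$ in the remaining leg. *)

theory Defs
  imports "HOL.Vector_Spaces" "HOL-Library.Function_Algebras" "HOL-Algebra.Group"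
begin

section \<open>Vector spaces, algebras and tensor products\<close>

text \<open>
  A vector space is given by a carrier inside a type of class \<open>ab_group_add\<close> together with
  a scalar multiplication. The carrier is needed because dual spaces and tensor products are proper
  subspaces of function types. Addition on function types is pointwise (HOL-Library.Function_Algebras).
\<close>

record ('k, 'v) kspace =
  carr :: "'v set"
  scl :: "'k \<Rightarrow> 'v \<Rightarrow> 'v"

record ('k, 'v) kalg = "('k, 'v) kspace" +
  amult :: "'v \<Rightarrow> 'v \<Rightarrow> 'v"
  aunit :: "'v"

definition is_kspace :: "('k::field, 'v::ab_group_add, 'z) kspace_scheme \<Rightarrow> bool" where
  "is_kspace V \<longleftrightarrow> vector_space (scl V) \<and> module.subspace (scl V) (carr V)"

definition linear_map ::
  "('k::field, 'v::ab_group_add, 'y) kspace_scheme \<Rightarrow> ('k, 'w::ab_group_add, 'z) kspace_scheme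
    \<Rightarrow> ('v \<Rightarrow> 'w) \<Rightarrow> bool" where
  "linear_map V W f \<longleftrightarrow>
     (\<forall>x\<in>carr V. f x \<in> carr W) \<and>
     (\<forall>x\<in>carr V. \<forall>y\<in>carr V. f (x + y) = f x + f y) \<and>
     (\<forall>c. \<forall>x\<in>carr V. f (scl V c x) = scl W c (f x))"

definition bilinear_map ::
  "('k::field, 'v::ab_group_add, 'x) kspace_scheme \<Rightarrow> ('k, 'w::ab_group_add, 'y) kspace_scheme
    \<Rightarrow> ('k, 'u::ab_group_add, 'z) kspace_scheme \<Rightarrow> ('v \<Rightarrow> 'w \<Rightarrow> 'u) \<Rightarrow> bool" where
  "bilinear_map V W U f \<longleftrightarrow>
     (\<forall>w\<in>carr W. linear_map V U (\<lambda>v. f v w)) \<and> (\<forall>v\<in>carr V. linear_map W U (f v))"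

definition kalgebra :: "('k::field, 'v::ab_group_add, 'z) kalg_scheme \<Rightarrow> bool" where
  "kalgebra A \<longleftrightarrow>
     is_kspace A \<and>
     bilinear_map A A A (amult A) \<and>
     (\<forall>x\<in>carr A. \<forall>y\<in>carr A. \<forall>z\<in>carr A. amult A (amult A x y) z = amult A x (amult A y z)) \<and>
     aunit A \<in> carr A \<and>
     (\<forall>x\<in>carr A. amult A (aunit A) x = x \<and> amult A x (aunit A) = x)"

definition alg_hom ::
  "('k::field, 'v::ab_group_add, 'y) kalg_scheme \<Rightarrow> ('k, 'w::ab_group_add, 'z) kalg_scheme
    \<Rightarrow> ('v \<Rightarrow> 'w) \<Rightarrow> bool" where
  "alg_hom A B f \<longleftrightarrow>
     linear_map A B f \<and>
     (\<forall>x\<in>carr A. \<forall>y\<in>carr A. f (amult A x y) = amult B (f x) (f y)) \<and>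
     f (aunit A) = aunit B"

definition alg_iso ::
  "('k::field, 'v::ab_group_add, 'y) kalg_scheme \<Rightarrow> ('k, 'w::ab_group_add, 'z) kalg_scheme
    \<Rightarrow> ('v \<Rightarrow> 'w) \<Rightarrow> bool" where
  "alg_iso A B f \<longleftrightarrow> alg_hom A B f \<and> bij_betw f (carr A) (carr B)"

definition ground :: "('k::field, 'k) kalg" where
  "ground = \<lparr>carr = UNIV, scl = (*), amult = (*), aunit = 1\<rparr>"

text \<open>
  The pure tensor \<open>v \<otimes> w\<close> is realised as evaluation at \<open>(v, w)\<close> of the
  bilinear forms on \<open>V \<times> W\<close>, and the tensor product consists of the finite sums of pure
  tensors. Over a field this is the usual tensor product: its universal property is the pair of
  lemmas \<open>tlift_tens\<close> and \<open>tlift_linear\<close> below.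
\<close>

definition tens ::
  "('k::field, 'v::ab_group_add, 'y) kspace_scheme \<Rightarrow> ('k, 'w::ab_group_add, 'z) kspace_scheme
    \<Rightarrow> 'v \<Rightarrow> 'w \<Rightarrow> (('v \<Rightarrow> 'w \<Rightarrow> 'k) \<Rightarrow> 'k)" where
  "tens V W v w = (\<lambda>B. if bilinear_map V W ground B then B v w else 0)"

definition tensor ::
  "('k::field, 'v::ab_group_add, 'y) kspace_scheme \<Rightarrow> ('k, 'w::ab_group_add, 'z) kspace_scheme
    \<Rightarrow> ('k, ('v \<Rightarrow> 'w \<Rightarrow> 'k) \<Rightarrow> 'k) kspace" where
  "tensor V W =
     \<lparr>carr = {\<Sum>(v, w)\<leftarrow>ps. tens V W v w | ps. set ps \<subseteq> carr V \<times> carr W},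
      scl = (\<lambda>c t B. c * t B)\<rparr>"

text \<open>
  The map on \<open>V \<otimes> W\<close> induced by a bilinear map \<open>f\<close>: write \<open>t\<close> as
  \<open>\<Sum> v\<^sub>i \<otimes> w\<^sub>i\<close> and return \<open>\<Sum> f v\<^sub>i w\<^sub>i\<close>.
\<close>

definition tlift ::
  "('k::field, 'v::ab_group_add, 'y) kspace_scheme \<Rightarrow> ('k, 'w::ab_group_add, 'z) kspace_scheme
    \<Rightarrow> ('v \<Rightarrow> 'w \<Rightarrow> 'u::ab_group_add) \<Rightarrow> (('v \<Rightarrow> 'w \<Rightarrow> 'k) \<Rightarrow> 'k) \<Rightarrow> 'u" where
  "tlift V W f t =
     (let ps = (SOME ps. set ps \<subseteq> carr V \<times> carr W \<and> t = (\<Sum>(v, w)\<leftarrow>ps. tens V W v w))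
      in \<Sum>(v, w)\<leftarrow>ps. f v w)"

lemma linear_map_sum_list:
  assumes f: "linear_map V W f" and V: "is_kspace V" and xs: "set xs \<subseteq> carr V"
  shows "sum_list xs \<in> carr V" "f (sum_list xs) = (\<Sum>x\<leftarrow>xs. f x)"
proof -
  interpret v: vector_space "scl V" using V by (simp add: is_kspace_def)
  have sub: "v.subspace (carr V)" using V by (simp add: is_kspace_def)
  have "f (0 + 0) = f 0 + f 0"
    using f v.subspace_0[OF sub] unfolding linear_map_def by blast
  hence f0: "f 0 = 0" by simp
  have "sum_list xs \<in> carr V \<and> f (sum_list xs) = (\<Sum>x\<leftarrow>xs. f x)"
    using xs
  proof (induction xs)
    case Nil
    show ?case using v.subspace_0[OF sub] f0 by simp
  next
    case (Cons x xs)
    then show ?case using v.subspace_add[OF sub] f unfolding linear_map_def by simp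
  qed
  thus "sum_list xs \<in> carr V" "f (sum_list xs) = (\<Sum>x\<leftarrow>xs. f x)" by auto
qed

lemma tens_sum_apply:
  assumes "bilinear_map V W ground B"
  shows "(\<Sum>(v, w)\<leftarrow>ps. tens V W v w) B = (\<Sum>(v, w)\<leftarrow>ps. B v w)"
  using assms by (induction ps) (auto simp: tens_def)

lemma functionals_separate_points:
  assumes U: "is_kspace U" and fg: "x \<in> carr U" "y \<in> carr U"
    and eq: "\<And>\<phi>. linear_map U ground \<phi> \<Longrightarrow> \<phi> x = \<phi> y"
  shows "x = y"
proof (rule ccontr)
  assume "x \<noteq> y"
  interpret u: vector_space "scl U" using U by (simp add: is_kspace_def)
  interpret k: vector_space "(*) :: 'a \<Rightarrow> 'a \<Rightarrow> 'a" by unfold_locales (auto simp: algebra_simps)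
  interpret p: vector_space_pair "scl U" "(*) :: 'a \<Rightarrow> 'a \<Rightarrow> 'a" ..
  have "u.independent {x - y}" using \<open>x \<noteq> y\<close> by (simp add: u.dependent_single)
  then obtain \<phi> where \<phi>: "Vector_Spaces.linear (scl U) ((*) :: 'a \<Rightarrow> 'a \<Rightarrow> 'a) \<phi>" "\<phi> (x - y) = 1"
    using p.linear_independent_extend[of "{x - y}" "\<lambda>_. 1"] by auto
  have "linear_map U ground \<phi>"
    using \<phi>(1) by (simp add: linear_map_def ground_def Vector_Spaces.linear_def module_hom_def
        module_hom_axioms_def)
  hence "\<phi> x = \<phi> y" by (rule eq)
  moreover have "\<phi> (x - y) = \<phi> x - \<phi> y"
    using \<phi>(1) by (rule p.linear_diff)
  ultimately show False using \<phi>(2) by simp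
qed

lemma tlift_sum:
  assumes f: "bilinear_map V W U f" and U: "is_kspace U" and ps: "set ps \<subseteq> carr V \<times> carr W"
  shows "tlift V W f (\<Sum>(v, w)\<leftarrow>ps. tens V W v w) = (\<Sum>(v, w)\<leftarrow>ps. f v w)"
proof -
  let ?t = "\<lambda>ps. \<Sum>(v, w)\<leftarrow>ps. tens V W v w"
  let ?s = "\<lambda>ps. \<Sum>(v, w)\<leftarrow>ps. f v w"
  define qs where "qs = (SOME qs. set qs \<subseteq> carr V \<times> carr W \<and> ?t ps = ?t qs)"
  have qs: "set qs \<subseteq> carr V \<times> carr W" "?t ps = ?t qs"
    using someI_ex[of "\<lambda>qs. set qs \<subseteq> carr V \<times> carr W \<and> ?t ps = ?t qs"] ps
    unfolding qs_def by blast+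
  have cl: "set (map (\<lambda>(v, w). f v w) rs) \<subseteq> carr U" if "set rs \<subseteq> carr V \<times> carr W" for rs
    using f that unfolding bilinear_map_def linear_map_def by fastforce
  have "linear_map U U id" by (simp add: linear_map_def)
  hence in_U: "?s ps \<in> carr U" "?s qs \<in> carr U"
    using linear_map_sum_list(1)[OF _ U cl] ps qs(1) by blast+
  have "?s ps = ?s qs"
  proof (rule functionals_separate_points[OF U in_U])
    fix \<phi> assume \<phi>: "linear_map U ground \<phi>"
    have B: "bilinear_map V W ground (\<lambda>v w. \<phi> (f v w))"
      using f \<phi> unfolding bilinear_map_def linear_map_def by simp
    have *: "\<phi> (?s rs) = ?t rs (\<lambda>v w. \<phi> (f v w))" if "set rs \<subseteq> carr V \<times> carr W" for rs
      unfolding tens_sum_apply[OF B] linear_map_sum_list(2)[OF \<phi> U cl[OF that]]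
      by (simp add: o_def case_prod_unfold)
    show "\<phi> (?s ps) = \<phi> (?s qs)"
      using *[OF ps] *[OF qs(1)] qs(2) by simp
  qed
  thus ?thesis by (simp add: tlift_def qs_def Let_def)
qed

lemma tlift_tens:
  assumes "bilinear_map V W U f" and "is_kspace U" and "v \<in> carr V" and "w \<in> carr W"
  shows "tlift V W f (tens V W v w) = f v w"
  using tlift_sum[OF assms(1,2), of "[(v, w)]"] assms(3,4) by simp

lemma tens_bilinear:
  assumes "is_kspace V" "is_kspace W"
  shows "bilinear_map V W (tensor V W) (tens V W)"
proof -
  interpret v: vector_space "scl V" using assms by (simp add: is_kspace_def)
  interpret w: vector_space "scl W" using assms by (simp add: is_kspace_def)
  have mem: "tens V W x y \<in> carr (tensor V W)" if "x \<in> carr V" "y \<in> carr W" for x y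
    unfolding tensor_def using that by (auto intro!: exI[of _ "[(x, y)]"])
  have v: "x + y \<in> carr V" "scl V c x \<in> carr V" if "x \<in> carr V" "y \<in> carr V" for x y c
    using assms(1) that unfolding is_kspace_def by (auto simp: v.subspace_add v.subspace_scale)
  have w: "x + y \<in> carr W" "scl W c x \<in> carr W" if "x \<in> carr W" "y \<in> carr W" for x y c
    using assms(2) that unfolding is_kspace_def by (auto simp: w.subspace_add w.subspace_scale)
  show ?thesis
    using mem v w unfolding bilinear_map_def linear_map_def
    by (auto simp: tens_def tensor_def fun_eq_iff bilinear_map_def linear_map_def ground_def)
qed

lemma tlift_linear:
  assumes f: "bilinear_map V W U f" and V: "is_kspace V" and W: "is_kspace W" and U: "is_kspace U"
  shows "linear_map (tensor V W) U (tlift V W f)"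
proof -
  interpret v: vector_space "scl V" using V by (simp add: is_kspace_def)
  have vs: "scl V c x \<in> carr V" if "x \<in> carr V" for x c
    using V that unfolding is_kspace_def by (auto simp: v.subspace_scale)
  interpret u: vector_space "scl U" using U by (simp add: is_kspace_def)
  have *: "\<exists>ps. set ps \<subseteq> carr V \<times> carr W \<and> t = (\<Sum>(v, w)\<leftarrow>ps. tens V W v w)"
    if "t \<in> carr (tensor V W)" for t
    using that by (auto simp: tensor_def)
  have fU: "(\<Sum>(v, w)\<leftarrow>ps. f v w) \<in> carr U" if "set ps \<subseteq> carr V \<times> carr W" for ps
  proof -
    have "set (map (\<lambda>(v, w). f v w) ps) \<subseteq> carr U"
      using f that unfolding bilinear_map_def linear_map_def by fastforce
    moreover have "linear_map U U id" by (simp add: linear_map_def)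
    ultimately show ?thesis using linear_map_sum_list(1)[OF _ U] by blast
  qed
  have sc: "(\<Sum>(v, w)\<leftarrow>map (apfst (scl V c)) ps. tens V W v w)
          = scl (tensor V W) c (\<Sum>(v, w)\<leftarrow>ps. tens V W v w)"
       "(\<Sum>(v, w)\<leftarrow>map (apfst (scl V c)) ps. f v w) = scl U c (\<Sum>(v, w)\<leftarrow>ps. f v w)"
    if "set ps \<subseteq> carr V \<times> carr W" for ps c
  proof -
    have tb: "tens V W (scl V c x) y = scl (tensor V W) c (tens V W x y)"
      if "x \<in> carr V" "y \<in> carr W" for x y
      using tens_bilinear[OF V W] that unfolding bilinear_map_def linear_map_def by blast
    have fb: "f (scl V c x) y = scl U c (f x y)" if "x \<in> carr V" "y \<in> carr W" for x y
      using f that unfolding bilinear_map_def linear_map_def by blast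
    show "(\<Sum>(v, w)\<leftarrow>map (apfst (scl V c)) ps. tens V W v w)
          = scl (tensor V W) c (\<Sum>(v, w)\<leftarrow>ps. tens V W v w)"
      using that tb
      by (induction ps) (auto simp: tensor_def fun_eq_iff algebra_simps)
    show "(\<Sum>(v, w)\<leftarrow>map (apfst (scl V c)) ps. f v w) = scl U c (\<Sum>(v, w)\<leftarrow>ps. f v w)"
      using that fb
      by (induction ps) (auto simp: u.scale_right_distrib)
  qed
  show ?thesis
    unfolding linear_map_def
  proof (intro conjI ballI allI)
    fix t assume "t \<in> carr (tensor V W)"
    then obtain ps where ps: "set ps \<subseteq> carr V \<times> carr W" "t = (\<Sum>(v, w)\<leftarrow>ps. tens V W v w)"
      using * by blast
    show "tlift V W f t \<in> carr U"
      using ps tlift_sum[OF f U ps(1)] fU by simp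
    fix c
    have "set (map (apfst (scl V c)) ps) \<subseteq> carr V \<times> carr W"
      using ps(1) vs by auto
    from tlift_sum[OF f U this] show "tlift V W f (scl (tensor V W) c t) = scl U c (tlift V W f t)"
      using sc[OF ps(1), of c] ps tlift_sum[OF f U ps(1)] by simp
  next
    fix t t' assume "t \<in> carr (tensor V W)" "t' \<in> carr (tensor V W)"
    then obtain ps qs where ps: "set ps \<subseteq> carr V \<times> carr W" "t = (\<Sum>(v, w)\<leftarrow>ps. tens V W v w)"
      and qs: "set qs \<subseteq> carr V \<times> carr W" "t' = (\<Sum>(v, w)\<leftarrow>qs. tens V W v w)"
      using * by metis
    show "tlift V W f (t + t') = tlift V W f t + tlift V W f t'"
      using tlift_sum[OF f U, of "ps @ qs"] tlift_sum[OF f U ps(1)] tlift_sum[OF f U qs(1)] ps qs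
      by simp
  qed
qed

definition tmap where
  "tmap V W V' W' f g = tlift V W (\<lambda>v w. tens V' W' (f v) (g w))"

text \<open>Threefold tensor products are bracketed as \<open>U \<otimes> (V \<otimes> W)\<close>.\<close>

definition tassoc where
  "tassoc U V W =
     tlift (tensor U V) W (\<lambda>t w. tlift U V (\<lambda>u v. tens U (tensor V W) u (tens V W v w)) t)"

definition tflip where
  "tflip V W = tlift V W (\<lambda>v w. tens W V w v)"

definition talg ::
  "('k::field, 'v::ab_group_add, 'y) kalg_scheme \<Rightarrow> ('k, 'w::ab_group_add, 'z) kalg_scheme
    \<Rightarrow> ('k, ('v \<Rightarrow> 'w \<Rightarrow> 'k) \<Rightarrow> 'k) kalg" where
  "talg A B =
     \<lparr>carr = carr (tensor A B), scl = scl (tensor A B),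
      amult = (\<lambda>t u. tlift A B (\<lambda>a b. tlift A B (\<lambda>a' b'. tens A B (amult A a a') (amult B b b')) u) t),
      aunit = tens A B (aunit A) (aunit B)\<rparr>"

definition leg12 where
  "leg12 A B C = tlift A B (\<lambda>x y. tens A (tensor B C) x (tens B C y (aunit C)))"

definition leg13 where
  "leg13 A B C = tlift A C (\<lambda>x z. tens A (tensor B C) x (tens B C (aunit B) z))"

definition leg23 where
  "leg23 A B C = tlift B C (\<lambda>y z. tens A (tensor B C) (aunit A) (tens B C y z))"


section \<open>Quasitriangular T-coalgebras\<close>

text \<open>
  The conjugation \<open>\<phi>\<^sub>b\<^sup>a : A\<^sub>a \<rightarrow> A\<^bsub>bab\<^sup>-\<^sup>1\<^esub>\<close> is written
  \<open>\<phi> b a\<close>; \<open>\<otimes>\<close>, \<open>inv\<close> and \<open>\<one>\<close> belong to the group \<open>G\<close>.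
\<close>

locale T_coalgebra = group G
  for G :: "'g monoid" (structure) +
  fixes A :: "'g \<Rightarrow> ('k::field, 'v::ab_group_add) kalg"
    and \<Delta> :: "'g \<Rightarrow> 'g \<Rightarrow> 'v \<Rightarrow> (('v \<Rightarrow> 'v \<Rightarrow> 'k) \<Rightarrow> 'k)"
    and \<epsilon> :: "'v \<Rightarrow> 'k"
    and S :: "'g \<Rightarrow> 'v \<Rightarrow> 'v"
    and \<phi> :: "'g \<Rightarrow> 'g \<Rightarrow> 'v \<Rightarrow> 'v"
  assumes algebra: "a \<in> carrier G \<Longrightarrow> kalgebra (A a)"
    and comult_hom: "\<lbrakk>a \<in> carrier G; b \<in> carrier G\<rbrakk> \<Longrightarrow>
      alg_hom (A (a \<otimes> b)) (talg (A a) (A b)) (\<Delta> a b)"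
    and counit_hom: "alg_hom (A \<one>) ground \<epsilon>"
    and coassoc: "\<lbrakk>a \<in> carrier G; b \<in> carrier G; c \<in> carrier G; x \<in> carr (A (a \<otimes> b \<otimes> c))\<rbrakk> \<Longrightarrow>
      tassoc (A a) (A b) (A c)
        (tmap (A (a \<otimes> b)) (A c) (tensor (A a) (A b)) (A c) (\<Delta> a b) id (\<Delta> (a \<otimes> b) c x)) =
      tmap (A a) (A (b \<otimes> c)) (A a) (tensor (A b) (A c)) id (\<Delta> b c) (\<Delta> a (b \<otimes> c) x)"
    and counit_right: "\<lbrakk>a \<in> carrier G; x \<in> carr (A a)\<rbrakk> \<Longrightarrow>
      tlift (A a) (A \<one>) (\<lambda>y z. scl (A a) (\<epsilon> z) y) (\<Delta> a \<one> x) = x"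
    and counit_left: "\<lbrakk>a \<in> carrier G; x \<in> carr (A a)\<rbrakk> \<Longrightarrow>
      tlift (A \<one>) (A a) (\<lambda>y z. scl (A a) (\<epsilon> y) z) (\<Delta> \<one> a x) = x"
    and antipode_linear: "a \<in> carrier G \<Longrightarrow> linear_map (A a) (A (inv a)) (S a)"
    and antipode_left: "\<lbrakk>a \<in> carrier G; x \<in> carr (A \<one>)\<rbrakk> \<Longrightarrow>
      tlift (A (inv a)) (A a) (\<lambda>y z. amult (A a) (S (inv a) y) z) (\<Delta> (inv a) a x) =
      scl (A a) (\<epsilon> x) (aunit (A a))"
    and antipode_right: "\<lbrakk>a \<in> carrier G; x \<in> carr (A \<one>)\<rbrakk> \<Longrightarrow>
      tlift (A a) (A (inv a)) (\<lambda>y z. amult (A a) y (S (inv a) z)) (\<Delta> a (inv a) x) =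
      scl (A a) (\<epsilon> x) (aunit (A a))"
    and conj_iso: "\<lbrakk>a \<in> carrier G; b \<in> carrier G\<rbrakk> \<Longrightarrow>
      alg_iso (A a) (A (b \<otimes> a \<otimes> inv b)) (\<phi> b a)"
    and conj_mult: "\<lbrakk>a \<in> carrier G; b \<in> carrier G; c \<in> carrier G; x \<in> carr (A a)\<rbrakk> \<Longrightarrow>
      \<phi> (b \<otimes> c) a x = \<phi> b (c \<otimes> a \<otimes> inv c) (\<phi> c a x)"
    and conj_comult: "\<lbrakk>a \<in> carrier G; b \<in> carrier G; c \<in> carrier G; x \<in> carr (A (a \<otimes> c))\<rbrakk> \<Longrightarrow>
      tmap (A a) (A c) (A (b \<otimes> a \<otimes> inv b)) (A (b \<otimes> c \<otimes> inv b)) (\<phi> b a) (\<phi> b c) (\<Delta> a c x) =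
      \<Delta> (b \<otimes> a \<otimes> inv b) (b \<otimes> c \<otimes> inv b) (\<phi> b (a \<otimes> c) x)"
    and conj_counit: "\<lbrakk>b \<in> carrier G; x \<in> carr (A \<one>)\<rbrakk> \<Longrightarrow> \<epsilon> (\<phi> b \<one> x) = \<epsilon> x"

locale quasitriangular_T_coalgebra = T_coalgebra G A \<Delta> \<epsilon> S \<phi>
  for G :: "'g monoid" (structure)
    and A :: "'g \<Rightarrow> ('k::field, 'v::ab_group_add) kalg" and \<Delta> \<epsilon> S \<phi> +
  fixes R :: "'g \<Rightarrow> 'g \<Rightarrow> (('v \<Rightarrow> 'v \<Rightarrow> 'k) \<Rightarrow> 'k)"
  assumes R_invertible: "\<lbrakk>a \<in> carrier G; b \<in> carrier G\<rbrakk> \<Longrightarrow>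
      R a b \<in> carr (talg (A a) (A b)) \<and>
      (\<exists>R' \<in> carr (talg (A a) (A b)).
         amult (talg (A a) (A b)) (R a b) R' = aunit (talg (A a) (A b)) \<and>
         amult (talg (A a) (A b)) R' (R a b) = aunit (talg (A a) (A b)))"
    and R_comult: "\<lbrakk>a \<in> carrier G; b \<in> carrier G; x \<in> carr (A (a \<otimes> b))\<rbrakk> \<Longrightarrow>
      amult (talg (A a) (A b)) (R a b) (\<Delta> a b x) =
      amult (talg (A a) (A b))
        (tflip (A b) (A a)
          (tmap (A (a \<otimes> b \<otimes> inv a)) (A a) (A b) (A a) (\<phi> (inv a) (a \<otimes> b \<otimes> inv a)) id
            (\<Delta> (a \<otimes> b \<otimes> inv a) a x)))
        (R a b)"
    and R_comult_right: "\<lbrakk>a \<in> carrier G; b \<in> carrier G; c \<in> carrier G\<rbrakk> \<Longrightarrow>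
      tmap (A a) (A (b \<otimes> c)) (A a) (tensor (A b) (A c)) id (\<Delta> b c) (R a (b \<otimes> c)) =
      amult (talg (A a) (talg (A b) (A c)))
        (leg13 (A a) (A b) (A c) (R a c)) (leg12 (A a) (A b) (A c) (R a b))"
    and R_comult_left: "\<lbrakk>a \<in> carrier G; b \<in> carrier G; c \<in> carrier G\<rbrakk> \<Longrightarrow>
      tassoc (A a) (A b) (A c)
        (tmap (A (a \<otimes> b)) (A c) (tensor (A a) (A b)) (A c) (\<Delta> a b) id (R (a \<otimes> b) c)) =
      amult (talg (A a) (talg (A b) (A c)))
        (leg13 (A a) (A b) (A c)
          (tmap (A a) (A (b \<otimes> c \<otimes> inv b)) (A a) (A c) id (\<phi> (inv b) (b \<otimes> c \<otimes> inv b))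
            (R a (b \<otimes> c \<otimes> inv b))))
        (leg23 (A a) (A b) (A c) (R b c))"
    and R_conj: "\<lbrakk>a \<in> carrier G; b \<in> carrier G; c \<in> carrier G\<rbrakk> \<Longrightarrow>
      tmap (A a) (A c) (A (b \<otimes> a \<otimes> inv b)) (A (b \<otimes> c \<otimes> inv b)) (\<phi> b a) (\<phi> b c) (R a c) =
      R (b \<otimes> a \<otimes> inv b) (b \<otimes> c \<otimes> inv b)"


section \<open>Hopf algebras, their automorphisms and their duals\<close>

text \<open>
  The underlying ring of a Hopf algebra is the whole type \<open>'h\<close>. The class \<open>ring_1\<close>
  excludes the zero ring, which is no restriction since the counit is unital.
\<close>

record ('k, 'h) hopf =
  hscl :: "'k \<Rightarrow> 'h \<Rightarrow> 'h"
  comult :: "'h \<Rightarrow> (('h \<Rightarrow> 'h \<Rightarrow> 'k) \<Rightarrow> 'k)"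
  counit :: "'h \<Rightarrow> 'k"
  antipode :: "'h \<Rightarrow> 'h"

definition alg :: "('k::field, 'h::ring_1) hopf \<Rightarrow> ('k, 'h) kalg" where
  "alg H = \<lparr>carr = UNIV, scl = hscl H, amult = (*), aunit = 1\<rparr>"

text \<open>Sweedler sums \<open>\<Sum> f h\<^sub>1 h\<^sub>2\<close> and \<open>\<Sum> f h\<^sub>1 h\<^sub>2 h\<^sub>3\<close>.\<close>

definition sweedler2 ::
  "('k::field, 'h::ring_1) hopf \<Rightarrow> ('h \<Rightarrow> 'h \<Rightarrow> 'u::ab_group_add) \<Rightarrow> 'h \<Rightarrow> 'u" where
  "sweedler2 H f h = tlift (alg H) (alg H) f (comult H h)"

definition sweedler3 ::
  "('k::field, 'h::ring_1) hopf \<Rightarrow> ('h \<Rightarrow> 'h \<Rightarrow> 'h \<Rightarrow> 'u::ab_group_add) \<Rightarrow> 'h \<Rightarrow> 'u" where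
  "sweedler3 H f = sweedler2 H (\<lambda>h1 h'. sweedler2 H (\<lambda>h2 h3. f h1 h2 h3) h')"

definition hopf_algebra :: "('k::field, 'h::ring_1) hopf \<Rightarrow> bool" where
  "hopf_algebra H \<longleftrightarrow>
     kalgebra (alg H) \<and>
     alg_hom (alg H) (talg (alg H) (alg H)) (comult H) \<and>
     alg_hom (alg H) ground (counit H) \<and>
     (\<forall>h. tassoc (alg H) (alg H) (alg H)
            (tmap (alg H) (alg H) (tensor (alg H) (alg H)) (alg H) (comult H) id (comult H h)) =
          tmap (alg H) (alg H) (alg H) (tensor (alg H) (alg H)) id (comult H) (comult H h)) \<and>
     (\<forall>h. sweedler2 H (\<lambda>h1 h2. hscl H (counit H h1) h2) h = h) \<and>
     (\<forall>h. sweedler2 H (\<lambda>h1 h2. hscl H (counit H h2) h1) h = h) \<and>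
     linear_map (alg H) (alg H) (antipode H) \<and>
     (\<forall>h. sweedler2 H (\<lambda>h1 h2. antipode H h1 * h2) h = hscl H (counit H h) 1) \<and>
     (\<forall>h. sweedler2 H (\<lambda>h1 h2. h1 * antipode H h2) h = hscl H (counit H h) 1)"

definition hopf_aut :: "('k::field, 'h::ring_1) hopf \<Rightarrow> ('h \<Rightarrow> 'h) set" where
  "hopf_aut H =
     {f. alg_iso (alg H) (alg H) f \<and>
         (\<forall>h. comult H (f h) = tmap (alg H) (alg H) (alg H) (alg H) f f (comult H h)) \<and>
         (\<forall>h. counit H (f h) = counit H h) \<and>
         (\<forall>h. antipode H (f h) = f (antipode H h))}"

text \<open>\<open>inverse_fun f\<close> avoids the symbol \<open>inv\<close>, which HOL-Algebra uses for groups.\<close>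

abbreviation inverse_fun :: "('a \<Rightarrow> 'b) \<Rightarrow> 'b \<Rightarrow> 'a" where
  "inverse_fun f \<equiv> inv_into UNIV f"

definition aut_group :: "('k::field, 'h::ring_1) hopf \<Rightarrow> (('h \<Rightarrow> 'h) \<times> ('h \<Rightarrow> 'h)) monoid" where
  "aut_group H =
     \<lparr>carrier = hopf_aut H \<times> hopf_aut H,
      mult = (\<lambda>(\<alpha>, \<beta>) (\<gamma>, \<delta>). (\<alpha> \<circ> \<gamma>, \<delta> \<circ> inverse_fun \<gamma> \<circ> \<beta> \<circ> \<gamma>)),
      one = (id, id)\<rparr>"

definition dual :: "('k::field, 'h::ring_1) hopf \<Rightarrow> ('k, 'h \<Rightarrow> 'k) kalg" where
  "dual H =
     \<lparr>carr = {p. linear_map (alg H) ground p}, scl = (\<lambda>c p h. c * p h),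
      amult = (\<lambda>p q. sweedler2 H (\<lambda>h1 h2. p h1 * q h2)), aunit = counit H\<rparr>"

text \<open>\<open>p\<^sub>1 \<otimes> p\<^sub>2\<close> is determined by \<open>p (h l) = p\<^sub>1 h p\<^sub>2 l\<close>.\<close>

definition dual_comult ::
  "('k::field, 'h::ring_1) hopf \<Rightarrow> ('h \<Rightarrow> 'k) \<Rightarrow> ((('h \<Rightarrow> 'k) \<Rightarrow> ('h \<Rightarrow> 'k) \<Rightarrow> 'k) \<Rightarrow> 'k)" where
  "dual_comult H p =
     (THE t. t \<in> carr (tensor (dual H) (dual H)) \<and>
             (\<forall>h l. tlift (dual H) (dual H) (\<lambda>p1 p2. p1 h * p2 l) t = p (h * l)))"

definition lact :: "'h::ring_1 \<Rightarrow> ('h \<Rightarrow> 'k) \<Rightarrow> ('h \<Rightarrow> 'k)" (infixr \<open>\<rightharpoonup>\<close> 75) where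
  "h \<rightharpoonup> p = (\<lambda>l. p (l * h))"

definition ract :: "('h::ring_1 \<Rightarrow> 'k) \<Rightarrow> 'h \<Rightarrow> ('h \<Rightarrow> 'k)" (infixl \<open>\<leftharpoonup>\<close> 74) where
  "p \<leftharpoonup> h = (\<lambda>l. p (h * l))"

definition dual_basis :: "('k::field, 'h::ring_1) hopf \<Rightarrow> 'h set \<Rightarrow> 'h \<Rightarrow> ('h \<Rightarrow> 'k)" where
  "dual_basis H E e = (\<lambda>h. module.representation (hscl H) E h e)"


section \<open>The T-coalgebra of diagonal crossed products\<close>

type_synonym ('k, 'h) dcp = "(('h \<Rightarrow> 'k) \<Rightarrow> 'h \<Rightarrow> 'k) \<Rightarrow> 'k"

text \<open>The element \<open>p \<bowtie> h\<close>.\<close>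

definition bt :: "('k::field, 'h::ring_1) hopf \<Rightarrow> ('h \<Rightarrow> 'k) \<Rightarrow> 'h \<Rightarrow> ('k, 'h) dcp" where
  "bt H p h = tens (dual H) (alg H) p h"

definition DT ::
  "('k::field, 'h::ring_1) hopf \<Rightarrow> ('h \<Rightarrow> 'h) \<times> ('h \<Rightarrow> 'h) \<Rightarrow> ('k, ('k, 'h) dcp) kalg" where
  "DT H = (\<lambda>(\<alpha>, \<beta>).
     \<lparr>carr = carr (tensor (dual H) (alg H)), scl = scl (tensor (dual H) (alg H)),
      amult = (\<lambda>t u.
        tlift (dual H) (alg H) (\<lambda>p h. tlift (dual H) (alg H) (\<lambda>q l.
          sweedler3 H (\<lambda>h1 h2 h3.
            bt H (amult (dual H) p (\<alpha> h1 \<rightharpoonup> q \<leftharpoonup> inverse_fun (antipode H) (\<beta> h3))) (h2 * l)) h) u) t),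
      aunit = bt H (counit H) 1\<rparr>)"

definition DT_comult ::
  "('k::field, 'h::ring_1) hopf \<Rightarrow> ('h \<Rightarrow> 'h) \<times> ('h \<Rightarrow> 'h) \<Rightarrow> ('h \<Rightarrow> 'h) \<times> ('h \<Rightarrow> 'h)
    \<Rightarrow> ('k, 'h) dcp \<Rightarrow> ((('k, 'h) dcp \<Rightarrow> ('k, 'h) dcp \<Rightarrow> 'k) \<Rightarrow> 'k)" where
  "DT_comult H = (\<lambda>(\<alpha>, \<beta>) (\<gamma>, \<delta>).
     tlift (dual H) (alg H) (\<lambda>p h.
       tlift (dual H) (dual H) (\<lambda>p1 p2.
         sweedler2 H (\<lambda>h1 h2.
           tens (DT H (\<alpha>, \<beta>)) (DT H (\<gamma>, \<delta>))
             (bt H p2 (\<gamma> h1)) (bt H p1 ((inverse_fun \<gamma> \<circ> \<beta> \<circ> \<gamma>) h2))) h)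
         (dual_comult H p)))"

definition DT_counit :: "('k::field, 'h::ring_1) hopf \<Rightarrow> ('k, 'h) dcp \<Rightarrow> 'k" where
  "DT_counit H = tlift (dual H) (alg H) (\<lambda>p h. p 1 * counit H h)"

definition DT_conj ::
  "('k::field, 'h::ring_1) hopf \<Rightarrow> ('h \<Rightarrow> 'h) \<times> ('h \<Rightarrow> 'h) \<Rightarrow> ('h \<Rightarrow> 'h) \<times> ('h \<Rightarrow> 'h)
    \<Rightarrow> ('k, 'h) dcp \<Rightarrow> ('k, 'h) dcp" where
  "DT_conj H = (\<lambda>(\<alpha>, \<beta>) (\<gamma>, \<delta>).
     tlift (dual H) (alg H) (\<lambda>p h.
       bt H (p \<circ> \<beta> \<circ> inverse_fun \<alpha>) ((\<alpha> \<circ> inverse_fun \<gamma> \<circ> inverse_fun \<beta> \<circ> \<gamma>) h)))"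

definition DT_antipode ::
  "('k::field, 'h::ring_1) hopf \<Rightarrow> ('h \<Rightarrow> 'h) \<times> ('h \<Rightarrow> 'h) \<Rightarrow> ('k, 'h) dcp \<Rightarrow> ('k, 'h) dcp" where
  "DT_antipode H = (\<lambda>(\<alpha>, \<beta>).
     tlift (dual H) (alg H) (\<lambda>p h.
       amult (DT H (inv\<^bsub>aut_group H\<^esub> (\<alpha>, \<beta>)))
         (bt H (counit H) ((\<alpha> \<circ> \<beta>) (antipode H h)))
         (bt H (p \<circ> inverse_fun (antipode H)) 1)))"

definition DT_R ::
  "('k::field, 'h::ring_1) hopf \<Rightarrow> 'h set \<Rightarrow> ('h \<Rightarrow> 'h) \<times> ('h \<Rightarrow> 'h) \<Rightarrow> ('h \<Rightarrow> 'h) \<times> ('h \<Rightarrow> 'h)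
    \<Rightarrow> ((('k, 'h) dcp \<Rightarrow> ('k, 'h) dcp \<Rightarrow> 'k) \<Rightarrow> 'k)" where
  "DT_R H E = (\<lambda>(\<alpha>, \<beta>) (\<gamma>, \<delta>).
     \<Sum>e\<in>E. tens (DT H (\<alpha>, \<beta>)) (DT H (\<gamma>, \<delta>))
       (bt H (counit H) (inverse_fun \<beta> e)) (bt H (dual_basis H E e) 1))"

end

theory Submission
  imports Defs
begin

text \<open>
  Since \<open>H\<close> is finite-dimensional, an element \<open>t\<close> of \<open>H\<^sup>* \<otimes> H\<close> is determined by the numbers
  \<open>ev t x f\<close>, where \<open>ev (p \<bowtie> h) x f = p(x) f(h)\<close> for \<open>x \<in> H\<close> and \<open>f \<in> H\<^sup>*\<close>. In these terms the
  comultiplication pulls back products, sending \<open>t\<close> to \<open>(x, f, y, g) \<mapsto> ev t (y x) ((f \<circ> \<gamma>) (g \<circ> \<gamma>\<^sup>-\<^sup>1 \<beta> \<gamma>))\<close>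
  (whence coassociativity), conjugation pulls back along automorphisms, and the \<open>R\<close>-matrix of \<open>(\<alpha>, \<beta>)\<close> is
  \<open>(x, f, y, g) \<mapsto> \<epsilon>(x) f(\<beta>\<^sup>-\<^sup>1(y)) g(1)\<close>. The identities that involve the crossed product are checked
  on pure tensors: after summing over dual bases, each reduces to coassociativity, multiplicativity of the
  coproduct, and one cancellation \<open>h\<^sub>2 S\<^sup>-\<^sup>1(h\<^sub>1) = \<epsilon>(h)\<close>.
\<close>

section \<open>Linear maps and tensor products\<close>

text \<open>The group law of G is dictated by multiplicativity of the comultiplication. In a product
  of two coproducts the argument of \<open>q\<close> contains
  \<open>\<gamma>(\<tau>(a')) S'(\<beta>(\<gamma>(c)))\<close> between its outer factors, where c
  and a' are neighbouring legs of h and \<tau> is the automorphism applied in the second tensor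
  factor. This cancels once \<open>\<gamma> \<tau> = \<beta> \<gamma>\<close>, so
  \<open>\<tau> = \<gamma>\<^sup>-\<^sup>1 \<beta> \<gamma>\<close>, and the automorphisms left at
  the two ends are \<open>\<alpha> \<gamma>\<close> and \<open>\<delta> \<tau>\<close>, the
  components of the product in G. The obstacle that shapes the proof is linearity: a Sweedler sum is
  defined by a lift that is meaningful for bilinear arguments, and formulas over the dual simplify
  for linear functionals. Identities are therefore reduced to scalars, where coassociativity asks
  for linearity in each argument and all sums are finite sums over a basis. The definition of a Hopf
  algebra does not state that S reverses products and coproducts; both facts are derived first and
  then transferred to \<open>S'\<close>.\<close>

lemma kspace_closed:
  assumes "is_kspace V"
  shows "0 \<in> carr V" "x \<in> carr V \<Longrightarrow> y \<in> carr V \<Longrightarrow> x + y \<in> carr V"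
    "x \<in> carr V \<Longrightarrow> scl V c x \<in> carr V"
    "(\<And>i. i \<in> I \<Longrightarrow> g i \<in> carr V) \<Longrightarrow> sum g I \<in> carr V"
proof -
  interpret v: vector_space "scl V" using assms by (simp add: is_kspace_def)
  have s: "v.subspace (carr V)" using assms by (simp add: is_kspace_def)
  show "0 \<in> carr V" "x \<in> carr V \<Longrightarrow> y \<in> carr V \<Longrightarrow> x + y \<in> carr V"
    "x \<in> carr V \<Longrightarrow> scl V c x \<in> carr V"
    using s by (auto simp: v.subspace_def)
  show "(\<And>i. i \<in> I \<Longrightarrow> g i \<in> carr V) \<Longrightarrow> sum g I \<in> carr V"
    by (rule v.subspace_sum[OF s])
qed

lemma kspace_zero_scale:
  assumes "is_kspace V" shows "scl V 0 x = 0" "scl V 1 x = x" "scl V c 0 = 0"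
proof -
  interpret v: vector_space "scl V" using assms by (simp add: is_kspace_def)
  show "scl V 0 x = 0" "scl V 1 x = x" "scl V c 0 = 0" by simp_all
qed

lemma kspace_scale_distrib:
  assumes "is_kspace V"
  shows "scl V c (x + y) = scl V c x + scl V c y" "scl V (c + d) x = scl V c x + scl V d x"
    "scl V c (scl V d x) = scl V (c * d) x"
proof -
  interpret v: vector_space "scl V" using assms by (simp add: is_kspace_def)
  show "scl V c (x + y) = scl V c x + scl V c y" "scl V (c + d) x = scl V c x + scl V d x"
    "scl V c (scl V d x) = scl V (c * d) x"
    by (simp_all add: v.scale_right_distrib v.scale_left_distrib)
qed

lemma linear_mapI:
  assumes "\<And>x. x \<in> carr V \<Longrightarrow> f x \<in> carr W"
    and "\<And>x y. x \<in> carr V \<Longrightarrow> y \<in> carr V \<Longrightarrow> f (x + y) = f x + f y"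
    and "\<And>c x. x \<in> carr V \<Longrightarrow> f (scl V c x) = scl W c (f x)"
  shows "linear_map V W f"
  using assms by (simp add: linear_map_def)

lemma linear_mapD:
  assumes "linear_map V W f"
  shows "x \<in> carr V \<Longrightarrow> f x \<in> carr W"
    "x \<in> carr V \<Longrightarrow> y \<in> carr V \<Longrightarrow> f (x + y) = f x + f y"
    "x \<in> carr V \<Longrightarrow> f (scl V c x) = scl W c (f x)"
  using assms by (simp_all add: linear_map_def)

lemma linear_map_zero:
  assumes "is_kspace V" "linear_map V W f" shows "f 0 = 0"
  using linear_mapD(2)[OF assms(2), of 0 0] kspace_closed(1)[OF assms(1)] by simp

lemma linear_map_sum:
  assumes V: "is_kspace V" and f: "linear_map V W f" and g: "\<And>i. i \<in> I \<Longrightarrow> g i \<in> carr V"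
  shows "f (sum g I) = (\<Sum>i\<in>I. f (g i))"
  using g
  by (induction I rule: infinite_finite_induct)
    (auto simp: linear_map_zero[OF V f] linear_mapD(2)[OF f] kspace_closed[OF V])

lemma linear_map_comp:
  assumes "linear_map V W f" "linear_map W U g" shows "linear_map V U (\<lambda>x. g (f x))"
  using assms by (simp add: linear_map_def)

lemma linear_map_plus:
  assumes "is_kspace W" "linear_map V W f" "linear_map V W g"
  shows "linear_map V W (\<lambda>x. f x + g x)"
  using assms
  by (auto simp: linear_map_def kspace_closed kspace_scale_distrib)

lemma linear_map_const_zero: "is_kspace W \<Longrightarrow> linear_map V W (\<lambda>x. 0)"
  by (auto simp: linear_map_def kspace_closed kspace_zero_scale)

lemma linear_map_setsum:
  assumes "is_kspace W" "\<And>i. i \<in> I \<Longrightarrow> linear_map V W (f i)"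
  shows "linear_map V W (\<lambda>x. \<Sum>i\<in>I. f i x)"
  using assms(2)
  by (induction I rule: infinite_finite_induct)
    (auto intro: linear_map_const_zero linear_map_plus assms(1))

lemma linear_map_ident: "linear_map V V (\<lambda>x. x)" "linear_map V V id"
  by (simp_all add: linear_map_def)

lemma linear_map_scl:
  assumes "is_kspace W" "linear_map V W f" shows "linear_map V W (\<lambda>x. scl W c (f x))"
  using assms by (auto simp: linear_map_def kspace_closed kspace_scale_distrib mult.commute)

lemma linear_map_scl_scalar:
  assumes "is_kspace W" "linear_map V ground f" "w \<in> carr W"
  shows "linear_map V W (\<lambda>x. scl W (f x) w)"
  using assms by (auto simp: linear_map_def ground_def kspace_closed kspace_scale_distrib)

section \<open>Bilinear maps and scalar-valued forms\<close>

lemma bilinear_mapI: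
  assumes "\<And>w. w \<in> carr W \<Longrightarrow> linear_map V U (\<lambda>v. f v w)"
    and "\<And>v. v \<in> carr V \<Longrightarrow> linear_map W U (\<lambda>w. f v w)"
  shows "bilinear_map V W U f"
  using assms by (simp add: bilinear_map_def)

lemma bilinear_mapD:
  assumes "bilinear_map V W U f"
  shows "w \<in> carr W \<Longrightarrow> linear_map V U (\<lambda>v. f v w)" "v \<in> carr V \<Longrightarrow> linear_map W U (\<lambda>w. f v w)"
    "v \<in> carr V \<Longrightarrow> w \<in> carr W \<Longrightarrow> f v w \<in> carr U"
  using assms by (auto simp: bilinear_map_def linear_map_def)

lemma bilinear_map_comp:
  assumes "bilinear_map V' W' U B" "linear_map V V' f" "linear_map W W' g"
  shows "bilinear_map V W U (\<lambda>v w. B (f v) (g w))"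
  using assms unfolding bilinear_map_def
  by (auto intro: linear_map_comp[of _ V' f] linear_map_comp[of _ W' g] dest: linear_mapD(1))

lemma bilinear_map_post:
  assumes "bilinear_map V W U B" "linear_map U U' f"
  shows "bilinear_map V W U' (\<lambda>v w. f (B v w))"
  using assms unfolding bilinear_map_def by (auto intro: linear_map_comp)

lemma kspace_ground: "is_kspace ground"
proof -
  interpret k: vector_space "(*) :: 'a::field \<Rightarrow> 'a \<Rightarrow> 'a" by unfold_locales (auto simp: algebra_simps)
  show "is_kspace (ground :: ('a, 'a) kalg)"
    using k.subspace_UNIV k.vector_space_axioms by (simp add: is_kspace_def ground_def)
qed

lemma ground_simps [simp]:
  "carr ground = UNIV" "scl ground = (*)" "amult ground = (*)" "aunit ground = 1"
  by (simp_all add: ground_def)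

lemma bilinear_map_ground_mult:
  assumes "linear_map V ground f" "linear_map W ground g"
  shows "bilinear_map V W ground (\<lambda>v w. f v * g w)"
  using assms by (auto simp: bilinear_map_def linear_map_def algebra_simps)

lemma tens_apply: "bilinear_map V W ground B \<Longrightarrow> tens V W v w B = B v w"
  by (simp add: tens_def)

lemma tensor_scl [simp]: "scl (tensor V W) c t B = c * t B"
  by (simp add: tensor_def)

lemma tensor_elim:
  assumes "t \<in> carr (tensor V W)"
  obtains ps where "set ps \<subseteq> carr V \<times> carr W" "t = (\<Sum>(v, w)\<leftarrow>ps. tens V W v w)"
  using assms by (auto simp: tensor_def)

lemma tensorI:
  "set ps \<subseteq> carr V \<times> carr W \<Longrightarrow> (\<Sum>(v, w)\<leftarrow>ps. tens V W v w) \<in> carr (tensor V W)"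
  unfolding tensor_def by auto

section \<open>The tensor product as a vector space, and linear maps out of it\<close>

lemma kspace_tensor:
  assumes V: "is_kspace V" and W: "is_kspace W"
  shows "is_kspace (tensor V W)"
proof -
  have vs: "vector_space (scl (tensor V W))"
    by unfold_locales (auto simp: fun_eq_iff algebra_simps)
  then interpret t: vector_space "scl (tensor V W)" .
  have "t.subspace (carr (tensor V W))"
  proof (rule t.subspaceI)
    show "0 \<in> carr (tensor V W)"
      unfolding tensor_def by (auto intro!: exI[of _ "[]"])
  next
    fix x y assume "x \<in> carr (tensor V W)" "y \<in> carr (tensor V W)"
    then obtain ps qs where "set ps \<subseteq> carr V \<times> carr W" "x = (\<Sum>(v, w)\<leftarrow>ps. tens V W v w)"
      "set qs \<subseteq> carr V \<times> carr W" "y = (\<Sum>(v, w)\<leftarrow>qs. tens V W v w)"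
      by (elim tensor_elim)
    thus "x + y \<in> carr (tensor V W)"
      unfolding tensor_def by (auto intro!: exI[of _ "ps @ qs"])
  next
    fix c x assume "x \<in> carr (tensor V W)"
    then obtain ps where ps: "set ps \<subseteq> carr V \<times> carr W" "x = (\<Sum>(v, w)\<leftarrow>ps. tens V W v w)"
      by (rule tensor_elim)
    have "scl (tensor V W) c (\<Sum>(v, w)\<leftarrow>ps. tens V W v w) =
        (\<Sum>(v, w)\<leftarrow>map (\<lambda>(v, w). (scl V c v, w)) ps. tens V W v w)"
      using ps(1)
    proof (induction ps)
      case (Cons a ps)
      have "scl (tensor V W) c (tens V W v w) = tens V W (scl V c v) w"
        if "v \<in> carr V" "w \<in> carr W" for v w
        using bilinear_mapD(1)[OF tens_bilinear[OF V W] that(2)] that(1)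
        by (simp add: linear_map_def)
      with Cons show ?case
        by (cases a) (auto simp: fun_eq_iff algebra_simps)
    qed simp
    moreover have "set (map (\<lambda>(v, w). (scl V c v, w)) ps) \<subseteq> carr V \<times> carr W"
      using ps(1) kspace_closed(3)[OF V] by auto
    ultimately show "scl (tensor V W) c x \<in> carr (tensor V W)"
      unfolding ps(2) by (simp only: tensorI)
  qed
  with vs show ?thesis by (simp add: is_kspace_def)
qed

lemma tens_carr:
  "is_kspace V \<Longrightarrow> is_kspace W \<Longrightarrow> v \<in> carr V \<Longrightarrow> w \<in> carr W \<Longrightarrow> tens V W v w \<in> carr (tensor V W)"
  using bilinear_mapD(3)[OF tens_bilinear] by blast

lemma tensor_linear_eqI:
  assumes V: "is_kspace V" and W: "is_kspace W"
    and f: "linear_map (tensor V W) U f" and g: "linear_map (tensor V W) U g"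
    and eq: "\<And>v w. v \<in> carr V \<Longrightarrow> w \<in> carr W \<Longrightarrow> f (tens V W v w) = g (tens V W v w)"
    and t: "t \<in> carr (tensor V W)"
  shows "f t = g t"
proof -
  obtain ps where ps: "set ps \<subseteq> carr V \<times> carr W" "t = (\<Sum>(v, w)\<leftarrow>ps. tens V W v w)"
    using t by (rule tensor_elim)
  let ?xs = "map (\<lambda>(v, w). tens V W v w) ps"
  have sub: "set ?xs \<subseteq> carr (tensor V W)" using ps(1) tens_carr[OF V W] by auto
  have "map f ?xs = map g ?xs" using ps(1) eq by auto
  thus ?thesis
    unfolding ps(2) linear_map_sum_list(2)[OF f kspace_tensor[OF V W] sub]
      linear_map_sum_list(2)[OF g kspace_tensor[OF V W] sub] by (simp only:)
qed

lemma tensor_apply_linear: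
  "linear_map (tensor V W) ground (\<lambda>t. t B)"
  by (simp add: linear_map_def)

text \<open>A tensor is itself a function on bilinear forms, so a functional applied to a lifted
  value is that function evaluated at the composed form. Coordinates of lifted maps are computed in
  this way, with no choice of a representation by pure tensors.\<close>

lemma tlift_apply:
  assumes "is_kspace V" "is_kspace W" "is_kspace U" "bilinear_map V W U f" "linear_map U ground \<phi>"
    "t \<in> carr (tensor V W)"
  shows "\<phi> (tlift V W f t) = t (\<lambda>v w. \<phi> (f v w))"
proof (rule tensor_linear_eqI[OF assms(1,2) _ _ _ assms(6)])
  show "linear_map (tensor V W) ground (\<lambda>t. \<phi> (tlift V W f t))"
    using assms by (blast intro: linear_map_comp tlift_linear)
  show "linear_map (tensor V W) ground (\<lambda>t. t (\<lambda>v w. \<phi> (f v w)))"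
    by (rule tensor_apply_linear)
  show "\<phi> (tlift V W f (tens V W v w)) = tens V W v w (\<lambda>v w. \<phi> (f v w))"
    if "v \<in> carr V" "w \<in> carr W" for v w
    using that assms by (simp add: tlift_tens[of V W U] tens_apply bilinear_map_post)
qed

lemma tlift_carr:
  assumes "is_kspace V" "is_kspace W" "is_kspace U" "bilinear_map V W U f" "t \<in> carr (tensor V W)"
  shows "tlift V W f t \<in> carr U"
  using linear_mapD(1)[OF tlift_linear] assms by blast

text \<open>Agreement is asked on the carriers, and bilinearity of \<open>g\<close> is inherited
  from \<open>f\<close>. This serves maps given by a formula that simplifies for linear functionals,
  as in the comultiplication.\<close>

lemma tlift_cong:
  assumes "\<And>v w. v \<in> carr V \<Longrightarrow> w \<in> carr W \<Longrightarrow> f v w = g v w"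
    and "is_kspace V" "is_kspace W" "is_kspace U" "bilinear_map V W U f" "t \<in> carr (tensor V W)"
  shows "tlift V W f t = tlift V W g t"
proof -
  have g: "bilinear_map V W U g"
    using assms(1,2,3,5) unfolding bilinear_map_def linear_map_def
    by (simp add: kspace_closed)
  show ?thesis
    by (rule tensor_linear_eqI[OF assms(2,3) tlift_linear[OF assms(5,2,3,4)]
          tlift_linear[OF g assms(2,3,4)] _ assms(6)])
      (simp add: tlift_tens[OF assms(5,4)] tlift_tens[OF g assms(4)] assms(1))
qed

text \<open>The counterpart for evaluation: \<open>t\<close> is a sum of pure tensors from the
  carriers, so among bilinear forms its value is fixed by their restriction to the carriers.\<close>

lemma tensor_apply_cong:
  assumes "t \<in> carr (tensor V W)" "bilinear_map V W ground B" "bilinear_map V W ground C"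
    and eq: "\<And>v w. v \<in> carr V \<Longrightarrow> w \<in> carr W \<Longrightarrow> B v w = C v w"
  shows "t B = t C"
proof -
  obtain ps where ps: "set ps \<subseteq> carr V \<times> carr W" "t = (\<Sum>(v, w)\<leftarrow>ps. tens V W v w)"
    using assms(1) by (rule tensor_elim)
  have "map (\<lambda>(v, w). B v w) ps = map (\<lambda>(v, w). C v w) ps" using ps(1) eq by auto
  thus ?thesis unfolding ps(2) tens_sum_apply[OF assms(2)] tens_sum_apply[OF assms(3)] by (simp only:)
qed

lemma tlift_bilinear:
  assumes V: "is_kspace V" and W: "is_kspace W" and U: "is_kspace U" and U': "is_kspace U'"
    and f1: "\<And>u. u \<in> carr U' \<Longrightarrow> bilinear_map V W U (\<lambda>v w. f v w u)"
    and f2: "\<And>v w. v \<in> carr V \<Longrightarrow> w \<in> carr W \<Longrightarrow> linear_map U' U (\<lambda>u. f v w u)"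
  shows "bilinear_map (tensor V W) U' U (\<lambda>t u. tlift V W (\<lambda>v w. f v w u) t)"
proof (rule bilinear_mapI)
  fix u assume "u \<in> carr U'"
  thus "linear_map (tensor V W) U (\<lambda>t. tlift V W (\<lambda>v w. f v w u) t)"
    using tlift_linear[OF f1 V W U] by simp
next
  fix t assume t: "t \<in> carr (tensor V W)"
  show "linear_map U' U (\<lambda>u. tlift V W (\<lambda>v w. f v w u) t)"
  proof (rule linear_mapI)
    fix u assume "u \<in> carr U'"
    thus "tlift V W (\<lambda>v w. f v w u) t \<in> carr U"
      using tlift_carr[OF V W U f1 t] by simp
  next
    fix u u' assume u: "u \<in> carr U'" "u' \<in> carr U'"
    hence uu: "u + u' \<in> carr U'" by (simp add: kspace_closed[OF U'])
    show "tlift V W (\<lambda>v w. f v w (u + u')) t = tlift V W (\<lambda>v w. f v w u) t + tlift V W (\<lambda>v w. f v w u') t"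
      by (rule tensor_linear_eqI[OF V W tlift_linear[OF f1[OF uu] V W U]
            linear_map_plus[OF U tlift_linear[OF f1[OF u(1)] V W U] tlift_linear[OF f1[OF u(2)] V W U]] _ t])
        (simp add: tlift_tens[OF f1 U] u uu linear_mapD(2)[OF f2])
  next
    fix c u assume u: "u \<in> carr U'"
    hence cu: "scl U' c u \<in> carr U'" by (simp add: kspace_closed[OF U'])
    show "tlift V W (\<lambda>v w. f v w (scl U' c u)) t = scl U c (tlift V W (\<lambda>v w. f v w u) t)"
      by (rule tensor_linear_eqI[OF V W tlift_linear[OF f1[OF cu] V W U]
            linear_map_scl[OF U tlift_linear[OF f1[OF u] V W U]] _ t])
        (simp add: tlift_tens[OF f1 U] u cu linear_mapD(3)[OF f2])
  qed
qed

lemma tlift_linear_param: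
  assumes V: "is_kspace V" and W: "is_kspace W" and U: "is_kspace U" and U': "is_kspace U'"
    and f1: "\<And>u. u \<in> carr U' \<Longrightarrow> bilinear_map V W U (\<lambda>v w. f v w u)"
    and f2: "\<And>v w. v \<in> carr V \<Longrightarrow> w \<in> carr W \<Longrightarrow> linear_map U' U (\<lambda>u. f v w u)"
    and t: "t \<in> carr (tensor V W)"
  shows "linear_map U' U (\<lambda>u. tlift V W (\<lambda>v w. f v w u) t)"
  using bilinear_mapD(2)[OF tlift_bilinear[OF V W U U' f1 f2] t] by simp

text \<open>Nested lifts define the multiplications of both \<open>talg\<close> and
  \<open>DT\<close>. The four-variable map is bilinear in each of two pairs of variables, so that
  lifting in one pair leaves a bilinear map in the other.\<close>

lemma tlift2_bilinear:
  assumes V: "is_kspace V" and W: "is_kspace W" and U: "is_kspace U"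
    and V': "is_kspace V'" and W': "is_kspace W'"
    and f1: "\<And>v w. v \<in> carr V \<Longrightarrow> w \<in> carr W \<Longrightarrow> bilinear_map V' W' U (f v w)"
    and f2: "\<And>v w. v \<in> carr V' \<Longrightarrow> w \<in> carr W' \<Longrightarrow> bilinear_map V W U (\<lambda>a b. f a b v w)"
  shows "bilinear_map (tensor V W) (tensor V' W') U
      (\<lambda>t u. tlift V W (\<lambda>a b. tlift V' W' (f a b) u) t)" (is ?A)
    and "v \<in> carr V \<Longrightarrow> w \<in> carr W \<Longrightarrow> v' \<in> carr V' \<Longrightarrow> w' \<in> carr W' \<Longrightarrow>
      tlift V W (\<lambda>a b. tlift V' W' (f a b) (tens V' W' v' w')) (tens V W v w) = f v w v' w'" (is "PROP ?B")
proof -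
  have 1: "bilinear_map V W U (\<lambda>v w. tlift V' W' (f v w) u)" if u: "u \<in> carr (tensor V' W')" for u
  proof (rule bilinear_mapI)
    fix w assume w: "w \<in> carr W"
    show "linear_map V U (\<lambda>v. tlift V' W' (f v w) u)"
      by (rule tlift_linear_param[OF V' W' U V _ _ u])
        (simp_all add: f1 w bilinear_mapD(1)[OF f2])
  next
    fix v assume v: "v \<in> carr V"
    show "linear_map W U (\<lambda>w. tlift V' W' (f v w) u)"
      by (rule tlift_linear_param[OF V' W' U W _ _ u])
        (simp_all add: f1 v bilinear_mapD(2)[OF f2])
  qed
  show ?A
    by (rule tlift_bilinear[OF V W U kspace_tensor[OF V' W']])
      (use 1 tlift_linear[OF f1 V' W' U] in auto)
  show "PROP ?B"
    by (simp add: tlift_tens[OF 1 U] tens_carr[OF V' W'] tlift_tens[OF f1 U])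
qed

text \<open>Coordinate systems pass to tensor products, so that products of coordinate functionals separate the
  points of iterated tensor products.\<close>

definition coords ::
  "('k::field, 'v::ab_group_add, 'z) kspace_scheme \<Rightarrow> 'i set \<Rightarrow> ('i \<Rightarrow> 'v \<Rightarrow> 'k) \<Rightarrow> ('i \<Rightarrow> 'v) \<Rightarrow> bool" where
  "coords V I \<phi> b \<longleftrightarrow> is_kspace V \<and> (\<forall>i\<in>I. linear_map V ground (\<phi> i) \<and> b i \<in> carr V) \<and>
     (\<forall>v\<in>carr V. v = (\<Sum>i\<in>I. scl V (\<phi> i v) (b i)))"

lemma coords_separate:
  assumes "coords V I \<phi> b" "v \<in> carr V" "w \<in> carr V" "\<And>i. i \<in> I \<Longrightarrow> \<phi> i v = \<phi> i w"
  shows "v = w"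
proof -
  have "v = (\<Sum>i\<in>I. scl V (\<phi> i v) (b i))" using assms(1,2) by (auto simp: coords_def)
  also have "\<dots> = (\<Sum>i\<in>I. scl V (\<phi> i w) (b i))" using assms(4) by simp
  also have "\<dots> = w" using assms(1,3) by (auto simp: coords_def)
  finally show ?thesis .
qed

text \<open>Expand both factors of a pure tensor. The coefficient of each product of basis vectors
  is the value of the tensor at the product form, and this description is linear in the
  tensor.\<close>

lemma coords_tensor:
  assumes V: "coords V I \<phi> b" and W: "coords W J \<psi> c"
  shows "coords (tensor V W) (I \<times> J) (\<lambda>(i, j) t. t (\<lambda>v w. \<phi> i v * \<psi> j w)) (\<lambda>(i, j). tens V W (b i) (c j))"
proof -
  have kV: "is_kspace V" and kW: "is_kspace W" using assms by (auto simp: coords_def)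
  note kT = kspace_tensor[OF kV kW]
  have "t = (\<Sum>(i, j)\<in>I \<times> J. scl (tensor V W) (t (\<lambda>v w. \<phi> i v * \<psi> j w)) (tens V W (b i) (c j)))"
    if t: "t \<in> carr (tensor V W)" for t
  proof (rule tensor_linear_eqI[OF kV kW linear_map_ident(1) _ _ t])
    show "linear_map (tensor V W) (tensor V W)
       (\<lambda>t. \<Sum>(i, j)\<in>I \<times> J. scl (tensor V W) (t (\<lambda>v w. \<phi> i v * \<psi> j w)) (tens V W (b i) (c j)))"
    proof (rule linear_map_setsum[OF kT], clarify)
      fix i j assume "i \<in> I" "j \<in> J"
      hence "tens V W (b i) (c j) \<in> carr (tensor V W)"
        using V W by (intro tens_carr[OF kV kW]) (auto simp: coords_def)
      thus "linear_map (tensor V W) (tensor V W)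
          (\<lambda>t. scl (tensor V W) (t (\<lambda>v w. \<phi> i v * \<psi> j w)) (tens V W (b i) (c j)))"
        by (intro linear_map_scl_scalar[OF kT tensor_apply_linear])
    qed
  next
    fix v w assume vw: "v \<in> carr V" "w \<in> carr W"
    have sv: "scl V (\<phi> i v) (b i) \<in> carr V" and b: "b i \<in> carr V" if "i \<in> I" for i
      using that V by (auto simp: coords_def intro: kspace_closed)
    have sw: "scl W (\<psi> i w) (c i) \<in> carr W" and c: "c i \<in> carr W" if "i \<in> J" for i
      using that W by (auto simp: coords_def intro: kspace_closed)
    note B = tens_bilinear[OF kV kW]
    have "tens V W v w = tens V W (\<Sum>i\<in>I. scl V (\<phi> i v) (b i)) (\<Sum>j\<in>J. scl W (\<psi> j w) (c j))"
      using V W vw by (auto simp: coords_def)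
    also have "\<dots> = (\<Sum>i\<in>I. \<Sum>j\<in>J. tens V W (scl V (\<phi> i v) (b i)) (scl W (\<psi> j w) (c j)))"
      using sv sw
      by (simp add: linear_map_sum[OF kV bilinear_mapD(1)[OF B]]
          linear_map_sum[OF kW bilinear_mapD(2)[OF B]] kspace_closed[OF kW])
    also have "\<dots> = (\<Sum>i\<in>I. \<Sum>j\<in>J. scl (tensor V W) (\<phi> i v * \<psi> j w) (tens V W (b i) (c j)))"
      using sv sw b c
      by (simp add: linear_mapD(3)[OF bilinear_mapD(1)[OF B]]
          linear_mapD(3)[OF bilinear_mapD(2)[OF B]] kspace_scale_distrib[OF kT] mult.commute)
    also have "\<dots> = (\<Sum>(i, j)\<in>I \<times> J. scl (tensor V W) (\<phi> i v * \<psi> j w) (tens V W (b i) (c j)))"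
      by (simp add: sum.cartesian_product)
    also have "\<dots> = (\<Sum>(i, j)\<in>I \<times> J. scl (tensor V W) (tens V W v w (\<lambda>v w. \<phi> i v * \<psi> j w)) (tens V W (b i) (c j)))"
    proof (rule sum.cong[OF refl], clarify)
      fix i j assume "i \<in> I" "j \<in> J"
      hence "bilinear_map V W ground (\<lambda>v w. \<phi> i v * \<psi> j w)"
        using V W by (intro bilinear_map_ground_mult) (auto simp: coords_def)
      thus "scl (tensor V W) (\<phi> i v * \<psi> j w) (tens V W (b i) (c j)) =
        scl (tensor V W) (tens V W v w (\<lambda>v w. \<phi> i v * \<psi> j w)) (tens V W (b i) (c j))"
        by (simp add: tens_apply)
    qed
    finally show "tens V W v w = (\<Sum>(i, j)\<in>I \<times> J. scl (tensor V W)
        (tens V W v w (\<lambda>v w. \<phi> i v * \<psi> j w)) (tens V W (b i) (c j)))" .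
  qed
  moreover have "tens V W (b i) (c j) \<in> carr (tensor V W)" if "i \<in> I" "j \<in> J" for i j
    using that V W by (intro tens_carr[OF kV kW]) (auto simp: coords_def)
  ultimately show ?thesis
    unfolding coords_def using kT by (auto simp: case_prod_unfold intro: tensor_apply_linear)
qed

lemma space_congs:
  assumes "carr V = carr V'" "scl V = scl V'"
  shows "is_kspace V = is_kspace V'"
    "linear_map V W f = linear_map V' W f" "linear_map U V g = linear_map U V' g"
  using assms by (simp_all add: is_kspace_def linear_map_def)

text \<open>These constructions look at carrier and scaling alone. All algebras
  \<open>DT H a\<close> therefore share their tensor spaces, and later rewriting replaces them by
  one underlying space.\<close>

lemma tens_congs:
  assumes "carr V = carr V'" "scl V = scl V'" "carr W = carr W'" "scl W = scl W'"
  shows "tens V W = tens V' W'" "tensor V W = tensor V' W'"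
    "tlift V W = (tlift V' W' :: ('v::ab_group_add \<Rightarrow> 'w::ab_group_add \<Rightarrow> 'u::ab_group_add) \<Rightarrow> _)"
proof -
  show *: "tens V W = tens V' W'"
    using assms by (simp add: tens_def bilinear_map_def linear_map_def fun_eq_iff)
  show "tensor V W = tensor V' W'" by (simp add: tensor_def * assms)
  show "tlift V W = (tlift V' W' :: ('v::ab_group_add \<Rightarrow> 'w::ab_group_add \<Rightarrow> 'u::ab_group_add) \<Rightarrow> _)"
    by (simp add: tlift_def * assms fun_eq_iff)
qed

section \<open>Tensor products of algebras\<close>

lemma talg_simps [simp]:
  "carr (talg A B) = carr (tensor A B)" "scl (talg A B) = scl (tensor A B)"
  "aunit (talg A B) = tens A B (aunit A) (aunit B)"
  by (simp_all add: talg_def)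

lemma talg_mult:
  assumes A: "is_kspace A" "bilinear_map A A A (amult A)"
    and B: "is_kspace B" "bilinear_map B B B (amult B)"
  shows "bilinear_map (talg A B) (talg A B) (talg A B) (amult (talg A B))"
    and "a \<in> carr A \<Longrightarrow> b \<in> carr B \<Longrightarrow> a' \<in> carr A \<Longrightarrow> b' \<in> carr B \<Longrightarrow>
      amult (talg A B) (tens A B a b) (tens A B a' b') = tens A B (amult A a a') (amult B b b')"
proof -
  note T = tens_bilinear[OF A(1) B(1)]
  have 1: "bilinear_map A B (tensor A B) (\<lambda>a' b'. tens A B (amult A a a') (amult B b b'))"
    if "a \<in> carr A" "b \<in> carr B" for a b
    using bilinear_map_comp[OF T bilinear_mapD(2)[OF A(2)] bilinear_mapD(2)[OF B(2)]] that by simp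
  have 2: "bilinear_map A B (tensor A B) (\<lambda>a b. tens A B (amult A a a') (amult B b b'))"
    if "a' \<in> carr A" "b' \<in> carr B" for a' b'
    using bilinear_map_comp[OF T bilinear_mapD(1)[OF A(2)] bilinear_mapD(1)[OF B(2)]] that by simp
  note * = tlift2_bilinear[OF A(1) B(1) kspace_tensor[OF A(1) B(1)] A(1) B(1) 1 2]
  show "bilinear_map (talg A B) (talg A B) (talg A B) (amult (talg A B))"
    using *(1) by (simp add: bilinear_map_def linear_map_def talg_def)
  show "amult (talg A B) (tens A B a b) (tens A B a' b') = tens A B (amult A a a') (amult B b b')"
    if "a \<in> carr A" "b \<in> carr B" "a' \<in> carr A" "b' \<in> carr B"
    using *(2) that by (simp add: talg_def)
qed

lemma bilinear_map_sum_sum: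
  assumes V: "is_kspace V" and W: "is_kspace W" and B: "bilinear_map V W U B"
    and "\<And>i. i \<in> I \<Longrightarrow> f i \<in> carr V" "\<And>j. j \<in> J \<Longrightarrow> g j \<in> carr W"
  shows "B (\<Sum>i\<in>I. f i) (\<Sum>j\<in>J. g j) = (\<Sum>i\<in>I. \<Sum>j\<in>J. B (f i) (g j))"
  using assms(4,5)
  by (simp add: linear_map_sum[OF V bilinear_mapD(1)[OF B]]
      linear_map_sum[OF W bilinear_mapD(2)[OF B]] kspace_closed[OF W])

section \<open>Sweedler calculus in a finite-dimensional Hopf algebra\<close>

locale fin_dim_hopf =
  fixes H :: "('k::field, 'h::ring_1) hopf" and E :: "'h set"
  assumes hopf: "hopf_algebra H"
    and fin_dim: "finite_dimensional_vector_space (hscl H) E"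
    and bij_antipode: "bij (antipode H)"
begin

abbreviation S :: "'h \<Rightarrow> 'h" where "S \<equiv> antipode H"
abbreviation S' :: "'h \<Rightarrow> 'h" where "S' \<equiv> inverse_fun (antipode H)"
abbreviation \<epsilon> :: "'h \<Rightarrow> 'k" where "\<epsilon> \<equiv> counit H"

definition lin :: "('h \<Rightarrow> 'k) \<Rightarrow> bool" where
  "lin = linear_map (alg H) ground"

definition linH :: "('h \<Rightarrow> 'h) \<Rightarrow> bool" where
  "linH = linear_map (alg H) (alg H)"

abbreviation Aut :: "('h \<Rightarrow> 'h) set" where "Aut \<equiv> hopf_aut H"

abbreviation co :: "'h \<Rightarrow> 'h \<Rightarrow> 'k" where
  "co \<equiv> dual_basis H E"

text \<open>The coefficient of the basis vector \<open>e\<close> when the first leg of the coproduct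
  is expanded along \<open>E\<close>: contracting that leg with \<open>co e\<close> makes the
  coproduct of \<open>h\<close> the sum over \<open>e\<close> of \<open>e \<otimes> cop e h\<close>,
  see \<open>comult_eq\<close>.\<close>

definition cop :: "'h \<Rightarrow> 'h \<Rightarrow> 'h" where
  "cop e h = tlift (alg H) (alg H) (\<lambda>a b. hscl H (co e a) b) (comult H h)"

text \<open>The Sweedler sum \<open>\<Sum> F h\<^sub>1 h\<^sub>2\<close>, for the expansion of \<open>\<Delta> h\<close> along the basis \<open>E\<close> in the first leg:
  being a plain sum, it needs no bilinearity of \<open>F\<close> for interchanging two such sums.\<close>

definition sw :: "('h \<Rightarrow> 'h \<Rightarrow> 'u::comm_monoid_add) \<Rightarrow> 'h \<Rightarrow> 'u" where
  "sw F h = (\<Sum>e\<in>E. F e (cop e h))"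

lemma alg_simps [simp]:
  "carr (alg H) = UNIV" "scl (alg H) = hscl H" "amult (alg H) = (*)" "aunit (alg H) = 1"
  by (simp_all add: alg_def)

lemma kalg_alg: "kalgebra (alg H)"
  using hopf by (simp add: hopf_algebra_def)

lemma ks_alg [simp]: "is_kspace (alg H)"
  using kalg_alg by (simp add: kalgebra_def)

lemma vs_alg: "vector_space (hscl H)"
  using ks_alg by (simp add: is_kspace_def)

lemma lin_iff: "lin f \<longleftrightarrow> (\<forall>x y. f (x + y) = f x + f y) \<and> (\<forall>c x. f (hscl H c x) = c * f x)"
  by (simp add: lin_def linear_map_def)

lemma linH_iff:
  "linH f \<longleftrightarrow> (\<forall>x y. f (x + y) = f x + f y) \<and> (\<forall>c x. f (hscl H c x) = hscl H c (f x))"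
  by (simp add: linH_def linear_map_def)

lemma bilinear_alg_ground:
  "bilinear_map (alg H) (alg H) ground F \<longleftrightarrow> (\<forall>b. lin (\<lambda>a. F a b)) \<and> (\<forall>a. lin (F a))"
  by (simp add: bilinear_map_def lin_def)

lemma lin_app: "lin p \<Longrightarrow> linH g \<Longrightarrow> lin (\<lambda>x. p (g x))"
  by (simp add: lin_iff linH_iff)

lemma linH_app: "linH p \<Longrightarrow> linH g \<Longrightarrow> linH (\<lambda>x. p (g x))"
  by (simp add: linH_iff)

lemma linH_ident: "linH (\<lambda>x. x)"
  by (simp add: linH_iff)

lemma hscl_mult: "hscl H c x * y = hscl H c (x * y)" "y * hscl H c x = hscl H c (y * x)"
  using kalg_alg by (simp_all add: kalgebra_def bilinear_map_def linear_map_def)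

lemma linH_mult: "linH g \<Longrightarrow> linH (\<lambda>x. g x * a)" "linH g \<Longrightarrow> linH (\<lambda>x. a * g x)"
  by (simp_all add: linH_iff hscl_mult distrib_left distrib_right)

lemma lin_times: "lin f \<Longrightarrow> lin (\<lambda>x. f x * c)" "lin f \<Longrightarrow> lin (\<lambda>x. c * f x)"
  by (simp_all add: lin_iff algebra_simps)

lemma lin_sum: "(\<And>i. i \<in> I \<Longrightarrow> lin (f i)) \<Longrightarrow> lin (\<lambda>x. \<Sum>i\<in>I. f i x)"
  by (simp add: lin_iff sum.distrib sum_distrib_left)

lemma lin_setsum: "lin f \<Longrightarrow> f (\<Sum>i\<in>I. g i) = (\<Sum>i\<in>I. f (g i))"
  unfolding lin_def by (rule linear_map_sum) auto

lemma lin_scl: "lin f \<Longrightarrow> f (hscl H c x) = c * f x"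
  by (simp add: lin_iff)

section \<open>Expansion along a basis and its dual basis\<close>

lemma expand: "(\<Sum>e\<in>E. hscl H (co e h) e) = h"
proof -
  interpret v: finite_dimensional_vector_space "hscl H" E by (rule fin_dim)
  show ?thesis
    unfolding dual_basis_def
    by (rule v.sum_representation_eq) (auto simp: v.independent_Basis v.span_Basis v.finite_Basis)
qed

lemma lin_co: "lin (co e)"
proof -
  interpret v: finite_dimensional_vector_space "hscl H" E by (rule fin_dim)
  have *: "v.independent E" "x \<in> v.span E" for x
    by (auto simp: v.independent_Basis v.span_Basis)
  show ?thesis
    unfolding lin_iff dual_basis_def
    by (simp add: v.representation_add[OF *(1) *(2) *(2)] v.representation_scale[OF *(1) *(2)])
qed

lemma lin_expand: "lin f \<Longrightarrow> (\<Sum>e\<in>E. co e h * f e) = f h"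
  by (subst (2) expand[of h, symmetric]) (simp add: lin_setsum lin_scl)

lemma lin_separate: "(\<And>f. lin f \<Longrightarrow> f x = f y) \<Longrightarrow> x = y"
  by (rule functionals_separate_points[of "alg H"]) (auto simp: lin_def)

lemma coords_alg: "coords (alg H) E co (\<lambda>e. e)"
  using lin_co by (simp add: coords_def expand lin_def)

lemma bilinear_co_scl: "bilinear_map (alg H) (alg H) (alg H) (\<lambda>a b. hscl H (co e a) b)"
proof -
  interpret v: vector_space "hscl H" by (rule vs_alg)
  show ?thesis using lin_co[of e]
    by (simp add: bilinear_map_def linear_map_def lin_iff v.scale_right_distrib v.scale_left_distrib
        mult.commute)
qed

lemma comult_carr: "comult H h \<in> carr (tensor (alg H) (alg H))"
  using hopf by (simp add: hopf_algebra_def alg_hom_def linear_map_def)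

lemma comult_linear: "linear_map (alg H) (tensor (alg H) (alg H)) (comult H)"
  using hopf by (simp add: hopf_algebra_def alg_hom_def linear_map_def)

lemma linH_cop: "linH (cop e)"
  unfolding linH_def cop_def
  by (rule linear_map_comp[OF comult_linear tlift_linear[OF bilinear_co_scl]]) auto

text \<open>On a pure tensor v \<otimes> w, expand v along \<open>E\<close> and move the coordinates
  into the second factor. Both sides are linear in the tensor, so the formula holds for every
  element, in particular for the coproduct of \<open>h\<close>.\<close>

lemma comult_eq: "comult H h = sw (tens (alg H) (alg H)) h"
  unfolding sw_def cop_def
proof (rule tensor_linear_eqI[OF ks_alg ks_alg linear_map_ident(1) _ _ comult_carr])
  note B = tens_bilinear[OF ks_alg ks_alg]
  let ?g = "\<lambda>t. \<Sum>e\<in>E. tens (alg H) (alg H) e (tlift (alg H) (alg H) (\<lambda>a b. hscl H (co e a) b) t)"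
  show "linear_map (tensor (alg H) (alg H)) (tensor (alg H) (alg H)) ?g"
    by (intro linear_map_setsum kspace_tensor ks_alg
        linear_map_comp[OF tlift_linear[OF bilinear_co_scl] bilinear_mapD(2)[OF B]]) auto
  fix v w
  have "tens (alg H) (alg H) v w = tens (alg H) (alg H) (\<Sum>e\<in>E. hscl H (co e v) e) w"
    by (simp add: expand)
  also have "\<dots> = (\<Sum>e\<in>E. tens (alg H) (alg H) (hscl H (co e v) e) w)"
    by (subst linear_map_sum[OF ks_alg bilinear_mapD(1)[OF B]]) auto
  also have "\<dots> = (\<Sum>e\<in>E. tens (alg H) (alg H) e (hscl H (co e v) w))"
    using linear_mapD(3)[OF bilinear_mapD(1)[OF B]] linear_mapD(3)[OF bilinear_mapD(2)[OF B]] by simp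
  also have "\<dots> = ?g (tens (alg H) (alg H) v w)"
    by (simp add: tlift_tens[OF bilinear_co_scl])
  finally show "tens (alg H) (alg H) v w = ?g (tens (alg H) (alg H) v w)" .
qed

text \<open>The passage from Sweedler sums given by lifting to finite sums over \<open>E\<close>.
  The bilinearity demanded here is what makes the lift independent of the chosen
  representation.\<close>

lemma tlift_comult:
  assumes "is_kspace U" "bilinear_map (alg H) (alg H) U f"
  shows "tlift (alg H) (alg H) f (comult H h) = sw f h"
  unfolding comult_eq sw_def
  using linear_map_sum[OF kspace_tensor[OF ks_alg ks_alg] tlift_linear[OF assms(2) _ _ assms(1)],
      of E "\<lambda>e. tens (alg H) (alg H) e (cop e h)"]
  by (simp add: tens_carr tlift_tens[OF assms(2,1)])

lemma sweedler2_eq: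
  "is_kspace U \<Longrightarrow> bilinear_map (alg H) (alg H) U f \<Longrightarrow> sweedler2 H f h = sw f h"
  unfolding sweedler2_def by (rule tlift_comult)

lemma sum_fun_apply: "(\<Sum>i\<in>I. f i) x = (\<Sum>i\<in>I. f i x)"
  for f :: "'i \<Rightarrow> 'a \<Rightarrow> 'b::comm_monoid_add"
  by (induction I rule: infinite_finite_induct) auto

lemma sw_apply: "sw F h x = sw (\<lambda>a b. F a b x) h"
  by (simp add: sw_def sum_fun_apply)

lemma comult_apply:
  assumes "\<And>b. lin (\<lambda>a. F a b)" "\<And>a. lin (F a)"
  shows "comult H h F = sw F h"
  using assms by (simp add: comult_eq sw_apply tens_apply bilinear_alg_ground)

lemma sw_linear_map:
  assumes "is_kspace U" "bilinear_map (alg H) (alg H) U F"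
  shows "linear_map (alg H) U (sw F)"
  unfolding sw_def using linH_cop
  by (intro linear_map_setsum assms(1) linear_map_comp[OF _ bilinear_mapD(2)[OF assms(2)]])
    (auto simp: linH_def)

lemma lin_sw: "(\<And>a b. lin (\<lambda>x. F x a b)) \<Longrightarrow> lin (\<lambda>x. sw (\<lambda>a b. F x a b) y)"
  unfolding sw_def by (rule lin_sum)

lemma lin_sw_arg:
  assumes "\<And>b. lin (\<lambda>a. F a b)" "\<And>a. lin (\<lambda>b. F a b)" "linH g"
  shows "lin (\<lambda>x. sw (\<lambda>a b. F a b) (g x))"
  unfolding sw_def
  by (intro lin_sum lin_app[OF assms(2)] linH_app[OF linH_cop] assms(3))

section \<open>The Hopf algebra axioms as scalar Sweedler identities\<close>

lemma lin_counit: "lin \<epsilon>"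
  using hopf by (simp add: hopf_algebra_def alg_hom_def lin_def)

lemma linH_antipode: "linH S"
  using hopf by (simp add: hopf_algebra_def linH_def)

lemma S_inv [simp]: "S (S' x) = x" "S' (S x) = x"
  using bij_antipode by (simp_all add: bij_is_surj surj_f_inv_f bij_is_inj)

lemma linH_inverse: "linH f \<Longrightarrow> bij f \<Longrightarrow> linH (inverse_fun f)"
  unfolding linH_iff
  by (metis bij_inv_eq_iff)

lemma linH_antipode': "linH S'"
  by (rule linH_inverse[OF linH_antipode bij_antipode])

lemmas lin_intros = lin_times lin_sw lin_sw_arg linH_ident linH_mult
  linH_app[OF linH_antipode] linH_app[OF linH_antipode'] lin_app[OF lin_counit]

lemma sw_swap:
  "sw (\<lambda>a b. sw (\<lambda>c d. F a b c d) y) x = sw (\<lambda>c d. sw (\<lambda>a b. F a b c d) x) y"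
  unfolding sw_def by (rule sum.swap)

lemma sw_sum: "(\<Sum>i\<in>I. sw (\<lambda>a b. F i a b) h) = sw (\<lambda>a b. \<Sum>i\<in>I. F i a b) h"
  unfolding sw_def by (rule sum.swap)

lemma sw_times:
  "sw (\<lambda>a b. F a b) h * c = sw (\<lambda>a b. F a b * c) h" "c * sw (\<lambda>a b. F a b) h = sw (\<lambda>a b. c * F a b) h"
  for c :: "'a::semiring_0"
  by (simp_all add: sw_def sum_distrib_left sum_distrib_right)

lemma lin_of_sw: "lin f \<Longrightarrow> f (sw (\<lambda>a b. G a b) h) = sw (\<lambda>a b. f (G a b)) h"
  unfolding sw_def by (rule lin_setsum)

lemma linear_of_sw:
  assumes "is_kspace V" "linear_map V U f" "\<And>a b. F a b \<in> carr V"
  shows "f (sw (\<lambda>a b. F a b) h) = sw (\<lambda>a b. f (F a b)) h"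
  unfolding sw_def by (rule linear_map_sum[OF assms(1,2,3)])

lemma sw_carr: "is_kspace V \<Longrightarrow> (\<And>a b. F a b \<in> carr V) \<Longrightarrow> sw (\<lambda>a b. F a b) h \<in> carr V"
  unfolding sw_def by (rule kspace_closed(4))

text \<open>Both sides of the coassociativity axiom become double sums of pure tensors in
  \<open>H \<otimes> (H \<otimes> H)\<close>. Being functions on bilinear forms, they may be
  evaluated at the form sending (u, t) to the lift of \<open>F u\<close> at t, which returns the
  values of \<open>F\<close>.\<close>

lemma sw_coassoc:
  assumes F: "\<And>b c. lin (\<lambda>a. F a b c)" "\<And>a c. lin (\<lambda>b. F a b c)" "\<And>a b. lin (\<lambda>c. F a b c)"
  shows "sw (\<lambda>a b. sw (\<lambda>c d. F c d b) a) h = sw (\<lambda>a b. sw (\<lambda>c d. F a c d) b) h"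
proof -
  let ?A = "alg H" and ?T = "tensor (alg H) (alg H)" and ?t = "tens (alg H) (alg H)"
  note T = tens_bilinear[OF ks_alg ks_alg] and kT = kspace_tensor[OF ks_alg ks_alg]
  note kT3 = kspace_tensor[OF ks_alg kT] and kT3' = kspace_tensor[OF kT ks_alg]
  have B1: "bilinear_map ?A ?A (tensor ?T ?A) (\<lambda>a b. tens ?T ?A (comult H a) b)"
    using bilinear_map_comp[OF tens_bilinear[OF kT ks_alg] comult_linear linear_map_ident(1)] .
  have B2: "bilinear_map ?A ?A (tensor ?A ?T) (\<lambda>a b. tens ?A ?T a (comult H b))"
    using bilinear_map_comp[OF tens_bilinear[OF ks_alg kT] linear_map_ident(1) comult_linear] .
  have B3: "bilinear_map ?A ?A (tensor ?A ?T) (\<lambda>u v. tens ?A ?T u (?t v w))" for w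
    using bilinear_map_comp[OF tens_bilinear[OF ks_alg kT] linear_map_ident(1) bilinear_mapD(1)[OF T]]
    by simp
  have B4: "bilinear_map ?T ?A (tensor ?A ?T) (\<lambda>t w. tlift ?A ?A (\<lambda>u v. tens ?A ?T u (?t v w)) t)"
    by (rule tlift_bilinear[OF ks_alg ks_alg kT3 ks_alg B3])
      (use linear_map_comp[OF bilinear_mapD(2)[OF T] bilinear_mapD(2)[OF tens_bilinear[OF ks_alg kT]]]
        in auto)
  have "tassoc ?A ?A ?A (tmap ?A ?A ?T ?A (comult H) id (comult H h)) =
      sw (\<lambda>a b. sw (\<lambda>c d. tens ?A ?T c (?t d b)) a) h"
  proof -
    have "tmap ?A ?A ?T ?A (comult H) id (comult H h) = sw (\<lambda>a b. tens ?T ?A (comult H a) b) h"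
      unfolding tmap_def using tlift_comult[OF kT3' B1] by simp
    moreover have "tassoc ?A ?A ?A (sw (\<lambda>a b. tens ?T ?A (comult H a) b) h) =
        sw (\<lambda>a b. tlift ?A ?A (\<lambda>u v. tens ?A ?T u (?t v b)) (comult H a)) h"
      unfolding tassoc_def
      by (subst linear_of_sw[OF kT3' tlift_linear[OF B4 kT ks_alg kT3]])
        (simp_all add: tens_carr[OF kT ks_alg] comult_carr tlift_tens[OF B4 kT3])
    ultimately show ?thesis
      by (simp add: tlift_comult[OF kT3 B3])
  qed
  moreover have "tmap ?A ?A ?A ?T id (comult H) (comult H h) =
      sw (\<lambda>a b. sw (\<lambda>c d. tens ?A ?T a (?t c d)) b) h"
  proof -
    have "tmap ?A ?A ?A ?T id (comult H) (comult H h) = sw (\<lambda>a b. tens ?A ?T a (comult H b)) h"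
      unfolding tmap_def using tlift_comult[OF kT3 B2] by simp
    also have "\<dots> = sw (\<lambda>a b. sw (\<lambda>c d. tens ?A ?T a (?t c d)) b) h"
      unfolding comult_eq
      by (subst linear_of_sw[OF kT bilinear_mapD(2)[OF tens_bilinear[OF ks_alg kT]]])
        (auto simp: tens_carr)
    finally show ?thesis .
  qed
  ultimately have eq: "sw (\<lambda>a b. sw (\<lambda>c d. tens ?A ?T c (?t d b)) a) h =
      sw (\<lambda>a b. sw (\<lambda>c d. tens ?A ?T a (?t c d)) b) h"
    using hopf by (simp add: hopf_algebra_def)
  have BF: "bilinear_map ?A ?A ground (F u)" for u
    using F by (simp add: bilinear_alg_ground)
  have BT: "bilinear_map ?A ?T ground (\<lambda>u t. tlift ?A ?A (F u) t)"
  proof (rule bilinear_mapI)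
    show "linear_map ?T ground (\<lambda>t. tlift ?A ?A (F v) t)" for v
      by (rule tlift_linear[OF BF ks_alg ks_alg kspace_ground])
    show "linear_map ?A ground (\<lambda>u. tlift ?A ?A (F u) t)" if "t \<in> carr ?T" for t
      using tlift_linear_param[OF ks_alg ks_alg kspace_ground ks_alg, of "\<lambda>v w u. F u v w" t] BF F(1) that
      by (simp add: lin_def)
  qed
  from eq have "sw (\<lambda>a b. sw (\<lambda>c d. tens ?A ?T c (?t d b)) a) h (\<lambda>u t. tlift ?A ?A (F u) t) =
      sw (\<lambda>a b. sw (\<lambda>c d. tens ?A ?T a (?t c d)) b) h (\<lambda>u t. tlift ?A ?A (F u) t)" by simp
  thus ?thesis
    unfolding sw_apply tens_apply[OF BT] by (simp add: tlift_tens[OF BF kspace_ground])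
qed

lemma sw_counit_left: "lin f \<Longrightarrow> sw (\<lambda>a b. \<epsilon> a * f b) h = f h"
  and sw_counit_right: "lin f \<Longrightarrow> sw (\<lambda>a b. f a * \<epsilon> b) h = f h"
proof -
  assume f: "lin f"
  interpret v: vector_space "hscl H" by (rule vs_alg)
  have B: "bilinear_map (alg H) (alg H) (alg H) (\<lambda>a b. hscl H (\<epsilon> a) b)"
    "bilinear_map (alg H) (alg H) (alg H) (\<lambda>a b. hscl H (\<epsilon> b) a)"
    using lin_counit
    by (simp_all add: bilinear_map_def linear_map_def lin_iff v.scale_right_distrib
        v.scale_left_distrib mult.commute)
  have "sw (\<lambda>a b. hscl H (\<epsilon> a) b) h = h" "sw (\<lambda>a b. hscl H (\<epsilon> b) a) h = h"
    using hopf sweedler2_eq[OF ks_alg B(1)] sweedler2_eq[OF ks_alg B(2)]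
    by (simp_all add: hopf_algebra_def)
  from arg_cong[OF this(1), of f] arg_cong[OF this(2), of f]
  show "sw (\<lambda>a b. \<epsilon> a * f b) h = f h" "sw (\<lambda>a b. f a * \<epsilon> b) h = f h"
    by (simp_all add: lin_of_sw[OF f] lin_scl[OF f] mult.commute)
qed

lemma sw_antipode_left: "lin f \<Longrightarrow> sw (\<lambda>a b. f (S a * b)) h = \<epsilon> h * f 1"
  and sw_antipode_right: "lin f \<Longrightarrow> sw (\<lambda>a b. f (a * S b)) h = \<epsilon> h * f 1"
proof -
  assume f: "lin f"
  have B: "bilinear_map (alg H) (alg H) (alg H) (\<lambda>a b. S a * b)"
    "bilinear_map (alg H) (alg H) (alg H) (\<lambda>a b. a * S b)"
    using linH_antipode by (simp_all add: bilinear_map_def linear_map_def linH_iff hscl_mult algebra_simps)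
  have "sw (\<lambda>a b. S a * b) h = hscl H (\<epsilon> h) 1" "sw (\<lambda>a b. a * S b) h = hscl H (\<epsilon> h) 1"
    using hopf sweedler2_eq[OF ks_alg B(1)] sweedler2_eq[OF ks_alg B(2)]
    by (simp_all add: hopf_algebra_def)
  from arg_cong[OF this(1), of f] arg_cong[OF this(2), of f]
  show "sw (\<lambda>a b. f (S a * b)) h = \<epsilon> h * f 1" "sw (\<lambda>a b. f (a * S b)) h = \<epsilon> h * f 1"
    by (simp_all add: lin_of_sw[OF f] lin_scl[OF f])
qed

lemma counit_mult [simp]: "\<epsilon> (x * y) = \<epsilon> x * \<epsilon> y" "\<epsilon> 1 = 1"
  using hopf by (simp_all add: hopf_algebra_def alg_hom_def)

text \<open>The coproduct of a product is a product in \<open>H \<otimes> H\<close>. Expanding both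
  coproducts into pure tensors makes that product legwise, and the result is evaluated at
  \<open>F\<close>.\<close>

lemma sw_mult:
  assumes F: "\<And>b. lin (\<lambda>a. F a b)" "\<And>a. lin (\<lambda>b. F a b)"
  shows "sw (\<lambda>a b. F a b) (x * y) = sw (\<lambda>a b. sw (\<lambda>c d. F (a * c) (b * d)) y) x"
proof -
  let ?A = "alg H"
  have bm: "bilinear_map ?A ?A ?A (amult ?A)"
    using kalg_alg by (simp add: kalgebra_def)
  note B = talg_mult[OF ks_alg bm ks_alg bm, unfolded alg_simps]
  have "comult H (x * y) = amult (talg ?A ?A) (comult H x) (comult H y)"
    using hopf by (simp add: hopf_algebra_def alg_hom_def)
  also have "\<dots> = sw (\<lambda>a b. sw (\<lambda>c d. tens ?A ?A (a * c) (b * d)) y) x"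
    unfolding comult_eq[of x] comult_eq[of y] sw_def
    by (subst bilinear_map_sum_sum[OF _ _ B(1)])
      (auto simp: tens_carr B(2) kspace_tensor space_congs(1)[of "talg ?A ?A" "tensor ?A ?A"])
  finally have "comult H (x * y) F = sw (\<lambda>a b. sw (\<lambda>c d. tens ?A ?A (a * c) (b * d)) y) x F" by simp
  thus ?thesis using F
    by (simp add: comult_apply sw_apply tens_apply bilinear_alg_ground)
qed

lemma sw_one:
  assumes F: "\<And>b. lin (\<lambda>a. F a b)" "\<And>a. lin (\<lambda>b. F a b)"
  shows "sw (\<lambda>a b. F a b) 1 = F 1 1"
proof -
  have "comult H 1 = tens (alg H) (alg H) 1 1"
    using hopf by (simp add: hopf_algebra_def alg_hom_def)
  from fun_cong[OF this, of F] show ?thesis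
    using F by (simp add: comult_apply tens_apply bilinear_alg_ground)
qed

text \<open>These variants leave the summand \<open>F\<close> free, so that a rule application
  matches any sum and the factorization through \<open>g\<close> becomes a side condition.\<close>

lemma sw_counit_leftI: "lin g \<Longrightarrow> (\<And>a b. F a b = \<epsilon> a * g b) \<Longrightarrow> sw (\<lambda>a b. F a b) h = g h"
  and sw_counit_rightI: "lin g \<Longrightarrow> (\<And>a b. F a b = \<epsilon> b * g a) \<Longrightarrow> sw (\<lambda>a b. F a b) h = g h"
  using sw_counit_left[of g h] sw_counit_right[of g h] by (simp_all add: mult.commute)

lemma sw_antipode_leftI:
    "lin g \<Longrightarrow> (\<And>a b. F a b = g (S a * b)) \<Longrightarrow> sw (\<lambda>a b. F a b) h = \<epsilon> h * g 1"
  and sw_antipode_rightI: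
    "lin g \<Longrightarrow> (\<And>a b. F a b = g (a * S b)) \<Longrightarrow> sw (\<lambda>a b. F a b) h = \<epsilon> h * g 1"
  using sw_antipode_left[of g h] sw_antipode_right[of g h] by simp_all

section \<open>The antipode reverses products and coproducts\<close>

lemma antipode_one: "S 1 = 1"
proof (rule lin_separate)
  fix f assume f: "lin f"
  have "sw (\<lambda>a b. f (S a * b)) 1 = f (S 1 * 1)"
    by (rule sw_one; intro lin_intros lin_app[OF f])
  thus "f (S 1) = f 1" by (simp add: sw_antipode_left[OF f])
qed

text \<open>The sum of \<open>f (S (x1 y1) x2 y2 S y3 S x3)\<close> is evaluated in two ways.
  Cancelling \<open>y2 S y3\<close> and then \<open>x2 S x3\<close> leaves
  \<open>f (S (x y))\<close>; cancelling \<open>S (x1 y1) x2 y2\<close> by the antipode identity for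
  a product leaves \<open>f (S y S x)\<close>.\<close>

lemma antipode_mult: "S (x * y) = S y * S x"
proof (rule lin_separate)
  fix f assume f: "lin f"
  note L = lin_intros lin_app[OF f]
  let ?G = "\<lambda>a b c u v w. f (S (a * u) * (b * v) * S w * S c)"
  let ?T = "sw (\<lambda>a b. sw (\<lambda>b c. sw (\<lambda>u v. sw (\<lambda>v w. ?G a b c u v w) v) y) b) x"
  have "sw (\<lambda>v w. ?G a b c u v w) t = \<epsilon> t * f (S (a * u) * b * S c)" for a b c u t
    by (rule sw_antipode_rightI[where g = "\<lambda>z. f (S (a * u) * b * z * S c)", simplified])
      (auto intro!: L simp: mult.assoc)
  moreover have "sw (\<lambda>u v. \<epsilon> v * f (S (a * u) * b * S c)) y = f (S (a * y) * b * S c)" for a b c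
    by (rule sw_counit_rightI[OF _ refl]) (intro L)
  moreover have "sw (\<lambda>b c. f (S (a * y) * b * S c)) t = \<epsilon> t * f (S (a * y))" for a t
    by (rule sw_antipode_rightI[where g = "\<lambda>z. f (S (a * y) * z)", simplified])
      (auto intro!: L simp: mult.assoc)
  moreover have "sw (\<lambda>a b. \<epsilon> b * f (S (a * y))) x = f (S (x * y))"
    by (rule sw_counit_rightI[OF _ refl]) (intro L)
  ultimately have 1: "?T = f (S (x * y))"
    by simp
  \<comment> \<open>Regroup so that the first two legs of x come from one element \<open>p\<close>,
    and those of y from one element \<open>q\<close>; \<open>sw_mult\<close> then reads the four
    legs as the coproduct of \<open>p * q\<close>.\<close>
  have "?T = sw (\<lambda>p c. sw (\<lambda>q w. sw (\<lambda>a b. sw (\<lambda>u v. ?G a b c u v w) q) p) y) x"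
    by (subst sw_swap, subst sw_coassoc, (intro L)+, subst sw_coassoc, (intro L)+, rule refl)
  also have "\<dots> = sw (\<lambda>p c. sw (\<lambda>q w. sw (\<lambda>a b. f (S a * b * S w * S c)) (p * q)) y) x"
    by (subst sw_mult) (intro L | rule refl)+
  also have "\<dots> = f (S y * S x)"
  proof -
    have "sw (\<lambda>a b. f (S a * b * S w * S c)) t = \<epsilon> t * f (S w * S c)" for w c t
      by (rule sw_antipode_leftI[where g = "\<lambda>z. f (z * S w * S c)", simplified])
        (auto intro!: L simp: mult.assoc)
    moreover have "sw (\<lambda>q w. \<epsilon> (p * q) * f (S w * S c)) y = \<epsilon> p * f (S y * S c)" for p c
      by (rule sw_counit_leftI[where g = "\<lambda>w. \<epsilon> p * f (S w * S c)"]) (auto intro!: L)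
    moreover have "sw (\<lambda>p c. \<epsilon> p * f (S y * S c)) x = f (S y * S x)"
      by (rule sw_counit_left) (intro L)
    ultimately show ?thesis by simp
  qed
  finally show "f (S (x * y)) = f (S y * S x)" using 1 by simp
qed

text \<open>Apply the counit to the left antipode identity; by multiplicativity the counit of the
  second leg splits off and is absorbed.\<close>

lemma counit_antipode [simp]: "\<epsilon> (S h) = \<epsilon> h"
proof -
  have "sw (\<lambda>a b. \<epsilon> (S a * b)) h = \<epsilon> h * \<epsilon> 1"
    by (rule sw_antipode_left[OF lin_counit])
  moreover have "sw (\<lambda>a b. \<epsilon> (S a * b)) h = \<epsilon> (S h)"
    by (rule sw_counit_rightI) (auto intro!: lin_intros)
  ultimately show ?thesis by simp
qed

text \<open>With h in five legs, consider \<open>F (u h2 S h5) (v h3 S h4)\<close>, where u and v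
  are the legs of \<open>S h1\<close>. Cancelling \<open>h3 S h4\<close> and then
  \<open>h2 S h5\<close> leaves the coproduct of \<open>S h\<close>. Reading \<open>u h2\<close> and
  \<open>v h3\<close> as the coproduct of \<open>S h1 h2\<close> and cancelling that instead leaves
  the antipodes of the remaining legs in reversed order.\<close>

lemma sw_antipode:
  assumes F: "\<And>b. lin (\<lambda>a. F a b)" "\<And>a. lin (\<lambda>b. F a b)"
  shows "sw (\<lambda>a b. F a b) (S h) = sw (\<lambda>a b. F (S b) (S a)) h"
proof -
  note L = lin_intros lin_app[OF F(1)] lin_app[OF F(2)] F
  let ?G = "\<lambda>a b b' c c'. sw (\<lambda>u v. F (u * b * S c') (v * b' * S c)) (S a)"
  let ?T = "sw (\<lambda>a t. sw (\<lambda>b t. sw (\<lambda>b' t. sw (\<lambda>c c'. ?G a b b' c c') t) t) t) h"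
  have "sw (\<lambda>b' t. sw (\<lambda>c c'. ?G a b b' c c') t) t = sw (\<lambda>u v. F (u * b * S t) v) (S a)" for a b t
  proof -
    have "sw (\<lambda>b' t. sw (\<lambda>c c'. ?G a b b' c c') t) t = sw (\<lambda>s c'. sw (\<lambda>b' c. ?G a b b' c c') s) t"
      by (rule sw_coassoc[symmetric]) (intro L)+
    also have "\<dots> = sw (\<lambda>s c'. \<epsilon> s * sw (\<lambda>u v. F (u * b * S c') v) (S a)) t"
    proof -
      have "sw (\<lambda>b' c. ?G a b b' c c') s = \<epsilon> s * sw (\<lambda>u v. F (u * b * S c') v) (S a)" for s c'
        by (rule sw_antipode_rightI[where g = "\<lambda>z. sw (\<lambda>u v. F (u * b * S c') (v * z)) (S a)", simplified])
          (auto intro!: L simp: mult.assoc)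
      thus ?thesis by simp
    qed
    also have "\<dots> = sw (\<lambda>u v. F (u * b * S t) v) (S a)"
      by (rule sw_counit_left) (intro L)
    finally show ?thesis .
  qed
  moreover have "sw (\<lambda>b t. sw (\<lambda>u v. F (u * b * S t) v) (S a)) t = \<epsilon> t * sw (\<lambda>u v. F u v) (S a)" for a t
    by (rule sw_antipode_rightI[where g = "\<lambda>z. sw (\<lambda>u v. F (u * z) v) (S a)", simplified])
      (auto intro!: L simp: mult.assoc)
  moreover have "sw (\<lambda>a t. \<epsilon> t * sw (\<lambda>u v. F u v) (S a)) h = sw (\<lambda>u v. F u v) (S h)"
    by (rule sw_counit_rightI[OF _ refl]) (intro L)
  ultimately have 1: "?T = sw (\<lambda>u v. F u v) (S h)"
    by simp
  have "?T = sw (\<lambda>p q. sw (\<lambda>a t. sw (\<lambda>b b'. sw (\<lambda>c c'. ?G a b b' c c') q) t) p) h"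
  proof -
    have "sw (\<lambda>t q. sw (\<lambda>b b'. sw (\<lambda>c c'. ?G a b b' c c') q) t) s =
        sw (\<lambda>b t. sw (\<lambda>b' t. sw (\<lambda>c c'. ?G a b b' c c') t) t) s" for a s
      by (rule sw_coassoc) (intro L)+
    moreover have "sw (\<lambda>p q. sw (\<lambda>a t. sw (\<lambda>b b'. sw (\<lambda>c c'. ?G a b b' c c') q) t) p) h =
        sw (\<lambda>a s. sw (\<lambda>t q. sw (\<lambda>b b'. sw (\<lambda>c c'. ?G a b b' c c') q) t) s) h"
      by (rule sw_coassoc) (intro L)+
    ultimately show ?thesis by (simp only:)
  qed
  also have "\<dots> = sw (\<lambda>p q. sw (\<lambda>a t. sw (\<lambda>c c'. sw (\<lambda>u v. F (u * S c') (v * S c)) (S a * t)) q) p) h"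
  proof -
    have "sw (\<lambda>b b'. sw (\<lambda>c c'. ?G a b b' c c') q) t =
        sw (\<lambda>c c'. sw (\<lambda>u v. F (u * S c') (v * S c)) (S a * t)) q" for a q t
    proof -
      have "sw (\<lambda>u v. F (u * S c') (v * S c)) (S a * t) = sw (\<lambda>b b'. ?G a b b' c c') t" for c c'
        by (subst sw_mult, (intro L)+, rule sw_swap)
      thus ?thesis by (subst sw_swap) simp
    qed
    thus ?thesis by simp
  qed
  also have "\<dots> = sw (\<lambda>p q. \<epsilon> p * sw (\<lambda>c c'. F (S c') (S c)) q) h"
  proof -
    have "sw (\<lambda>a t. sw (\<lambda>c c'. sw (\<lambda>u v. F (u * S c') (v * S c)) (S a * t)) q) p =
        \<epsilon> p * sw (\<lambda>c c'. sw (\<lambda>u v. F (u * S c') (v * S c)) 1) q" for p q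
      by (rule sw_antipode_leftI[where g = "\<lambda>z. sw (\<lambda>c c'. sw (\<lambda>u v. F (u * S c') (v * S c)) z) q", OF _ refl])
        (intro L)
    moreover have "sw (\<lambda>u v. F (u * S c') (v * S c)) 1 = F (S c') (S c)" for c c'
      by (subst sw_one) (auto intro!: L)
    ultimately show ?thesis by simp
  qed
  also have "\<dots> = sw (\<lambda>c c'. F (S c') (S c)) h"
    by (rule sw_counit_left) (intro L)
  finally show ?thesis using 1 by simp
qed

lemma sw_antipode':
  assumes F: "\<And>b. lin (\<lambda>a. F a b)" "\<And>a. lin (\<lambda>b. F a b)"
  shows "sw (\<lambda>a b. F a b) (S' h) = sw (\<lambda>a b. F (S' b) (S' a)) h"
proof -
  have "sw (\<lambda>a b. F (S' b) (S' a)) (S (S' h)) = sw (\<lambda>a b. F (S' (S a)) (S' (S b))) (S' h)"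
    by (rule sw_antipode) (intro lin_app[OF F(1)] lin_app[OF F(2)] lin_intros)+
  thus ?thesis by simp
qed

lemma antipode'_mult: "S' (x * y) = S' y * S' x"
  using antipode_mult[of "S' y" "S' x"] by (metis S_inv)

lemma antipode'_one [simp]: "S' 1 = 1"
  using antipode_one by (metis S_inv(2))

lemma counit_antipode' [simp]: "\<epsilon> (S' h) = \<epsilon> h"
  using counit_antipode[of "S' h"] by simp

text \<open>Applying \<open>S'\<close> to the antipode identities reverses their factors, which is
  why the legs appear in opposite order: \<open>S' h2 h1\<close> and
  \<open>h2 S' h1\<close>.\<close>

lemma sw_antipode'_leftI:
    "lin g \<Longrightarrow> (\<And>a b. F a b = g (S' b * a)) \<Longrightarrow> sw (\<lambda>a b. F a b) h = \<epsilon> h * g 1"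
  and sw_antipode'_rightI:
    "lin g \<Longrightarrow> (\<And>a b. F a b = g (b * S' a)) \<Longrightarrow> sw (\<lambda>a b. F a b) h = \<epsilon> h * g 1"
  using sw_antipode_left[of "\<lambda>x. g (S' x)" h] sw_antipode_right[of "\<lambda>x. g (S' x)" h]
  by (simp_all add: antipode'_mult lin_app lin_intros)

text \<open>The tensor condition on the coproduct is traded for a condition on all bilinear forms,
  to which the scalar Sweedler calculus applies; tensors are functions, hence equal when all their
  values agree.\<close>

lemma hopf_aut_iff:
  "\<alpha> \<in> Aut \<longleftrightarrow> linH \<alpha> \<and> bij \<alpha> \<and> (\<forall>x y. \<alpha> (x * y) = \<alpha> x * \<alpha> y) \<and> \<alpha> 1 = 1 \<and>
     (\<forall>x. \<epsilon> (\<alpha> x) = \<epsilon> x) \<and> (\<forall>x. S (\<alpha> x) = \<alpha> (S x)) \<and>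
     (\<forall>F h. (\<forall>b. lin (\<lambda>a. F a b)) \<longrightarrow> (\<forall>a. lin (\<lambda>b. F a b)) \<longrightarrow>
        sw F (\<alpha> h) = sw (\<lambda>a b. F (\<alpha> a) (\<alpha> b)) h)"
proof (cases "linH \<alpha>")
  case True
  let ?A = "alg H" and ?t = "tens (alg H) (alg H)"
  have B: "bilinear_map ?A ?A (tensor ?A ?A) (\<lambda>a b. ?t (\<alpha> a) (\<alpha> b))"
    using bilinear_map_comp[OF tens_bilinear[OF ks_alg ks_alg]] True unfolding linH_def by blast
  have "tmap ?A ?A ?A ?A \<alpha> \<alpha> (comult H h) = sw (\<lambda>a b. ?t (\<alpha> a) (\<alpha> b)) h" for h
    unfolding tmap_def by (rule tlift_comult[OF kspace_tensor[OF ks_alg ks_alg] B])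
  moreover have "comult H (\<alpha> h) = sw (\<lambda>a b. ?t (\<alpha> a) (\<alpha> b)) h \<longleftrightarrow>
      (\<forall>F. (\<forall>b. lin (\<lambda>a. F a b)) \<longrightarrow> (\<forall>a. lin (\<lambda>b. F a b)) \<longrightarrow>
        sw F (\<alpha> h) = sw (\<lambda>a b. F (\<alpha> a) (\<alpha> b)) h)" (is "?L \<longleftrightarrow> ?R") for h
  proof -
    have 1: "comult H (\<alpha> h) F = sw F (\<alpha> h)" "sw (\<lambda>a b. ?t (\<alpha> a) (\<alpha> b)) h F = sw (\<lambda>a b. F (\<alpha> a) (\<alpha> b)) h"
      if "bilinear_map ?A ?A ground F" for F
      using that by (simp_all add: comult_eq sw_apply tens_apply)
    \<comment> \<open>Pure tensors take the value 0 at arguments that are not bilinear, so both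
      sides vanish there.\<close>
    have 2: "comult H (\<alpha> h) F = sw (\<lambda>a b. ?t (\<alpha> a) (\<alpha> b)) h F"
      if "\<not> bilinear_map ?A ?A ground F" for F
      using that by (simp add: comult_eq sw_apply tens_def) (simp add: sw_def)
    show ?thesis
    proof
      assume ?L
      thus ?R using 1 bilinear_alg_ground by simp
    next
      assume R: ?R
      show ?L
      proof
        fix F
        show "comult H (\<alpha> h) F = sw (\<lambda>a b. ?t (\<alpha> a) (\<alpha> b)) h F"
        proof (cases "bilinear_map ?A ?A ground F")
          case True
          hence "sw F (\<alpha> h) = sw (\<lambda>a b. F (\<alpha> a) (\<alpha> b)) h"
            using R unfolding bilinear_alg_ground by blast
          thus ?thesis using 1[OF True] by simp
        qed (rule 2)
      qed
    qed
  qed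
  ultimately show ?thesis using True
    by (auto simp: hopf_aut_def alg_iso_def alg_hom_def linH_def)
qed (simp add: hopf_aut_def alg_iso_def alg_hom_def linH_def)

lemma hopf_autD:
  assumes "\<alpha> \<in> Aut"
  shows "linH \<alpha>" "bij \<alpha>" "\<alpha> (x * y) = \<alpha> x * \<alpha> y" "\<alpha> 1 = 1" "\<epsilon> (\<alpha> x) = \<epsilon> x" "S (\<alpha> x) = \<alpha> (S x)"
    "S' (\<alpha> x) = \<alpha> (S' x)" "\<alpha> (inverse_fun \<alpha> x) = x" "inverse_fun \<alpha> (\<alpha> x) = x"
proof -
  show *: "linH \<alpha>" "bij \<alpha>" "\<alpha> (x * y) = \<alpha> x * \<alpha> y" "\<alpha> 1 = 1" "\<epsilon> (\<alpha> x) = \<epsilon> x" "S (\<alpha> x) = \<alpha> (S x)" for x y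
    using assms unfolding hopf_aut_iff by blast+
  show "S' (\<alpha> x) = \<alpha> (S' x)" using *(6)[of "S' x"] by (metis S_inv)
  show "\<alpha> (inverse_fun \<alpha> x) = x" "inverse_fun \<alpha> (\<alpha> x) = x"
    using *(2) by (simp_all add: bij_is_surj surj_f_inv_f bij_is_inj)
qed

lemma sw_aut:
  assumes "\<alpha> \<in> Aut" "\<And>b. lin (\<lambda>a. F a b)" "\<And>a. lin (\<lambda>b. F a b)"
  shows "sw (\<lambda>a b. F a b) (\<alpha> h) = sw (\<lambda>a b. F (\<alpha> a) (\<alpha> b)) h"
  using assms unfolding hopf_aut_iff by blast

lemma hopf_aut_id [simp]: "id \<in> Aut"
  unfolding hopf_aut_iff by (simp add: linH_iff)

lemma hopf_aut_comp [simp]: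
  assumes a: "\<alpha> \<in> Aut" and b: "\<beta> \<in> Aut"
  shows "\<alpha> \<circ> \<beta> \<in> Aut"
proof -
  note A = hopf_autD[OF a] and B = hopf_autD[OF b]
  have "sw F (\<alpha> (\<beta> h)) = sw (\<lambda>x y. F (\<alpha> (\<beta> x)) (\<alpha> (\<beta> y))) h"
    if F: "\<And>b. lin (\<lambda>a. F a b)" "\<And>a. lin (\<lambda>b. F a b)" for F h
  proof -
    have "sw F (\<alpha> (\<beta> h)) = sw (\<lambda>x y. F (\<alpha> x) (\<alpha> y)) (\<beta> h)"
      by (rule sw_aut[OF a F])
    also have "\<dots> = sw (\<lambda>x y. F (\<alpha> (\<beta> x)) (\<alpha> (\<beta> y))) h"
      by (rule sw_aut[OF b lin_app[OF F(1) A(1)] lin_app[OF F(2) A(1)]])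
    finally show ?thesis .
  qed
  moreover have "linH (\<lambda>x. \<alpha> (\<beta> x))" by (rule linH_app[OF A(1) B(1)])
  ultimately show ?thesis
    unfolding hopf_aut_iff by (simp add: comp_def A(3-6) B(3-6) bij_comp[OF B(2) A(2), unfolded comp_def])
qed

lemma hopf_aut_inv [simp]:
  assumes a: "\<alpha> \<in> Aut"
  shows "inverse_fun \<alpha> \<in> Aut"
proof -
  let ?b = "inverse_fun \<alpha>"
  note A = hopf_autD[OF a]
  have l: "linH ?b" by (rule linH_inverse[OF A(1,2)])
  have "sw F (?b h) = sw (\<lambda>a b. F (?b a) (?b b)) h"
    if F: "\<And>b. lin (\<lambda>a. F a b)" "\<And>a. lin (\<lambda>b. F a b)" for F h
    using sw_aut[OF a, of "\<lambda>x y. F (?b x) (?b y)" "?b h"] lin_app[OF F(1) l] lin_app[OF F(2) l]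
    by (simp add: A(8,9))
  moreover have "?b (x * y) = ?b x * ?b y" for x y
    using A(3)[of "?b x" "?b y"] A(8,9) by metis
  moreover have "?b 1 = 1" using A(4,9) by metis
  moreover have "\<epsilon> (?b x) = \<epsilon> x" for x using A(5)[of "?b x"] A(8) by simp
  moreover have "S (?b x) = ?b (S x)" for x using A(6)[of "?b x"] A(8,9) by metis
  ultimately show ?thesis
    unfolding hopf_aut_iff using l A(2) by (simp add: bij_imp_bij_inv)
qed

section \<open>The convolution algebra on the dual\<close>

definition conv :: "('h \<Rightarrow> 'k) \<Rightarrow> ('h \<Rightarrow> 'k) \<Rightarrow> 'h \<Rightarrow> 'k" where
  "conv f g = (\<lambda>h. sw (\<lambda>a b. f a * g b) h)"

lemma lin_conv: "lin f \<Longrightarrow> lin g \<Longrightarrow> lin (conv f g)"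
  unfolding conv_def by (intro lin_intros)

lemma conv_assoc:
  assumes "lin f" "lin g" "lin k"
  shows "conv (conv f g) k = conv f (conv g k)"
  unfolding conv_def fun_eq_iff sw_times
  by (subst sw_coassoc) (auto intro!: lin_intros assms simp: mult.assoc)

lemma conv_counit: "lin f \<Longrightarrow> conv \<epsilon> f = f" "lin f \<Longrightarrow> conv f \<epsilon> = f"
  by (simp_all add: conv_def fun_eq_iff sw_counit_left sw_counit_right)

lemma conv_aut:
  assumes "\<alpha> \<in> Aut" "lin f" "lin g"
  shows "conv f g \<circ> \<alpha> = conv (f \<circ> \<alpha>) (g \<circ> \<alpha>)"
  unfolding conv_def fun_eq_iff comp_def
  by (subst sw_aut[OF assms(1)]) (auto intro: lin_times assms)

lemma conv_one: "lin f \<Longrightarrow> lin g \<Longrightarrow> conv f g 1 = f 1 * g 1"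
  unfolding conv_def by (rule sw_one) (auto intro: lin_times)

lemma lin_comp: "lin f \<Longrightarrow> linH g \<Longrightarrow> lin (f \<circ> g)"
  by (simp add: comp_def lin_app)

lemma dual_simps [simp]:
  "carr (dual H) = {p. lin p}" "scl (dual H) = (\<lambda>c p h. c * p h)" "aunit (dual H) = \<epsilon>"
  by (simp_all add: dual_def lin_def)

lemma dual_mult: "lin p \<Longrightarrow> lin q \<Longrightarrow> amult (dual H) p q = conv p q"
  by (simp add: dual_def conv_def fun_eq_iff sweedler2_eq[OF kspace_ground] bilinear_alg_ground lin_times)

lemma ks_dual [simp]: "is_kspace (dual H)"
proof -
  interpret v: vector_space "scl (dual H)"
    by unfold_locales (auto simp: fun_eq_iff algebra_simps)
  have "v.subspace (carr (dual H))"
    unfolding v.subspace_def by (auto simp: lin_iff algebra_simps)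
  thus ?thesis using v.vector_space_axioms by (simp add: is_kspace_def)
qed

lemma coords_dual: "coords (dual H) E (\<lambda>e p. p e) co"
proof -
  have "p = (\<Sum>e\<in>E. scl (dual H) (p e) (co e))" if "lin p" for p
    using lin_expand[OF that] by (simp add: fun_eq_iff sum_fun_apply mult.commute)
  thus ?thesis by (simp add: coords_def lin_co linear_map_def)
qed

section \<open>Diagonal crossed products\<close>

definition sw3 :: "('h \<Rightarrow> 'h \<Rightarrow> 'h \<Rightarrow> 'u::comm_monoid_add) \<Rightarrow> 'h \<Rightarrow> 'u" where
  "sw3 F h = sw (\<lambda>a t. sw (\<lambda>b c. F a b c) t) h"

lemma sw_cong: "(\<And>a b. F a b = G a b) \<Longrightarrow> sw (\<lambda>a b. F a b) h = sw (\<lambda>a b. G a b) h"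
  by simp

lemma sw3_cong: "(\<And>a b c. F a b c = G a b c) \<Longrightarrow> sw3 (\<lambda>a b c. F a b c) h = sw3 (\<lambda>a b c. G a b c) h"
  by simp

lemma sw_sw3_swap: "sw3 (\<lambda>a b c. sw (\<lambda>u v. F a b c u v) y) x = sw (\<lambda>u v. sw3 (\<lambda>a b c. F a b c u v) x) y"
proof -
  have "sw3 (\<lambda>a b c. sw (\<lambda>u v. F a b c u v) y) x = sw (\<lambda>a t. sw (\<lambda>u v. sw (\<lambda>b c. F a b c u v) t) y) x"
    unfolding sw3_def by (rule sw_cong) (rule sw_swap)
  also have "\<dots> = sw (\<lambda>u v. sw3 (\<lambda>a b c. F a b c u v) x) y"
    unfolding sw3_def by (rule sw_swap)
  finally show ?thesis .
qed

lemma sw3_swap: "sw3 (\<lambda>a b c. sw3 (\<lambda>u v w. F a b c u v w) y) x = sw3 (\<lambda>u v w. sw3 (\<lambda>a b c. F a b c u v w) x) y"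
proof -
  have "sw3 (\<lambda>a b c. sw3 (\<lambda>u v w. F a b c u v w) y) x =
      sw (\<lambda>u s. sw3 (\<lambda>a b c. sw (\<lambda>v w. F a b c u v w) s) x) y"
    unfolding sw3_def[of _ y] by (rule sw_sw3_swap)
  also have "\<dots> = sw3 (\<lambda>u v w. sw3 (\<lambda>a b c. F a b c u v w) x) y"
    unfolding sw3_def[of _ y] by (rule sw_cong) (rule sw_sw3_swap)
  finally show ?thesis .
qed

lemma lin_sw3: "(\<And>a b c. lin (\<lambda>x. F x a b c)) \<Longrightarrow> lin (\<lambda>x. sw3 (\<lambda>a b c. F x a b c) y)"
  unfolding sw3_def by (intro lin_intros)

lemma lin_sw3_arg:
  assumes "\<And>b c. lin (\<lambda>a. F a b c)" "\<And>a c. lin (\<lambda>b. F a b c)" "\<And>a b. lin (\<lambda>c. F a b c)" "linH g"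
  shows "lin (\<lambda>x. sw3 (\<lambda>a b c. F a b c) (g x))"
  unfolding sw3_def by (intro lin_intros assms)

lemma sw3_mult:
  assumes F: "\<And>b c. lin (\<lambda>a. F a b c)" "\<And>a c. lin (\<lambda>b. F a b c)" "\<And>a b. lin (\<lambda>c. F a b c)"
  shows "sw3 (\<lambda>a b c. F a b c) (x * y) = sw3 (\<lambda>a b c. sw3 (\<lambda>u v w. F (a * u) (b * v) (c * w)) y) x"
proof -
  note L = F lin_intros lin_app[OF F(1)] lin_app[OF F(2)] lin_app[OF F(3)]
  have "sw (\<lambda>b c. F d b c) (t * s) = sw (\<lambda>b c. sw (\<lambda>v w. F d (b * v) (c * w)) s) t" for d t s
    by (rule sw_mult) (auto intro!: F)
  moreover have "sw3 (\<lambda>a b c. F a b c) (x * y) = sw (\<lambda>a t. sw (\<lambda>u s. sw (\<lambda>b c. F (a * u) b c) (t * s)) y) x"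
    unfolding sw3_def by (rule sw_mult) (intro L)+
  moreover have "sw (\<lambda>u s. sw (\<lambda>b c. sw (\<lambda>v w. F (a * u) (b * v) (c * w)) s) t) y =
     sw (\<lambda>b c. sw (\<lambda>u s. sw (\<lambda>v w. F (a * u) (b * v) (c * w)) s) y) t" for a t
    by (rule sw_swap)
  ultimately show ?thesis
    unfolding sw3_def by simp
qed

lemma sw3_aut:
  assumes a: "\<alpha> \<in> Aut"
    and F: "\<And>b c. lin (\<lambda>a. F a b c)" "\<And>a c. lin (\<lambda>b. F a b c)" "\<And>a b. lin (\<lambda>c. F a b c)"
  shows "sw3 (\<lambda>a b c. F a b c) (\<alpha> x) = sw3 (\<lambda>a b c. F (\<alpha> a) (\<alpha> b) (\<alpha> c)) x"
proof -
  note L = F lin_intros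
  have "sw (\<lambda>b c. F d b c) (\<alpha> t) = sw (\<lambda>b c. F d (\<alpha> b) (\<alpha> c)) t" for d t
    by (rule sw_aut[OF a]) (auto intro!: F)
  moreover have "sw3 (\<lambda>a b c. F a b c) (\<alpha> x) = sw (\<lambda>a t. sw (\<lambda>b c. F (\<alpha> a) b c) (\<alpha> t)) x"
    unfolding sw3_def by (rule sw_aut[OF a]) (intro L)+
  ultimately show ?thesis
    unfolding sw3_def by simp
qed

lemma sw3_one:
  assumes F: "\<And>b c. lin (\<lambda>a. F a b c)" "\<And>a c. lin (\<lambda>b. F a b c)" "\<And>a b. lin (\<lambda>c. F a b c)"
  shows "sw3 (\<lambda>a b c. F a b c) 1 = F 1 1 1"
  unfolding sw3_def by (subst sw_one, (intro F lin_intros)+, subst sw_one) (auto intro!: F)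

text \<open>Both sides are the five-leg coproduct of h, obtained by splitting the middle leg into
  three or each outer leg into two. This regrouping is what associativity of the crossed product
  comes down to.\<close>

lemma sw3_mid_split:
  assumes F: "\<And>b c d e. lin (\<lambda>a. F a b c d e)" "\<And>a c d e. lin (\<lambda>b. F a b c d e)"
    "\<And>a b d e. lin (\<lambda>c. F a b c d e)" "\<And>a b c e. lin (\<lambda>d. F a b c d e)" "\<And>a b c d. lin (\<lambda>e. F a b c d e)"
  shows "sw3 (\<lambda>a b c. sw3 (\<lambda>u v w. F a u v w c) b) h =
    sw3 (\<lambda>a b c. sw (\<lambda>a1 a2. sw (\<lambda>c1 c2. F a1 a2 b c1 c2) c) a) h"
proof -
  note L = F lin_intros
  \<comment> \<open>The fully right-nested form, to which both sides are brought.\<close>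
  let ?N = "sw (\<lambda>a t. sw (\<lambda>u t. sw (\<lambda>v t. sw (\<lambda>w c. F a u v w c) t) t) t) h"
  have inner: "sw (\<lambda>b c. sw (\<lambda>u s. sw (\<lambda>v w. F a u v w c) s) b) t =
      sw (\<lambda>u t. sw (\<lambda>v t. sw (\<lambda>w c. F a u v w c) t) t) t" for a t
  proof -
    have "sw (\<lambda>b c. sw (\<lambda>u s. sw (\<lambda>v w. F a u v w c) s) b) t =
        sw (\<lambda>u t. sw (\<lambda>s c. sw (\<lambda>v w. F a u v w c) s) t) t"
      by (rule sw_coassoc) (intro L)+
    moreover have "sw (\<lambda>s c. sw (\<lambda>v w. F a u v w c) s) t = sw (\<lambda>v t. sw (\<lambda>w c. F a u v w c) t) t" for u t
      by (rule sw_coassoc) (auto intro!: F)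
    ultimately show ?thesis by simp
  qed
  hence 1: "sw3 (\<lambda>a b c. sw3 (\<lambda>u v w. F a u v w c) b) h = ?N"
    unfolding sw3_def by (rule sw_cong)
  have "sw3 (\<lambda>a b c. sw (\<lambda>a1 a2. sw (\<lambda>c1 c2. F a1 a2 b c1 c2) c) a) h =
      sw (\<lambda>a t. sw (\<lambda>a1 a2. sw (\<lambda>b c. sw (\<lambda>c1 c2. F a1 a2 b c1 c2) c) t) a) h"
    unfolding sw3_def by (rule sw_cong) (rule sw_swap)
  also have "\<dots> = ?N"
    by (rule sw_coassoc) (intro L)+
  finally show ?thesis using 1 by simp
qed

text \<open>As \<open>H\<^sup>* \<otimes> H\<close> is the space of all diagonal crossed products, its points are separated by the
  functionals \<open>p \<bowtie> h \<mapsto> p(x) f(h)\<close>; equations in \<open>H\<^sup>* \<bowtie> H\<close> become scalar Sweedler identities.\<close>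

abbreviation DS :: "('k, ('k, 'h) dcp) kspace" where
  "DS \<equiv> tensor (dual H) (alg H)"

abbreviation DS2 where "DS2 \<equiv> tensor DS DS"

abbreviation DS3 where "DS3 \<equiv> tensor DS DS2"

definition ev :: "('k, 'h) dcp \<Rightarrow> 'h \<Rightarrow> ('h \<Rightarrow> 'k) \<Rightarrow> 'k" where
  "ev t x f = t (\<lambda>p h. p x * f h)"

definition ev2 :: "((('k, 'h) dcp \<Rightarrow> ('k, 'h) dcp \<Rightarrow> 'k) \<Rightarrow> 'k) \<Rightarrow> 'h \<Rightarrow> ('h \<Rightarrow> 'k) \<Rightarrow> 'h \<Rightarrow> ('h \<Rightarrow> 'k) \<Rightarrow> 'k" where
  "ev2 T x f y g = T (\<lambda>a b. ev a x f * ev b y g)"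

definition ev3 where
  "ev3 T x f y g z k = T (\<lambda>a s. ev a x f * ev2 s y g z k)"

lemma ks_DS [simp]: "is_kspace DS"
  by (rule kspace_tensor) auto

lemma ks_DS2 [simp]: "is_kspace DS2"
  by (rule kspace_tensor) auto

lemma ks_DS3 [simp]: "is_kspace DS3" "is_kspace (tensor DS2 DS)"
  by (rule kspace_tensor; simp)+

lemma ev_linear: "linear_map DS ground (\<lambda>t. ev t x f)"
  unfolding ev_def by (rule tensor_apply_linear)

lemma ev2_linear: "linear_map DS2 ground (\<lambda>t. ev2 t x f y g)"
  unfolding ev2_def by (rule tensor_apply_linear)

lemma ev3_linear: "linear_map DS3 ground (\<lambda>t. ev3 t x f y g z k)"
  unfolding ev3_def by (rule tensor_apply_linear)

lemma coords_DS:
  "coords DS (E \<times> E) (\<lambda>(i, j) t. ev t i (co j)) (\<lambda>(i, j). tens (dual H) (alg H) (co i) j)"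
  using coords_tensor[OF coords_dual coords_alg] by (simp add: ev_def)

lemma coords_DS2:
  "coords DS2 ((E \<times> E) \<times> (E \<times> E)) (\<lambda>((i, j), (i', j')) t. ev2 t i (co j) i' (co j'))
    (\<lambda>((i, j), (i', j')). tens DS DS (tens (dual H) (alg H) (co i) j) (tens (dual H) (alg H) (co i') j'))"
  using coords_tensor[OF coords_DS coords_DS] by (simp add: ev2_def case_prod_unfold)

lemma coords_DS3:
  "\<exists>b. coords DS3 ((E \<times> E) \<times> ((E \<times> E) \<times> (E \<times> E)))
    (\<lambda>((i, j), ((i', j'), (i'', j''))) t. ev3 t i (co j) i' (co j') i'' (co j'')) b"
  using coords_tensor[OF coords_DS coords_DS2] unfolding ev3_def by (simp add: case_prod_unfold) blast

lemma ev_ext: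
  "t \<in> carr DS \<Longrightarrow> u \<in> carr DS \<Longrightarrow> (\<And>x f. lin f \<Longrightarrow> ev t x f = ev u x f) \<Longrightarrow> t = u"
  using lin_co by (auto intro: coords_separate[OF coords_DS])

lemma ev2_ext:
  "t \<in> carr DS2 \<Longrightarrow> u \<in> carr DS2 \<Longrightarrow>
    (\<And>x f y g. lin f \<Longrightarrow> lin g \<Longrightarrow> ev2 t x f y g = ev2 u x f y g) \<Longrightarrow> t = u"
  using lin_co by (auto intro!: coords_separate[OF coords_DS2])

lemma ev3_ext:
  assumes "t \<in> carr DS3" "u \<in> carr DS3"
    "\<And>x f y g z k. lin f \<Longrightarrow> lin g \<Longrightarrow> lin k \<Longrightarrow> ev3 t x f y g z k = ev3 u x f y g z k"
  shows "t = u"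
proof -
  obtain b where "coords DS3 ((E \<times> E) \<times> ((E \<times> E) \<times> (E \<times> E)))
    (\<lambda>((i, j), ((i', j'), (i'', j''))) t. ev3 t i (co j) i' (co j') i'' (co j'')) b"
    using coords_DS3 by blast
  from coords_separate[OF this assms(1,2)] show ?thesis
    using assms(3) lin_co by auto
qed

lemma lin_linear: "lin f \<longleftrightarrow> linear_map (alg H) ground f"
  by (simp add: lin_def)

lemma ev_bt [simp]: "lin p \<Longrightarrow> lin f \<Longrightarrow> ev (bt H p h) x f = p x * f h"
  unfolding ev_def bt_def
  by (rule tens_apply, rule bilinear_map_ground_mult) (auto simp: lin_def linear_map_def)

lemma ev2_tens [simp]: "ev2 (tens DS DS a b) x f y g = ev a x f * ev b y g"
  unfolding ev2_def by (intro tens_apply bilinear_map_ground_mult ev_linear)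

lemma ev3_tens [simp]: "ev3 (tens DS DS2 a s) x f y g z k = ev a x f * ev2 s y g z k"
  unfolding ev3_def by (intro tens_apply bilinear_map_ground_mult ev_linear ev2_linear)

lemma bt_carr [simp]: "lin p \<Longrightarrow> bt H p h \<in> carr DS"
  unfolding bt_def by (rule tens_carr) auto

lemma linear_map_dualI:
  assumes "is_kspace V" "\<And>v. v \<in> carr V \<Longrightarrow> lin (P v)" "\<And>x. linear_map V ground (\<lambda>v. P v x)"
  shows "linear_map V (dual H) P"
  using assms by (auto simp: linear_map_def fun_eq_iff)

lemma DS_eqI:
  assumes "linear_map DS U f" "linear_map DS U g" "t \<in> carr DS"
    "\<And>p h. lin p \<Longrightarrow> f (bt H p h) = g (bt H p h)"
  shows "f t = g t"
  by (rule tensor_linear_eqI[OF ks_dual ks_alg assms(1,2) _ assms(3)]) (use assms(4) in \<open>simp add: bt_def\<close>)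

lemma bt_bilinear: "bilinear_map (dual H) (alg H) DS (bt H)"
  using tens_bilinear[OF ks_dual ks_alg] by (simp add: bilinear_map_def linear_map_def bt_def)

lemma DT_simps [simp]:
  "carr (DT H a) = carr DS" "scl (DT H a) = scl DS" "aunit (DT H a) = bt H \<epsilon> 1"
  by (simp_all add: DT_def case_prod_unfold)

lemma DT_tens [simp]:
  "tens (DT H a) (DT H b) = tens DS DS" "tensor (DT H a) (DT H b) = DS2"
  "tens (DT H a) (tensor V W) = tens DS (tensor V W)" "tens (tensor V W) (DT H a) = tens (tensor V W) DS"
  "tensor (DT H a) (tensor V W) = tensor DS (tensor V W)"
  "tensor (tensor V W) (DT H a) = tensor (tensor V W) DS"
  by (rule tens_congs; simp)+

lemma DT_tlift [simp]:
  "tlift (DT H a) (DT H b) F = tlift DS DS F"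
  "tlift (DT H a) (tensor V W) F' = tlift DS (tensor V W) F'"
  "tlift (tensor V W) (DT H a) F'' = tlift (tensor V W) DS F''"
  by (subst tens_congs(3); simp)+

lemma ks_DT [simp]: "is_kspace (DT H a)"
  by (subst space_congs(1)[of _ DS]) auto

lemma DT_linear_map [simp]:
  "linear_map (DT H a) W f = linear_map DS W f" "linear_map V (DT H a) g = linear_map V DS g"
  by (rule space_congs; simp)+

lemma DT_bilinear_map [simp]:
  "bilinear_map (DT H a) (DT H b) (DT H c) f = bilinear_map DS DS DS f"
  by (simp add: bilinear_map_def)

section \<open>The twisted action on the dual and the crossed multiplication\<close>

definition act :: "('h \<Rightarrow> 'h) \<Rightarrow> ('h \<Rightarrow> 'h) \<Rightarrow> ('h \<Rightarrow> 'k) \<Rightarrow> 'h \<Rightarrow> 'h \<Rightarrow> 'h \<Rightarrow> 'k" where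
  "act \<alpha> \<beta> q a c = (\<lambda>x. q (S' (\<beta> c) * x * \<alpha> a))"

lemma act_eq: "\<alpha> a \<rightharpoonup> q \<leftharpoonup> S' (\<beta> c) = act \<alpha> \<beta> q a c"
  by (simp add: lact_def ract_def act_def)

lemma linear_map_times:
  "linear_map V ground f \<Longrightarrow> linear_map V ground (\<lambda>x. f x * c)"
  "linear_map V ground f \<Longrightarrow> linear_map V ground (\<lambda>x. c * f x)"
  by (auto simp: linear_map_def algebra_simps)

lemma linear_map_sw:
  "is_kspace U \<Longrightarrow> (\<And>a b. linear_map V U (\<lambda>x. F x a b)) \<Longrightarrow> linear_map V U (\<lambda>x. sw (\<lambda>a b. F x a b) h)"
  unfolding sw_def by (rule linear_map_setsum)

lemma linear_map_sw3:
  "is_kspace U \<Longrightarrow> (\<And>a b c. linear_map V U (\<lambda>x. F x a b c)) \<Longrightarrow> linear_map V U (\<lambda>x. sw3 (\<lambda>a b c. F x a b c) h)"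
  unfolding sw3_def by (intro linear_map_sw)

lemma linear_map_dual_eval: "linear_map (dual H) ground (\<lambda>p. p x)"
  by (simp add: linear_map_def)

lemmas dual_intros = linear_map_times linear_map_sw[OF kspace_ground] linear_map_sw3[OF kspace_ground]
  linear_map_dual_eval linear_map_setsum[OF kspace_ground]

lemma linear_of_sw3:
  assumes "is_kspace V" "linear_map V U f" "\<And>a b c. F a b c \<in> carr V"
  shows "f (sw3 (\<lambda>a b c. F a b c) h) = sw3 (\<lambda>a b c. f (F a b c)) h"
  unfolding sw3_def
  by (subst linear_of_sw[OF assms(1,2)], rule sw_carr[OF assms(1,3)], rule sw_cong,
      rule linear_of_sw[OF assms])

lemma sweedler3_eq:
  assumes U: "is_kspace U"
    and F: "\<And>b c. linear_map (alg H) U (\<lambda>a. F a b c)" "\<And>a c. linear_map (alg H) U (\<lambda>b. F a b c)"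
      "\<And>a b. linear_map (alg H) U (\<lambda>c. F a b c)"
  shows "sweedler3 H F h = sw3 F h"
    and "linear_map (alg H) U (sw3 F)"
proof -
  have B: "bilinear_map (alg H) (alg H) U (F a)" for a
    using F by (simp add: bilinear_map_def)
  have B2: "bilinear_map (alg H) (alg H) U (\<lambda>a t. sw (F a) t)"
    using sw_linear_map[OF U B] linear_map_sw[OF U F(1)] by (simp add: bilinear_map_def)
  have "(\<lambda>a t. sweedler2 H (F a) t) = (\<lambda>a t. sw (F a) t)"
    by (intro ext sweedler2_eq[OF U B])
  thus "sweedler3 H F h = sw3 F h"
    unfolding sweedler3_def sw3_def using sweedler2_eq[OF U B2, of h] by simp
  show "linear_map (alg H) U (sw3 F)"
    using sw_linear_map[OF U B2] unfolding sw3_def[abs_def] by simp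
qed

lemma lin_act: "lin q \<Longrightarrow> lin (act \<alpha> \<beta> q a c)"
  unfolding act_def by (rule lin_app, assumption) (intro lin_intros)

lemma linear_map_bt1: "linear_map V (dual H) P \<Longrightarrow> linear_map V DS (\<lambda>x. bt H (P x) h)"
  using linear_map_comp[OF _ bilinear_mapD(1)[OF bt_bilinear]] by simp

lemma linear_map_bt2: "lin p \<Longrightarrow> linear_map V (alg H) g \<Longrightarrow> linear_map V DS (\<lambda>x. bt H p (g x))"
  using linear_map_comp[OF _ bilinear_mapD(2)[OF bt_bilinear]] by simp

lemma act_linear:
  assumes "\<beta> \<in> Aut" "\<alpha> \<in> Aut" "lin q"
  shows "lin (\<lambda>a. act \<alpha> \<beta> q a c x)" "lin (\<lambda>c. act \<alpha> \<beta> q a c x)" "lin (\<lambda>x. act \<alpha> \<beta> q a c x)"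
  unfolding act_def
  by (intro lin_intros lin_app[OF assms(3)] linH_app[OF hopf_autD(1)[OF assms(1)]]
      linH_app[OF hopf_autD(1)[OF assms(2)]])+

lemma act_dual: "linear_map (dual H) ground (\<lambda>q. act \<alpha> \<beta> q a c x)"
  unfolding act_def by (rule linear_map_dual_eval)

lemma conv_dual:
  "linear_map (dual H) ground (\<lambda>p. conv p q x)"
  "(\<And>x. linear_map (dual H) ground (\<lambda>q. F q x)) \<Longrightarrow> linear_map (dual H) ground (\<lambda>q. conv p (F q) x)"
  unfolding conv_def by (intro dual_intros; assumption)+

text \<open>The product of \<open>bt H p h\<close> and \<open>bt H q l\<close> in the crossed
  product for (\<alpha>, \<beta>), as \<open>DT_mult\<close> shows, with finite sums in place of
  lifted Sweedler sums.\<close>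

definition cross :: "('h \<Rightarrow> 'h) \<Rightarrow> ('h \<Rightarrow> 'h) \<Rightarrow> ('h \<Rightarrow> 'k) \<Rightarrow> 'h \<Rightarrow> ('h \<Rightarrow> 'k) \<Rightarrow> 'h \<Rightarrow> ('k, 'h) dcp" where
  "cross \<alpha> \<beta> p h q l = sw3 (\<lambda>a b c. bt H (conv p (act \<alpha> \<beta> q a c)) (b * l)) h"

lemma cross_linear:
  assumes ab: "\<beta> \<in> Aut" "\<alpha> \<in> Aut"
  shows "lin p \<Longrightarrow> lin q \<Longrightarrow> linear_map (alg H) DS (\<lambda>h. cross \<alpha> \<beta> p h q l)"
    and "lin p \<Longrightarrow> lin q \<Longrightarrow> linear_map (alg H) DS (\<lambda>l. cross \<alpha> \<beta> p h q l)"
    and "lin q \<Longrightarrow> linear_map (dual H) DS (\<lambda>p. cross \<alpha> \<beta> p h q l)"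
    and "lin p \<Longrightarrow> linear_map (dual H) DS (\<lambda>q. cross \<alpha> \<beta> p h q l)"
    and "lin p \<Longrightarrow> lin q \<Longrightarrow> sweedler3 H (\<lambda>a b c. bt H (amult (dual H) p (\<alpha> a \<rightharpoonup> q \<leftharpoonup> S' (\<beta> c))) (b * l)) h =
      cross \<alpha> \<beta> p h q l"
proof -
  note L = lin_act lin_conv
  note A = act_linear[OF ab]
  have 1: "linear_map (alg H) DS (\<lambda>a. bt H (conv p (act \<alpha> \<beta> q a c)) b)" if "lin p" "lin q" for p q c b
    by (rule linear_map_bt1, rule linear_map_dualI)
      (auto simp: that L lin_linear[symmetric] conv_def intro!: lin_intros A that)
  have 2: "linear_map (alg H) DS (\<lambda>c. bt H (conv p (act \<alpha> \<beta> q a c)) b)" if "lin p" "lin q" for p q a b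
    by (rule linear_map_bt1, rule linear_map_dualI)
      (auto simp: that L lin_linear[symmetric] conv_def intro!: lin_intros A that)
  have 3: "linear_map (alg H) DS (\<lambda>b. bt H (conv p (act \<alpha> \<beta> q a c)) (b * l))" if "lin p" "lin q" for p q a l c
    by (rule linear_map_bt2) (auto simp: that L linH_def[symmetric] intro!: lin_intros)
  have 4: "linear_map (alg H) DS (\<lambda>l. bt H (conv p (act \<alpha> \<beta> q a c)) (b * l))" if "lin p" "lin q" for p q a b c
    by (rule linear_map_bt2) (auto simp: that L linH_def[symmetric] intro!: lin_intros)
  show "linear_map (alg H) DS (\<lambda>h. cross \<alpha> \<beta> p h q l)" if "lin p" "lin q"
    unfolding cross_def by (rule sweedler3_eq(2)[OF ks_DS]) (intro 1 2 3 that)+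
  show "linear_map (alg H) DS (\<lambda>l. cross \<alpha> \<beta> p h q l)" if "lin p" "lin q"
    unfolding cross_def by (intro linear_map_sw3 ks_DS 4 that)
  show "linear_map (dual H) DS (\<lambda>p. cross \<alpha> \<beta> p h q l)" if "lin q"
    unfolding cross_def
    by (intro linear_map_sw3 ks_DS linear_map_bt1 linear_map_dualI conv_dual(1))
      (simp_all add: L that)
  show "linear_map (dual H) DS (\<lambda>q. cross \<alpha> \<beta> p h q l)" if "lin p"
    unfolding cross_def
    by (intro linear_map_sw3 ks_DS linear_map_bt1 linear_map_dualI conv_dual(2) act_dual)
      (simp_all add: L that)
  show "sweedler3 H (\<lambda>a b c. bt H (amult (dual H) p (\<alpha> a \<rightharpoonup> q \<leftharpoonup> S' (\<beta> c))) (b * l)) h =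
      cross \<alpha> \<beta> p h q l" if "lin p" "lin q"
    unfolding cross_def act_eq using that
    by (simp add: dual_mult L sweedler3_eq(1)[OF ks_DS 1 3 2])
qed

lemma cross_carr [simp]:
  "\<beta> \<in> Aut \<Longrightarrow> \<alpha> \<in> Aut \<Longrightarrow> lin p \<Longrightarrow> lin q \<Longrightarrow> cross \<alpha> \<beta> p h q l \<in> carr DS"
  using linear_mapD(1)[OF cross_linear(1)] by simp

text \<open>The formulas in the definitions are simplified for linear functionals. Linearity is
  proved for the simplified formula and carried back through agreement on the carrier.\<close>

lemma linear_map_cong:
  assumes "is_kspace V" "\<And>x. x \<in> carr V \<Longrightarrow> f x = g x"
  shows "linear_map V W f = linear_map V W g"
  using assms by (auto simp: linear_map_def kspace_closed)

lemma DT_mult: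
  assumes "\<alpha> \<in> Aut" "\<beta> \<in> Aut"
  shows "bilinear_map DS DS DS (amult (DT H (\<alpha>, \<beta>)))"
    and "lin p \<Longrightarrow> lin q \<Longrightarrow> amult (DT H (\<alpha>, \<beta>)) (bt H p h) (bt H q l) = cross \<alpha> \<beta> p h q l"
proof -
  note C = cross_linear[OF assms(2,1)]
  let ?M = "\<lambda>p h q l. sweedler3 H (\<lambda>a b c. bt H (amult (dual H) p (\<alpha> a \<rightharpoonup> q \<leftharpoonup> S' (\<beta> c))) (b * l)) h"
  have 1: "bilinear_map (dual H) (alg H) DS (?M p h)" if "p \<in> carr (dual H)" for p h
  proof (rule bilinear_mapI)
    show "linear_map (dual H) DS (\<lambda>q. ?M p h q l)" for l
      by (subst linear_map_cong[OF ks_dual, where g = "\<lambda>q. cross \<alpha> \<beta> p h q l"])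
        (use C that in auto)
    show "linear_map (alg H) DS (\<lambda>l. ?M p h q l)" if "q \<in> carr (dual H)" for q
      by (subst linear_map_cong[OF ks_alg, where g = "\<lambda>l. cross \<alpha> \<beta> p h q l"])
        (use C that \<open>p \<in> carr (dual H)\<close> in auto)
  qed
  have 2: "bilinear_map (dual H) (alg H) DS (\<lambda>p h. ?M p h q l)" if "q \<in> carr (dual H)" for q l
  proof (rule bilinear_mapI)
    show "linear_map (dual H) DS (\<lambda>p. ?M p h q l)" for h
      by (subst linear_map_cong[OF ks_dual, where g = "\<lambda>p. cross \<alpha> \<beta> p h q l"])
        (use C that in auto)
    show "linear_map (alg H) DS (\<lambda>h. ?M p h q l)" if "p \<in> carr (dual H)" for p
      by (subst linear_map_cong[OF ks_alg, where g = "\<lambda>h. cross \<alpha> \<beta> p h q l"])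
        (use C that \<open>q \<in> carr (dual H)\<close> in auto)
  qed
  note T = tlift2_bilinear[OF ks_dual ks_alg ks_DS ks_dual ks_alg, of ?M, OF 1 2]
  show "bilinear_map DS DS DS (amult (DT H (\<alpha>, \<beta>)))"
    using T(1) by (simp add: DT_def)
  show "amult (DT H (\<alpha>, \<beta>)) (bt H p h) (bt H q l) = cross \<alpha> \<beta> p h q l" if "lin p" "lin q"
    using T(2)[of p h q l] C(5) that by (simp add: DT_def bt_def)
qed

lemma DT_mult_linear:
  assumes "\<alpha> \<in> Aut" "\<beta> \<in> Aut"
  shows "t \<in> carr DS \<Longrightarrow> linear_map DS DS (amult (DT H (\<alpha>, \<beta>)) t)"
    "u \<in> carr DS \<Longrightarrow> linear_map DS DS (\<lambda>t. amult (DT H (\<alpha>, \<beta>)) t u)"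
    "t \<in> carr DS \<Longrightarrow> u \<in> carr DS \<Longrightarrow> amult (DT H (\<alpha>, \<beta>)) t u \<in> carr DS"
  using bilinear_mapD[OF DT_mult(1)[OF assms]] by auto

lemma ev_sw3:
  "(\<And>a b c. F a b c \<in> carr DS) \<Longrightarrow> ev (sw3 (\<lambda>a b c. F a b c) h) x f = sw3 (\<lambda>a b c. ev (F a b c) x f) h"
  by (rule linear_of_sw3[OF ks_DS ev_linear])

lemma ev_cross:
  assumes "\<beta> \<in> Aut" "\<alpha> \<in> Aut" "lin p" "lin q" "lin f"
  shows "ev (cross \<alpha> \<beta> p h q l) x f = sw3 (\<lambda>a b c. conv p (act \<alpha> \<beta> q a c) x * f (b * l)) h"
  unfolding cross_def using assms by (subst ev_sw3) (auto simp: lin_conv lin_act)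

text \<open>The factors coming from c and c' are stacked on the left of the argument in reversed
  order. \<open>S'\<close> reverses products, which offsets this, so both pairs of indices multiply
  in the same order.\<close>

lemma act_act:
  assumes "\<beta> \<in> Aut" "\<alpha> \<in> Aut"
  shows "act \<alpha> \<beta> (act \<alpha> \<beta> r a' c') a c = act \<alpha> \<beta> r (a * a') (c * c')"
  using hopf_autD(3)[OF assms(1)] hopf_autD(3)[OF assms(2)]
  by (simp add: act_def antipode'_mult mult.assoc)

text \<open>Expand the coproduct of \<open>S' (\<beta> c) * x * \<alpha> a\<close> factor by factor.
  Since \<open>S'\<close> reverses coproducts, \<open>q\<close> receives the second leg of c and
  \<open>r\<close> the first.\<close>

lemma act_conv:
  assumes ab: "\<beta> \<in> Aut" "\<alpha> \<in> Aut" and q: "lin q" "lin r"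
  shows "act \<alpha> \<beta> (conv q r) a c x =
    sw (\<lambda>a1 a2. sw (\<lambda>c1 c2. conv (act \<alpha> \<beta> q a1 c2) (act \<alpha> \<beta> r a2 c1) x) c) a"
proof -
  note L = lin_intros lin_app[OF q(1)] lin_app[OF q(2)]
    linH_app[OF hopf_autD(1)[OF ab(1)]] linH_app[OF hopf_autD(1)[OF ab(2)]]
  have "act \<alpha> \<beta> (conv q r) a c x = sw (\<lambda>x1 x2. sw (\<lambda>a1 a2. q (x1 * a1) * r (x2 * a2)) (\<alpha> a)) (S' (\<beta> c) * x)"
    unfolding act_def conv_def by (rule sw_mult) (intro L)+
  also have "\<dots> = sw (\<lambda>x1 x2. sw (\<lambda>a1 a2. q (x1 * \<alpha> a1) * r (x2 * \<alpha> a2)) a) (S' (\<beta> c) * x)"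
    by (subst sw_aut[OF ab(2)]) (intro L refl)+
  also have "\<dots> = sw (\<lambda>c1 c2. sw (\<lambda>x1 x2. sw (\<lambda>a1 a2. q (c1 * x1 * \<alpha> a1) * r (c2 * x2 * \<alpha> a2)) a) x) (S' (\<beta> c))"
    by (rule sw_mult) (intro L)+
  also have "\<dots> = sw (\<lambda>c1 c2. sw (\<lambda>x1 x2. sw (\<lambda>a1 a2. q (S' c2 * x1 * \<alpha> a1) * r (S' c1 * x2 * \<alpha> a2)) a) x) (\<beta> c)"
    by (rule sw_antipode') (intro L)+
  also have "\<dots> = sw (\<lambda>c1 c2. sw (\<lambda>x1 x2. sw (\<lambda>a1 a2. q (S' (\<beta> c2) * x1 * \<alpha> a1) * r (S' (\<beta> c1) * x2 * \<alpha> a2)) a) x) c"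
    by (rule sw_aut[OF ab(1)]) (intro L)+
  also have "\<dots> = sw (\<lambda>c1 c2. sw (\<lambda>a1 a2. conv (act \<alpha> \<beta> q a1 c2) (act \<alpha> \<beta> r a2 c1) x) a) c"
    unfolding act_def conv_def by (rule sw_cong) (rule sw_swap)
  also have "\<dots> = sw (\<lambda>a1 a2. sw (\<lambda>c1 c2. conv (act \<alpha> \<beta> q a1 c2) (act \<alpha> \<beta> r a2 c1) x) c) a"
    by (rule sw_swap)
  finally show ?thesis .
qed

section \<open>Associativity and unit of the crossed product\<close>

lemma conv_of_sw: "conv p (\<lambda>x. sw (\<lambda>a b. F a b x) h) x = sw (\<lambda>a b. conv p (F a b) x) h"
  unfolding conv_def sw_times by (rule sw_swap)

lemma conv_linear:
  "(\<And>x. lin (\<lambda>a. F a x)) \<Longrightarrow> lin (\<lambda>a. conv p (F a) x)"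
  "(\<And>x. lin (\<lambda>a. F a x)) \<Longrightarrow> lin (\<lambda>a. conv (F a) p x)"
  unfolding conv_def by (intro lin_intros; assumption)+

text \<open>With h in five legs, on both sides h1 and h5 act on \<open>q\<close>, h2 and h4 act on
  \<open>r\<close>, and h3 stays in the H-component. On the left h2, h3, h4 arise by splitting the
  middle leg; on the right the pairs h1, h2 and h4, h5 arise from \<open>act_conv\<close>.
  \<open>sw3_mid_split\<close> identifies the two.\<close>

lemma cross_assoc:
  assumes ab: "\<beta> \<in> Aut" "\<alpha> \<in> Aut" and p: "lin p" and q: "lin q" and r: "lin r"
  shows "amult (DT H (\<alpha>, \<beta>)) (amult (DT H (\<alpha>, \<beta>)) (bt H p h) (bt H q l)) (bt H r m) =
    amult (DT H (\<alpha>, \<beta>)) (bt H p h) (amult (DT H (\<alpha>, \<beta>)) (bt H q l) (bt H r m))" (is "?L = ?R")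
proof (rule ev_ext)
  note M = DT_mult[OF ab(2,1)] and Mlin = DT_mult_linear[OF ab(2,1)]
  note la = lin_act lin_conv
  show "?L \<in> carr DS" "?R \<in> carr DS" using p q r by (auto intro!: Mlin)
  fix x f assume f: "lin f"
  let ?a = "act \<alpha> \<beta>"
  note A = act_linear[OF ab]
  note L = lin_intros lin_app[OF f] lin_sw3 lin_sw3_arg conv_linear lin_app[OF A(1)] lin_app[OF A(2)] A q r p
  have eL: "?L = sw3 (\<lambda>a b c. cross \<alpha> \<beta> (conv p (?a q a c)) (b * l) r m) h"
    unfolding M(2)[OF p q] unfolding cross_def[of \<alpha> \<beta> p h]
    by (subst linear_of_sw3[OF ks_DS Mlin(2)]) (simp_all add: M(2) la p q r)
  have eR: "?R = sw3 (\<lambda>u v w. cross \<alpha> \<beta> p h (conv q (?a r u w)) (v * m)) l"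
    unfolding M(2)[OF q r] unfolding cross_def[of \<alpha> \<beta> q]
    by (subst linear_of_sw3[OF ks_DS Mlin(1)]) (simp_all add: M(2) la p q r)
  \<comment> \<open>The general term with \<open>l\<close> already summed out; its arguments are the
    five legs of h in order.\<close>
  define F where "F a u v w c =
    sw3 (\<lambda>u' v' w'. conv (conv p (?a q a c)) (?a r (u * u') (w * w')) x * f (v * v' * m)) l" for a u v w c
  have "ev ?L x f = sw3 (\<lambda>a b c. sw3 (\<lambda>u v w. conv (conv p (?a q a c)) (?a r u w) x * f (v * m)) (b * l)) h"
    unfolding eL using p q r f by (subst ev_sw3) (simp_all add: ab la ev_cross)
  also have "\<dots> = sw3 (\<lambda>a b c. sw3 (\<lambda>u v w. F a u v w c) b) h"
    unfolding F_def by (rule sw3_cong, rule sw3_mult) (intro L)+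
  also have "\<dots> = sw3 (\<lambda>a b c. sw (\<lambda>a1 a2. sw (\<lambda>c1 c2. F a1 a2 b c1 c2) c) a) h"
    unfolding F_def by (rule sw3_mid_split) (intro L)+
  also have "\<dots> = sw3 (\<lambda>a b c. sw3 (\<lambda>u v w. conv p (?a (conv q (?a r u w)) a c) x * f (b * (v * m))) l) h"
  proof (rule sw3_cong)
    fix a b c
    have "sw (\<lambda>a1 a2. sw (\<lambda>c1 c2. F a1 a2 b c1 c2) c) a =
      sw3 (\<lambda>u v w. sw (\<lambda>a1 a2. sw (\<lambda>c1 c2.
        conv (conv p (?a q a1 c2)) (?a r (a2 * u) (c1 * w)) x * f (b * v * m)) c) a) l"
      unfolding F_def by (simp only: sw_sw3_swap)
    also have "\<dots> = sw3 (\<lambda>u v w. conv p (?a (conv q (?a r u w)) a c) x * f (b * (v * m))) l"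
    proof (rule sw3_cong)
      fix u v w
      have "?a (conv q (?a r u w)) a c = (\<lambda>x. sw (\<lambda>a1 a2. sw (\<lambda>c1 c2.
          conv (?a q a1 c2) (?a r (a2 * u) (c1 * w)) x) c) a)"
        using q r by (intro ext) (simp add: act_conv[OF ab] la act_act[OF ab])
      hence "conv p (?a (conv q (?a r u w)) a c) x =
          sw (\<lambda>a1 a2. sw (\<lambda>c1 c2. conv p (conv (?a q a1 c2) (?a r (a2 * u) (c1 * w))) x) c) a"
        by (simp add: conv_of_sw)
      thus "sw (\<lambda>a1 a2. sw (\<lambda>c1 c2.
          conv (conv p (?a q a1 c2)) (?a r (a2 * u) (c1 * w)) x * f (b * v * m)) c) a =
          conv p (?a (conv q (?a r u w)) a c) x * f (b * (v * m))"
        by (simp add: sw_times conv_assoc p q r la mult.assoc)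
    qed
    finally show "sw (\<lambda>a1 a2. sw (\<lambda>c1 c2. F a1 a2 b c1 c2) c) a =
      sw3 (\<lambda>u v w. conv p (?a (conv q (?a r u w)) a c) x * f (b * (v * m))) l" .
  qed
  also have "\<dots> = sw3 (\<lambda>u v w. sw3 (\<lambda>a b c. conv p (?a (conv q (?a r u w)) a c) x * f (b * (v * m))) h) l"
    by (rule sw3_swap)
  also have "\<dots> = ev ?R x f"
    unfolding eR using p q r f by (subst ev_sw3) (simp_all add: ab la ev_cross)
  finally show "ev ?L x f = ev ?R x f" .
qed

lemma DT_assoc:
  assumes ab: "\<alpha> \<in> Aut" "\<beta> \<in> Aut"
    and x: "x \<in> carr DS" and y: "y \<in> carr DS" and z: "z \<in> carr DS"
  shows "amult (DT H (\<alpha>, \<beta>)) (amult (DT H (\<alpha>, \<beta>)) x y) z =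
    amult (DT H (\<alpha>, \<beta>)) x (amult (DT H (\<alpha>, \<beta>)) y z)"
proof -
  let ?m = "amult (DT H (\<alpha>, \<beta>))"
  note M = DT_mult_linear[OF ab]
  have 1: "?m (?m (bt H p h) (bt H q l)) z = ?m (bt H p h) (?m (bt H q l) z)" if "lin p" "lin q" for p h q l
    by (rule DS_eqI[OF _ _ z, where U = DS])
      (use that in \<open>auto intro!: M cross_assoc ab linear_map_comp[OF M(1) M(1)]\<close>)
  have 2: "?m (?m (bt H p h) y) z = ?m (bt H p h) (?m y z)" if "lin p" for p h
    by (rule DS_eqI[OF _ _ y, where U = DS])
      (use that z in \<open>auto intro!: 1 linear_map_comp[OF M(1) M(2)] linear_map_comp[OF M(2) M(1)]\<close>)
  show ?thesis
    by (rule DS_eqI[OF _ _ x, where U = DS])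
      (use y z in \<open>auto intro!: 2 M linear_map_comp[OF M(2) M(2)]\<close>)
qed

text \<open>Two products without crossing: the legs of 1 are trivial and \<open>act\<close> at (1,
  1) is the identity, while \<open>act\<close> changes the counit only by the scalars \<epsilon>(a)
  and \<epsilon>(c), which the counit axioms absorb. So the dual and H multiply as subalgebras; the
  antipode and R-matrix computations rest on these cases.\<close>

lemma DT_mult_bt_unit:
  assumes ab: "\<alpha> \<in> Aut" "\<beta> \<in> Aut" and q: "lin q"
  shows "lin p \<Longrightarrow> amult (DT H (\<alpha>, \<beta>)) (bt H p 1) (bt H q l) = bt H (conv p q) l"
    and "amult (DT H (\<alpha>, \<beta>)) (bt H q h) (bt H \<epsilon> l) = bt H q (h * l)"
proof -
  let ?m = "amult (DT H (\<alpha>, \<beta>))"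
  note M = DT_mult_linear[OF ab] and A = act_linear[OF ab(2,1)]
  note aut = hopf_autD[OF ab(1)] hopf_autD[OF ab(2)]
  have act1: "act \<alpha> \<beta> q 1 1 = q"
    by (simp add: act_def aut)
  show "?m (bt H p 1) (bt H q l) = bt H (conv p q) l" if p: "lin p"
  proof (rule ev_ext)
    fix x f assume f: "lin f"
    have "sw3 (\<lambda>a b c. conv p (act \<alpha> \<beta> q a c) x * f (b * l)) 1 =
        conv p (act \<alpha> \<beta> q 1 1) x * f (1 * l)"
      by (rule sw3_one) (intro lin_intros lin_app[OF f] conv_linear A q)+
    thus "ev (?m (bt H p 1) (bt H q l)) x f = ev (bt H (conv p q) l) x f"
      using p q f by (simp add: DT_mult(2)[OF ab] ev_cross ab act1 lin_conv)
  qed (auto intro!: M p q bt_carr lin_conv)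
  show "?m (bt H q h) (bt H \<epsilon> l) = bt H q (h * l)"
  proof (rule ev_ext)
    fix x f assume f: "lin f"
    have "conv q (act \<alpha> \<beta> \<epsilon> a c) x = q x * \<epsilon> a * \<epsilon> c" for a c
      unfolding conv_def act_def
      by (rule sw_counit_rightI[where g = "\<lambda>x. q x * \<epsilon> a * \<epsilon> c"])
        (auto simp: aut intro!: lin_intros q)
    moreover have "sw3 (\<lambda>a b c. q x * \<epsilon> a * \<epsilon> c * f (b * l)) h = q x * f (h * l)"
    proof -
      have "sw (\<lambda>b c. q x * \<epsilon> a * \<epsilon> c * f (b * l)) t = \<epsilon> a * (q x * f (t * l))" for a t
        by (rule sw_counit_rightI[where g = "\<lambda>b. \<epsilon> a * (q x * f (b * l))"])
          (auto intro!: lin_intros lin_app[OF f])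
      hence "sw3 (\<lambda>a b c. q x * \<epsilon> a * \<epsilon> c * f (b * l)) h = sw (\<lambda>a t. \<epsilon> a * (q x * f (t * l))) h"
        unfolding sw3_def by (intro sw_cong)
      also have "\<dots> = q x * f (h * l)"
        by (rule sw_counit_left) (intro lin_intros lin_app[OF f])
      finally show ?thesis .
    qed
    ultimately show "ev (?m (bt H q h) (bt H \<epsilon> l)) x f = ev (bt H q (h * l)) x f"
      using q f by (simp add: DT_mult(2)[OF ab] lin_counit ev_cross ab)
  qed (auto intro!: M q bt_carr lin_counit)
qed

lemma DT_unit:
  assumes ab: "\<alpha> \<in> Aut" "\<beta> \<in> Aut" and x: "x \<in> carr DS"
  shows "amult (DT H (\<alpha>, \<beta>)) (bt H \<epsilon> 1) x = x" "amult (DT H (\<alpha>, \<beta>)) x (bt H \<epsilon> 1) = x"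
  by (rule DS_eqI[OF _ _ x, where U = DS];
      auto intro!: DT_mult_linear[OF ab] bt_carr lin_counit linear_map_ident
        simp: DT_mult_bt_unit[OF ab] lin_counit conv_counit)+

lemma kalgebra_DT:
  assumes "\<alpha> \<in> Aut" "\<beta> \<in> Aut"
  shows "kalgebra (DT H (\<alpha>, \<beta>))"
  unfolding kalgebra_def
  using DT_assoc[OF assms] DT_unit[OF assms] DT_mult(1)[OF assms] lin_counit by simp

lemma talg_DT:
  assumes ab: "\<alpha> \<in> Aut" "\<beta> \<in> Aut" "\<gamma> \<in> Aut" "\<delta> \<in> Aut"
  shows "bilinear_map DS2 DS2 DS2 (amult (talg (DT H (\<alpha>, \<beta>)) (DT H (\<gamma>, \<delta>))))"
    and "a \<in> carr DS \<Longrightarrow> b \<in> carr DS \<Longrightarrow> a' \<in> carr DS \<Longrightarrow> b' \<in> carr DS \<Longrightarrow>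
      amult (talg (DT H (\<alpha>, \<beta>)) (DT H (\<gamma>, \<delta>))) (tens DS DS a b) (tens DS DS a' b') =
      tens DS DS (amult (DT H (\<alpha>, \<beta>)) a a') (amult (DT H (\<gamma>, \<delta>)) b b')"
proof -
  note T = talg_mult[of "DT H (\<alpha>, \<beta>)" "DT H (\<gamma>, \<delta>)", simplified, OF DT_mult(1)[OF ab(1,2)] DT_mult(1)[OF ab(3,4)]]
  show "bilinear_map DS2 DS2 DS2 (amult (talg (DT H (\<alpha>, \<beta>)) (DT H (\<gamma>, \<delta>))))"
    using T(1) by (simp add: bilinear_map_def linear_map_def)
  show "amult (talg (DT H (\<alpha>, \<beta>)) (DT H (\<gamma>, \<delta>))) (tens DS DS a b) (tens DS DS a' b') =
      tens DS DS (amult (DT H (\<alpha>, \<beta>)) a a') (amult (DT H (\<gamma>, \<delta>)) b b')"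
    if "a \<in> carr DS" "b \<in> carr DS" "a' \<in> carr DS" "b' \<in> carr DS"
    using T(2) that by simp
qed

section \<open>Comultiplication\<close>

lemma lin_ract: "lin p \<Longrightarrow> lin (p \<leftharpoonup> e)"
  unfolding ract_def by (rule lin_app, assumption) (intro lin_intros)

text \<open>Expand y along \<open>E\<close> inside p(y x). This contraction of dual bases removes
  the sums over \<open>E\<close> that come from the coproduct of a functional.\<close>

lemma sum_co_ract: "lin p \<Longrightarrow> (\<Sum>e\<in>E. (p \<leftharpoonup> e) x * co e y) = p (y * x)"
  using lin_expand[of "\<lambda>e. p (e * x)" y] lin_app[OF _ linH_mult(1)[OF linH_ident], of p x]
  by (simp add: ract_def mult.commute)

text \<open>The description by values at (h, l) has at most one solution, because evaluations at
  pairs of basis vectors are coordinates on the tensor square of the dual; the sum given is a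
  solution by \<open>sum_co_ract\<close>.\<close>

lemma dual_comult_eq:
  assumes p: "lin p"
  shows "dual_comult H p = (\<Sum>e\<in>E. tens (dual H) (dual H) (co e) (p \<leftharpoonup> e))" (is "_ = ?t")
  unfolding dual_comult_def
proof (rule the_equality)
  let ?D = "dual H"
  have ks: "is_kspace (tensor ?D ?D)" by (rule kspace_tensor) auto
  have B: "bilinear_map ?D ?D ground (\<lambda>p1 p2. p1 h * p2 l)" for h l
    by (intro bilinear_map_ground_mult linear_map_dual_eval)
  have tl: "tlift ?D ?D (\<lambda>p1 p2. p1 h * p2 l) t = t (\<lambda>p1 p2. p1 h * p2 l)"
    if "t \<in> carr (tensor ?D ?D)" for t h l
    using tlift_apply[OF ks_dual ks_dual kspace_ground B linear_map_ident(1) that] by simp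
  have carr: "?t \<in> carr (tensor ?D ?D)"
    by (intro kspace_closed(4)[OF ks] tens_carr) (auto simp: lin_co lin_ract p)
  have val: "?t (\<lambda>p1 p2. p1 h * p2 l) = p (h * l)" for h l
    by (simp add: sum_fun_apply tens_apply[OF B] sum_co_ract[OF p, symmetric] mult.commute)
  show "?t \<in> carr (tensor ?D ?D) \<and> (\<forall>h l. tlift ?D ?D (\<lambda>p1 p2. p1 h * p2 l) ?t = p (h * l))"
    using carr val tl by simp
  fix t assume t: "t \<in> carr (tensor ?D ?D) \<and> (\<forall>h l. tlift ?D ?D (\<lambda>p1 p2. p1 h * p2 l) t = p (h * l))"
  show "t = ?t"
    by (rule coords_separate[OF coords_tensor[OF coords_dual coords_dual]])
      (use t carr val tl in auto)
qed

text \<open>The structure maps \<open>comul\<close>, \<open>conjg\<close>, \<open>antip\<close> and \<open>Rmat\<close> take the automorphisms they apply as free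
  parameters. The group law of \<open>G\<close> enters only at the very end, where it supplies the relations between
  these parameters.\<close>

definition comul :: "('h \<Rightarrow> 'h) \<Rightarrow> ('h \<Rightarrow> 'h) \<Rightarrow> ('k, 'h) dcp \<Rightarrow> ((('k, 'h) dcp \<Rightarrow> ('k, 'h) dcp \<Rightarrow> 'k) \<Rightarrow> 'k)" where
  "comul \<gamma> \<tau> = tlift (dual H) (alg H) (\<lambda>p h. tlift (dual H) (dual H) (\<lambda>p1 p2.
     sweedler2 H (\<lambda>h1 h2. tens DS DS (bt H p2 (\<gamma> h1)) (bt H p1 (\<tau> h2))) h) (dual_comult H p))"

lemma DT_comult_eq: "DT_comult H (\<alpha>, \<beta>) (\<gamma>, \<delta>) = comul \<gamma> (inverse_fun \<gamma> \<circ> \<beta> \<circ> \<gamma>)"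
  by (simp add: DT_comult_def comul_def)

lemma comul:
  assumes l: "linH \<gamma>" "linH \<tau>"
  shows comul_linear: "linear_map DS DS2 (comul \<gamma> \<tau>)"
    and comul_bt: "lin p \<Longrightarrow> comul \<gamma> \<tau> (bt H p h) =
      (\<Sum>e\<in>E. sw (\<lambda>h1 h2. tens DS DS (bt H (p \<leftharpoonup> e) (\<gamma> h1)) (bt H (co e) (\<tau> h2))) h)"
proof -
  let ?D = "dual H"
  let ?X = "\<lambda>p1 p2 h. sw (\<lambda>h1 h2. tens DS DS (bt H p2 (\<gamma> h1)) (bt H p1 (\<tau> h2))) h"
  let ?C = "\<lambda>p h. \<Sum>e\<in>E. ?X (co e) (p \<leftharpoonup> e) h"
  let ?F = "\<lambda>p h. tlift ?D ?D (\<lambda>p1 p2.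
     sweedler2 H (\<lambda>h1 h2. tens DS DS (bt H p2 (\<gamma> h1)) (bt H p1 (\<tau> h2))) h) (dual_comult H p)"
  note T = tens_bilinear[OF ks_DS ks_DS]
  have B: "bilinear_map (alg H) (alg H) DS2 (\<lambda>h1 h2. tens DS DS (bt H p2 (\<gamma> h1)) (bt H p1 (\<tau> h2)))"
    if "lin p1" "lin p2" for p1 p2
    by (rule bilinear_map_comp[OF T]; rule linear_map_bt2; use that l in \<open>simp add: linH_def\<close>)
  have X: "sweedler2 H (\<lambda>h1 h2. tens DS DS (bt H p2 (\<gamma> h1)) (bt H p1 (\<tau> h2))) h = ?X p1 p2 h"
    if "lin p1" "lin p2" for p1 p2 h
    by (rule sweedler2_eq[OF ks_DS2 B[OF that]])
  have XB: "bilinear_map ?D ?D DS2 (\<lambda>p1 p2. ?X p1 p2 h)" for h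
    by (rule bilinear_mapI; rule linear_map_sw[OF ks_DS2])
      (auto intro!: linear_map_comp[OF linear_map_bt1 bilinear_mapD(2)[OF T]]
        linear_map_comp[OF linear_map_bt1 bilinear_mapD(1)[OF T]] linear_map_ident)
  \<comment> \<open>\<open>?F\<close> is the defining formula and \<open>?C\<close> its finite-sum
    version. The two are compared for linear \<open>p\<close>, bilinearity is shown for
    \<open>?C\<close>, and it is then transferred to \<open>?F\<close>.\<close>
  have F: "?F p h = ?C p h" if p: "lin p" for p h
  proof -
    have t: "(\<Sum>e\<in>E. tens ?D ?D (co e) (p \<leftharpoonup> e)) \<in> carr (tensor ?D ?D)"
      by (intro kspace_closed(4) kspace_tensor tens_carr) (auto simp: lin_co lin_ract p)
    have "?F p h = tlift ?D ?D (\<lambda>p1 p2. ?X p1 p2 h) (\<Sum>e\<in>E. tens ?D ?D (co e) (p \<leftharpoonup> e))"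
      unfolding dual_comult_eq[OF p]
      by (rule tlift_cong[symmetric, OF _ ks_dual ks_dual ks_DS2 XB t]) (simp add: X)
    also have "\<dots> = ?C p h"
      by (subst linear_map_sum[OF kspace_tensor tlift_linear[OF XB]])
        (auto simp: lin_co lin_ract p intro!: tens_carr tlift_tens[OF XB] sum.cong)
    finally show ?thesis .
  qed
  have lin_r: "linear_map ?D ?D (\<lambda>p. p \<leftharpoonup> e)" for e
    by (rule linear_map_dualI) (auto simp: lin_ract, simp add: ract_def linear_map_dual_eval)
  have C: "bilinear_map ?D (alg H) DS2 ?C"
  proof (rule bilinear_mapI)
    show "linear_map ?D DS2 (\<lambda>p. ?C p h)" for h
      by (intro linear_map_setsum ks_DS2 linear_map_comp[OF lin_r bilinear_mapD(2)[OF XB]])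
        (simp add: lin_co)
    show "linear_map (alg H) DS2 (\<lambda>h. ?C p h)" if "p \<in> carr ?D" for p
      using that by (intro linear_map_setsum ks_DS2 sw_linear_map B) (auto simp: lin_co lin_ract)
  qed
  have FB: "bilinear_map ?D (alg H) DS2 ?F"
  proof (rule bilinear_mapI)
    show "linear_map ?D DS2 (\<lambda>p. ?F p h)" for h
      by (subst linear_map_cong[OF ks_dual, where g = "\<lambda>p. ?C p h"])
        (use F bilinear_mapD(1)[OF C] in auto)
    show "linear_map (alg H) DS2 (\<lambda>h. ?F p h)" if "p \<in> carr ?D" for p
      by (subst linear_map_cong[OF ks_alg, where g = "\<lambda>h. ?C p h"])
        (use F bilinear_mapD(2)[OF C] that in auto)
  qed
  show "linear_map DS DS2 (comul \<gamma> \<tau>)"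
    unfolding comul_def by (rule tlift_linear[OF FB ks_dual ks_alg ks_DS2])
  show "comul \<gamma> \<tau> (bt H p h) = ?C p h" if "lin p"
    unfolding comul_def bt_def[of H p h] using that F by (subst tlift_tens[OF FB ks_DS2]) auto
qed

lemma comul_apply:
  assumes "linH \<gamma>" "linH \<tau>" "lin p" "bilinear_map DS DS ground B"
  shows "comul \<gamma> \<tau> (bt H p h) B = (\<Sum>e\<in>E. sw (\<lambda>h1 h2. B (bt H (p \<leftharpoonup> e) (\<gamma> h1)) (bt H (co e) (\<tau> h2))) h)"
  by (simp add: comul_bt[OF assms(1-3)] sum_fun_apply sw_apply tens_apply[OF assms(4)])

text \<open>The second leg of a functional sits in the first tensor factor, hence the order
  \<open>y * x\<close>. On the H side the two functionals meet the legs of h, which is their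
  convolution.\<close>

lemma ev2_comul:
  assumes l: "linH \<gamma>" "linH \<tau>" and fg: "lin f" "lin g" and t: "t \<in> carr DS"
  shows "ev2 (comul \<gamma> \<tau> t) x f y g = ev t (y * x) (conv (f \<circ> \<gamma>) (g \<circ> \<tau>))"
proof (rule DS_eqI[OF _ _ t, where U = ground])
  show "linear_map DS ground (\<lambda>t. ev2 (comul \<gamma> \<tau> t) x f y g)"
    by (rule linear_map_comp[OF comul_linear[OF l] ev2_linear])
  show "linear_map DS ground (\<lambda>t. ev t (y * x) (conv (f \<circ> \<gamma>) (g \<circ> \<tau>)))"
    by (rule ev_linear)
  fix p h assume p: "lin p"
  have "ev2 (comul \<gamma> \<tau> (bt H p h)) x f y g =
      (\<Sum>e\<in>E. sw (\<lambda>h1 h2. ((p \<leftharpoonup> e) x * f (\<gamma> h1)) * (co e y * g (\<tau> h2))) h)"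
    unfolding ev2_def by (subst comul_apply[OF l p])
      (simp_all add: bilinear_map_ground_mult ev_linear lin_ract lin_co p fg)
  also have "\<dots> = (\<Sum>e\<in>E. (p \<leftharpoonup> e) x * co e y) * sw (\<lambda>h1 h2. f (\<gamma> h1) * g (\<tau> h2)) h"
    by (simp add: sw_times sw_sum sum_distrib_left sum_distrib_right ac_simps)
  also have "\<dots> = ev (bt H p h) (y * x) (conv (f \<circ> \<gamma>) (g \<circ> \<tau>))"
    using l fg by (simp add: sum_co_ract p lin_conv lin_comp) (simp add: conv_def)
  finally show "ev2 (comul \<gamma> \<tau> (bt H p h)) x f y g = ev (bt H p h) (y * x) (conv (f \<circ> \<gamma>) (g \<circ> \<tau>))" .
qed

text \<open>Six consecutive legs u1, u2, u3, v1, v2, v3 of h, in which the neighbours u3 and v1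
  occur only through \<open>v1 * S' u3\<close>, the last argument of \<open>K\<close>.
  Coassociativity makes these two the legs of one element, and cancelling them leaves four
  legs.\<close>

lemma sw_contract:
  assumes K: "\<And>b c d z. lin (\<lambda>a. K a b c d z)" "\<And>a c d z. lin (\<lambda>b. K a b c d z)"
    "\<And>a b d z. lin (\<lambda>c. K a b c d z)" "\<And>a b c z. lin (\<lambda>d. K a b c d z)" "\<And>a b c d. lin (\<lambda>z. K a b c d z)"
  shows "sw (\<lambda>u v. sw3 (\<lambda>u1 u2 u3. sw3 (\<lambda>v1 v2 v3. K u1 u2 v2 v3 (v1 * S' u3)) v) u) h =
    sw3 (\<lambda>a b c. sw (\<lambda>b1 b2. K a b1 b2 c 1) b) h"
proof -
  note L = K lin_intros lin_sw3 lin_sw3_arg lin_app[OF K(5)]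
  let ?Z = "\<lambda>u1 u2 u3 v1 t. sw (\<lambda>v2 v3. K u1 u2 v2 v3 (v1 * S' u3)) t"
  let ?Y = "\<lambda>u1 u2 u3 v. sw (\<lambda>v1 t. ?Z u1 u2 u3 v1 t) v"
  have "sw (\<lambda>u v. sw3 (\<lambda>u1 u2 u3. sw3 (\<lambda>v1 v2 v3. K u1 u2 v2 v3 (v1 * S' u3)) v) u) h =
      sw (\<lambda>u v. sw (\<lambda>u1 s. sw (\<lambda>u2 u3. ?Y u1 u2 u3 v) s) u) h"
    by (simp add: sw3_def)
  also have "\<dots> = sw (\<lambda>u1 w. sw (\<lambda>s v. sw (\<lambda>u2 u3. ?Y u1 u2 u3 v) s) w) h"
    by (rule sw_coassoc) (intro L)+
  also have "\<dots> = sw (\<lambda>u1 w. sw (\<lambda>u2 w'. sw (\<lambda>v2 v3. K u1 u2 v2 v3 1) w') w) h"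
  proof (rule sw_cong)
    fix u1 w
    have "sw (\<lambda>s v. sw (\<lambda>u2 u3. ?Y u1 u2 u3 v) s) w = sw (\<lambda>u2 w'. sw (\<lambda>u3 v. ?Y u1 u2 u3 v) w') w"
      by (rule sw_coassoc) (intro L)+
    also have "\<dots> = sw (\<lambda>u2 w'. sw (\<lambda>v2 v3. K u1 u2 v2 v3 1) w') w"
    proof (rule sw_cong)
      fix u2 w'
      \<comment> \<open>After this regrouping u3 and v1 are the two legs of the single element
        \<open>r\<close>.\<close>
      have "sw (\<lambda>u3 v. ?Y u1 u2 u3 v) w' = sw (\<lambda>r t. sw (\<lambda>u3 v1. ?Z u1 u2 u3 v1 t) r) w'"
        by (rule sw_coassoc[symmetric]) (intro L)+
      also have "\<dots> = sw (\<lambda>r t. \<epsilon> r * sw (\<lambda>v2 v3. K u1 u2 v2 v3 1) t) w'"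
        by (rule sw_cong)
          (rule sw_antipode'_rightI[where g = "\<lambda>z. sw (\<lambda>v2 v3. K u1 u2 v2 v3 z) _"], intro L, rule refl)
      also have "\<dots> = sw (\<lambda>v2 v3. K u1 u2 v2 v3 1) w'"
        by (rule sw_counit_left) (intro L)
      finally show "sw (\<lambda>u3 v. ?Y u1 u2 u3 v) w' = sw (\<lambda>v2 v3. K u1 u2 v2 v3 1) w'" .
    qed
    finally show "sw (\<lambda>s v. sw (\<lambda>u2 u3. ?Y u1 u2 u3 v) s) w =
      sw (\<lambda>u2 w'. sw (\<lambda>v2 v3. K u1 u2 v2 v3 1) w') w" .
  qed
  also have "\<dots> = sw3 (\<lambda>a b c. sw (\<lambda>b1 b2. K a b1 b2 c 1) b) h"
    unfolding sw3_def by (rule sw_cong, rule sw_coassoc[symmetric]) (intro L)+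
  finally show ?thesis .
qed

lemma linear_of_sum_sw:
  assumes "is_kspace V" "linear_map V U f" "\<And>e a b. e \<in> I \<Longrightarrow> F e a b \<in> carr V"
  shows "f (\<Sum>e\<in>I. sw (\<lambda>a b. F e a b) h) = (\<Sum>e\<in>I. sw (\<lambda>a b. f (F e a b)) h)"
  using assms(3)
  by (subst linear_map_sum[OF assms(1,2)])
    (auto intro!: sum.cong sw_carr[OF assms(1)] linear_of_sw[OF assms(1,2)])

lemma sw3_sum: "(\<Sum>i\<in>I. sw3 (\<lambda>a b c. F i a b c) h) = sw3 (\<lambda>a b c. \<Sum>i\<in>I. F i a b c) h"
  unfolding sw3_def sw_sum by (rule refl)

lemma sw3_times:
  "sw3 (\<lambda>a b c. F a b c) h * d = sw3 (\<lambda>a b c. F a b c * d) h"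
  "d * sw3 (\<lambda>a b c. F a b c) h = sw3 (\<lambda>a b c. d * F a b c) h"
  for d :: "'a::semiring_0"
  unfolding sw3_def sw_times by (rule refl)+

text \<open>The sums over \<open>e\<close> and \<open>d\<close> come from the coproducts of
  \<open>p\<close> and \<open>q\<close>. Summing them out recombines the split functionals:
  \<open>p\<close> is evaluated at a product of legs of y and x, and \<open>q\<close> at the product
  of the two twisted arguments, the one from y first.\<close>

lemma sum_conv_act:
  assumes p: "lin p" and q: "lin q"
  shows "(\<Sum>e\<in>E. \<Sum>d\<in>E. conv (p \<leftharpoonup> e) (act \<alpha> \<beta> (q \<leftharpoonup> d) a c) x * conv (co e) (act \<gamma> \<delta> (co d) a' c') y) =
    sw (\<lambda>x1 x2. sw (\<lambda>y1 y2. p (y1 * x1) * q (S' (\<delta> c') * y2 * \<gamma> a' * (S' (\<beta> c) * x2 * \<alpha> a))) y) x"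
proof -
  have "(\<Sum>e\<in>E. \<Sum>d\<in>E. (p \<leftharpoonup> e) x1 * (q \<leftharpoonup> d) X * (co e y1 * co d Y)) = p (y1 * x1) * q (Y * X)"
    for x1 y1 X Y
  proof -
    have "(\<Sum>e\<in>E. \<Sum>d\<in>E. (p \<leftharpoonup> e) x1 * (q \<leftharpoonup> d) X * (co e y1 * co d Y)) =
        (\<Sum>e\<in>E. \<Sum>d\<in>E. ((p \<leftharpoonup> e) x1 * co e y1) * ((q \<leftharpoonup> d) X * co d Y))"
      by (simp add: ac_simps)
    also have "\<dots> = p (y1 * x1) * q (Y * X)"
      by (simp add: sum_product[symmetric] sum_co_ract p q)
    finally show ?thesis .
  qed
  thus ?thesis
    unfolding conv_def act_def sw_times sw_sum by simp (rule sw_swap)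
qed

text \<open>Both sides are evaluated at (x, f, y, g). The two crossed products on the right give
  three legs of h1 and three of h2. Once the dual bases are summed out, the relation between
  \<gamma>, \<tau> and \<beta> permits the contraction \<open>sw_contract\<close>, and the remaining
  four legs are those of the product on the left.\<close>

lemma comul_mult_bt:
  assumes aut: "\<alpha> \<in> Aut" "\<beta> \<in> Aut" "\<gamma> \<in> Aut" "\<delta> \<in> Aut"
    and \<tau>: "\<tau> \<in> Aut" "\<And>x. \<gamma> (\<tau> x) = \<beta> (\<gamma> x)" and p: "lin p" and q: "lin q"
  shows "comul \<gamma> \<tau> (amult (DT H (\<alpha> \<circ> \<gamma>, \<delta> \<circ> \<tau>)) (bt H p h) (bt H q l)) =
    amult (talg (DT H (\<alpha>, \<beta>)) (DT H (\<gamma>, \<delta>))) (comul \<gamma> \<tau> (bt H p h)) (comul \<gamma> \<tau> (bt H q l))"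
    (is "?L = amult ?TT ?P ?Q")
proof (rule ev2_ext)
  note l\<gamma> = hopf_autD(1)[OF aut(3)] and l\<tau> = hopf_autD(1)[OF \<tau>(1)]
  note DL = comul_linear[OF l\<gamma> l\<tau>] and DB = comul_bt[OF l\<gamma> l\<tau>]
  note ag = hopf_aut_comp[OF aut(1,3)] and dt = hopf_aut_comp[OF aut(4) \<tau>(1)]
  note T = talg_DT[OF aut] and M = DT_mult_linear[OF aut(1,2)] DT_mult_linear[OF aut(3,4)]
  note linp = lin_ract[OF p] lin_ract[OF q] lin_co
  have PQ: "?P \<in> carr DS2" "?Q \<in> carr DS2"
    using linear_mapD(1)[OF DL] p q by auto
  have Lc: "amult (DT H (\<alpha> \<circ> \<gamma>, \<delta> \<circ> \<tau>)) (bt H p h) (bt H q l) = cross (\<alpha> \<circ> \<gamma>) (\<delta> \<circ> \<tau>) p h q l"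
    by (rule DT_mult(2)[OF ag dt p q])
  show "?L \<in> carr DS2"
    unfolding Lc by (rule linear_mapD(1)[OF DL]) (simp add: ag dt p q)
  show "amult ?TT ?P ?Q \<in> carr DS2"
    using bilinear_mapD(3)[OF T(1)] PQ by blast
  fix x f y g assume f: "lin f" and g: "lin g"
  \<comment> \<open>The general term once both dual bases are summed out. The slot \<open>z\<close>
    holds the part of the argument of \<open>q\<close> that is going to cancel,
    \<open>v1 * S' u3\<close>.\<close>
  define K where "K u1 u2 v2 v3 z = sw (\<lambda>l1 l2. sw (\<lambda>x1 x2. sw (\<lambda>y1 y2.
      p (y1 * x1) * q (S' (\<delta> (\<tau> v3)) * y2 * \<beta> (\<gamma> z) * x2 * \<alpha> (\<gamma> u1))) y) x *
      (f (\<gamma> (u2 * l1)) * g (\<tau> (v2 * l2)))) l" for u1 u2 v2 v3 z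
  note L = lin_intros lin_app[OF p] lin_app[OF q] lin_app[OF f] lin_app[OF g]
    linH_app[OF l\<gamma>] linH_app[OF l\<tau>] linH_app[OF hopf_autD(1)[OF aut(1)]]
    linH_app[OF hopf_autD(1)[OF aut(2)]] linH_app[OF hopf_autD(1)[OF aut(4)]]
    conv_linear act_linear[OF aut(2,1)] act_linear[OF aut(4,3)]
  let ?C = "\<lambda>e d h1 h2 l1 l2. tens DS DS (cross \<alpha> \<beta> (p \<leftharpoonup> e) (\<gamma> h1) (q \<leftharpoonup> d) (\<gamma> l1))
      (cross \<gamma> \<delta> (co e) (\<tau> h2) (co d) (\<tau> l2))"
  let ?U = "\<lambda>e d a b c l1. conv (p \<leftharpoonup> e) (act \<alpha> \<beta> (q \<leftharpoonup> d) (\<gamma> a) (\<gamma> c)) x * f (\<gamma> (b * l1))"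
  let ?V = "\<lambda>e d a b c l2. conv (co e) (act \<gamma> \<delta> (co d) (\<tau> a) (\<tau> c)) y * g (\<tau> (b * l2))"
  have C: "?C e d h1 h2 l1 l2 \<in> carr DS2" for e d h1 h2 l1 l2
    by (simp add: tens_carr linp aut)
  have "amult ?TT ?P ?Q = (\<Sum>e\<in>E. sw (\<lambda>h1 h2. \<Sum>d\<in>E. sw (\<lambda>l1 l2. ?C e d h1 h2 l1 l2) l) h)"
    unfolding DB[OF p]
    by (subst linear_of_sum_sw[OF ks_DS2 bilinear_mapD(1)[OF T(1) PQ(2)]])
      (simp_all add: tens_carr linp DB[OF q] linear_of_sum_sw[OF ks_DS2 bilinear_mapD(2)[OF T(1)]]
        T(2) DT_mult(2)[OF aut(1,2)] DT_mult(2)[OF aut(3,4)])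
  hence "ev2 (amult ?TT ?P ?Q) x f y g =
      (\<Sum>e\<in>E. sw (\<lambda>h1 h2. \<Sum>d\<in>E. sw (\<lambda>l1 l2. ev2 (?C e d h1 h2 l1 l2) x f y g) l) h)"
    by (simp add: C linear_of_sum_sw[OF ks_DS2 ev2_linear] kspace_closed(4)[OF ks_DS2] sw_carr)
  also have "\<dots> = (\<Sum>e\<in>E. sw (\<lambda>h1 h2. \<Sum>d\<in>E. sw (\<lambda>l1 l2.
      sw3 (\<lambda>a b c. sw3 (\<lambda>a' b' c'. ?U e d a b c l1 * ?V e d a' b' c' l2) h2) h1) l) h)"
  proof -
    \<comment> \<open>Since \<gamma> and \<tau> respect the coproduct, legs of
      \<open>\<gamma> h1\<close> and \<open>\<tau> h2\<close> are replaced by images of legs of h1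
      and h2.\<close>
    have "ev (cross \<alpha> \<beta> (p \<leftharpoonup> e) (\<gamma> h1) (q \<leftharpoonup> d) (\<gamma> l1)) x f = sw3 (\<lambda>a b c. ?U e d a b c l1) h1" for e d h1 l1
      unfolding ev_cross[OF aut(2,1) linp(1,2) f]
      by (subst sw3_aut[OF aut(3)]) (intro L linp | simp add: hopf_autD[OF aut(3)])+
    moreover have "ev (cross \<gamma> \<delta> (co e) (\<tau> h2) (co d) (\<tau> l2)) y g = sw3 (\<lambda>a b c. ?V e d a b c l2) h2" for e d h2 l2
      unfolding ev_cross[OF aut(4,3) lin_co lin_co g]
      by (subst sw3_aut[OF \<tau>(1)]) (intro L linp lin_co | simp add: hopf_autD[OF \<tau>(1)])+
    ultimately show ?thesis by (simp only: ev2_tens sw3_times(1)) (simp only: sw3_times(2))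
  qed
  also have "\<dots> = sw (\<lambda>h1 h2. sw3 (\<lambda>a b c. sw3 (\<lambda>a' b' c'. sw (\<lambda>l1 l2.
      \<Sum>e\<in>E. \<Sum>d\<in>E. ?U e d a b c l1 * ?V e d a' b' c' l2) l) h2) h1) h"
    by (simp only: sw_sum sw3_sum sw_sw3_swap)
  also have "\<dots> = sw (\<lambda>h1 h2. sw3 (\<lambda>a b c. sw3 (\<lambda>a' b' c'. K a b b' c' (a' * S' c)) h2) h1) h"
  proof -
    have "(\<Sum>e\<in>E. \<Sum>d\<in>E. ?U e d a b c l1 * ?V e d a' b' c' l2) =
      sw (\<lambda>x1 x2. sw (\<lambda>y1 y2. p (y1 * x1) *
        q (S' (\<delta> (\<tau> c')) * y2 * \<beta> (\<gamma> (a' * S' c)) * x2 * \<alpha> (\<gamma> a))) y) x *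
      (f (\<gamma> (b * l1)) * g (\<tau> (b' * l2)))" for a b c a' b' c' l1 l2
    proof -
      have "(\<Sum>e\<in>E. \<Sum>d\<in>E. ?U e d a b c l1 * ?V e d a' b' c' l2) =
        (\<Sum>e\<in>E. \<Sum>d\<in>E. conv (p \<leftharpoonup> e) (act \<alpha> \<beta> (q \<leftharpoonup> d) (\<gamma> a) (\<gamma> c)) x *
           conv (co e) (act \<gamma> \<delta> (co d) (\<tau> a') (\<tau> c')) y) * (f (\<gamma> (b * l1)) * g (\<tau> (b' * l2)))"
        by (simp only: sum_distrib_right sum_distrib_left ac_simps)
      \<comment> \<open>Here \<open>\<gamma> (\<tau> a') * S' (\<beta> (\<gamma> c))\<close> becomes
        \<open>\<beta> (\<gamma> (a' * S' c))\<close> by the relation on \<tau>.\<close>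
      thus ?thesis
        by (simp only: sum_conv_act[OF p q])
          (simp add: \<tau>(2) hopf_autD(3,7)[OF aut(2)] hopf_autD(3,7)[OF aut(3)] mult.assoc)
    qed
    thus ?thesis by (simp only: K_def)
  qed
  also have "\<dots> = sw3 (\<lambda>a b c. sw (\<lambda>b1 b2. K a b1 b2 c 1) b) h"
    unfolding K_def by (rule sw_contract) (intro L)+
  also have "\<dots> = sw3 (\<lambda>a b c. conv p (act (\<alpha> \<circ> \<gamma>) (\<delta> \<circ> \<tau>) q a c) (y * x) * conv (f \<circ> \<gamma>) (g \<circ> \<tau>) (b * l)) h"
  proof (rule sw3_cong)
    fix a b c
    let ?A = "\<lambda>z. q (S' (\<delta> (\<tau> c)) * z * \<alpha> (\<gamma> a))"
    have "conv p (act (\<alpha> \<circ> \<gamma>) (\<delta> \<circ> \<tau>) q a c) (y * x) = sw (\<lambda>z1 z2. p z1 * ?A z2) (y * x)"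
      by (simp add: conv_def act_def)
    also have "\<dots> = sw (\<lambda>y1 y2. sw (\<lambda>x1 x2. p (y1 * x1) * ?A (y2 * x2)) x) y"
      by (rule sw_mult) (intro L p)+
    also have "\<dots> = sw (\<lambda>x1 x2. sw (\<lambda>y1 y2. p (y1 * x1) * ?A (y2 * x2)) y) x"
      by (rule sw_swap)
    finally have 1: "conv p (act (\<alpha> \<circ> \<gamma>) (\<delta> \<circ> \<tau>) q a c) (y * x) =
        sw (\<lambda>x1 x2. sw (\<lambda>y1 y2. p (y1 * x1) * ?A (y2 * x2)) y) x" .
    have "conv (f \<circ> \<gamma>) (g \<circ> \<tau>) (b * l) = sw (\<lambda>z1 z2. f (\<gamma> z1) * g (\<tau> z2)) (b * l)"
      by (simp add: conv_def)
    also have "\<dots> = sw (\<lambda>b1 b2. sw (\<lambda>l1 l2. f (\<gamma> (b1 * l1)) * g (\<tau> (b2 * l2))) l) b"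
      by (rule sw_mult) (intro L)+
    finally have 2: "conv (f \<circ> \<gamma>) (g \<circ> \<tau>) (b * l) =
        sw (\<lambda>b1 b2. sw (\<lambda>l1 l2. f (\<gamma> (b1 * l1)) * g (\<tau> (b2 * l2))) l) b" .
    show "sw (\<lambda>b1 b2. K a b1 b2 c 1) b =
        conv p (act (\<alpha> \<circ> \<gamma>) (\<delta> \<circ> \<tau>) q a c) (y * x) * conv (f \<circ> \<gamma>) (g \<circ> \<tau>) (b * l)"
      unfolding 1 2 sw_times(2)[where F = "\<lambda>b1 b2. sw (\<lambda>l1 l2. f (\<gamma> (b1 * l1)) * g (\<tau> (b2 * l2))) l"]
        sw_times(2)[where F = "\<lambda>l1 l2. f (\<gamma> (_ * l1)) * g (\<tau> (_ * l2))"] K_def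
      by (simp add: hopf_autD(4)[OF aut(3)] hopf_autD(4)[OF aut(2)] mult.assoc sw_times)
  qed
  also have "\<dots> = ev2 ?L x f y g"
    unfolding Lc using l\<gamma> l\<tau> f g
    by (simp add: ev2_comul ag dt p q ev_cross lin_conv lin_comp)
  finally show "ev2 ?L x f y g = ev2 (amult ?TT ?P ?Q) x f y g" ..
qed

section \<open>Group, conjugation and counit\<close>

lemma inverse_aut:
  "\<alpha> \<in> Aut \<Longrightarrow> \<beta> \<in> Aut \<Longrightarrow> inverse_fun (\<alpha> \<circ> \<beta>) = inverse_fun \<beta> \<circ> inverse_fun \<alpha>"
  "\<alpha> \<in> Aut \<Longrightarrow> inverse_fun (inverse_fun \<alpha>) = \<alpha>"
  "inverse_fun id = id"
  by (simp_all add: hopf_autD(2) o_inv_distrib bij_is_inj bij_is_surj inv_inv_eq)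

lemma aut_group_simps [simp]:
  "carrier (aut_group H) = Aut \<times> Aut"
  "(\<alpha>, \<beta>) \<otimes>\<^bsub>aut_group H\<^esub> (\<gamma>, \<delta>) = (\<alpha> \<circ> \<gamma>, \<delta> \<circ> inverse_fun \<gamma> \<circ> \<beta> \<circ> \<gamma>)"
  "\<one>\<^bsub>aut_group H\<^esub> = (id, id)"
  by (simp_all add: aut_group_def)

lemma group_aut: "group (aut_group H)"
proof (rule groupI)
  fix x y z assume "x \<in> carrier (aut_group H)" "y \<in> carrier (aut_group H)" "z \<in> carrier (aut_group H)"
  then obtain \<alpha> \<beta> \<gamma> \<delta> \<mu> \<nu> where xyz: "x = (\<alpha>, \<beta>)" "y = (\<gamma>, \<delta>)" "z = (\<mu>, \<nu>)"
    and aut: "\<alpha> \<in> Aut" "\<beta> \<in> Aut" "\<gamma> \<in> Aut" "\<delta> \<in> Aut"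
      "\<mu> \<in> Aut" "\<nu> \<in> Aut" by auto
  show "x \<otimes>\<^bsub>aut_group H\<^esub> y \<otimes>\<^bsub>aut_group H\<^esub> z = x \<otimes>\<^bsub>aut_group H\<^esub> (y \<otimes>\<^bsub>aut_group H\<^esub> z)"
    using aut by (simp add: xyz inverse_aut fun_eq_iff aut[THEN hopf_autD(8)] aut[THEN hopf_autD(9)])
next
  fix x assume "x \<in> carrier (aut_group H)"
  then obtain \<alpha> \<beta> where x: "x = (\<alpha>, \<beta>)" "\<alpha> \<in> Aut" "\<beta> \<in> Aut" by auto
  show "\<exists>y\<in>carrier (aut_group H). y \<otimes>\<^bsub>aut_group H\<^esub> x = \<one>\<^bsub>aut_group H\<^esub>"
    by (rule bexI[of _ "(inverse_fun \<alpha>, \<alpha> \<circ> inverse_fun \<beta> \<circ> inverse_fun \<alpha>)"])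
      (use x in \<open>auto simp: fun_eq_iff hopf_autD(8,9)[OF x(2)] hopf_autD(8,9)[OF x(3)]\<close>)
qed (auto simp: inverse_aut fun_eq_iff hopf_autD(9))

lemma inv_aut_group [simp]:
  assumes "\<alpha> \<in> Aut" "\<beta> \<in> Aut"
  shows "inv\<^bsub>aut_group H\<^esub> (\<alpha>, \<beta>) = (inverse_fun \<alpha>, \<alpha> \<circ> inverse_fun \<beta> \<circ> inverse_fun \<alpha>)"
  by (rule group.inv_equality[OF group_aut])
    (use assms in \<open>auto simp: fun_eq_iff hopf_autD(8,9)[OF assms(1)] hopf_autD(8,9)[OF assms(2)]\<close>)

section \<open>Conjugation\<close>

definition conjg :: "('h \<Rightarrow> 'h) \<Rightarrow> ('h \<Rightarrow> 'h) \<Rightarrow> ('k, 'h) dcp \<Rightarrow> ('k, 'h) dcp" where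
  "conjg \<mu> \<kappa> = tlift (dual H) (alg H) (\<lambda>p h. bt H (p \<circ> \<mu>) (\<kappa> h))"

lemma DT_conj_eq:
  "DT_conj H (\<alpha>, \<beta>) (\<gamma>, \<delta>) =
    conjg (\<beta> \<circ> inverse_fun \<alpha>) (\<alpha> \<circ> inverse_fun \<gamma> \<circ> inverse_fun \<beta> \<circ> \<gamma>)"
  by (simp add: DT_conj_def conjg_def comp_assoc)

context
  fixes \<mu> \<kappa> assumes lin: "linH \<mu>" "linH \<kappa>"
begin

lemma conjg_bilinear: "bilinear_map (dual H) (alg H) DS (\<lambda>p h. bt H (p \<circ> \<mu>) (\<kappa> h))"
proof (rule bilinear_map_comp[OF bt_bilinear])
  show "linear_map (dual H) (dual H) (\<lambda>p. p \<circ> \<mu>)"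
    using lin by (intro linear_map_dualI) (auto simp: lin_comp linear_map_dual_eval)
  show "linear_map (alg H) (alg H) \<kappa>" using lin by (simp add: linH_def)
qed

lemma conjg_linear: "linear_map DS DS (conjg \<mu> \<kappa>)"
  unfolding conjg_def by (rule tlift_linear[OF conjg_bilinear]) auto

lemma conjg_bt: "lin p \<Longrightarrow> conjg \<mu> \<kappa> (bt H p h) = bt H (p \<circ> \<mu>) (\<kappa> h)"
  unfolding conjg_def bt_def[of H p h] by (subst tlift_tens[OF conjg_bilinear]) auto

lemma ev_conjg:
  assumes "lin f" "t \<in> carr DS"
  shows "ev (conjg \<mu> \<kappa> t) x f = ev t (\<mu> x) (f \<circ> \<kappa>)"
  by (rule DS_eqI[OF linear_map_comp[OF conjg_linear ev_linear] ev_linear assms(2)])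
    (use assms lin in \<open>simp add: conjg_bt lin_comp\<close>)

lemma conjg_carr: "t \<in> carr DS \<Longrightarrow> conjg \<mu> \<kappa> t \<in> carr DS"
  using linear_mapD(1)[OF conjg_linear] .

end

lemma conjg_id: "t \<in> carr DS \<Longrightarrow> conjg (\<lambda>x. x) (\<lambda>x. x) t = t"
  by (rule ev_ext) (auto simp: conjg_carr linH_ident ev_conjg comp_def)

lemma conjg_conjg:
  assumes "linH \<mu>" "linH \<kappa>" "linH \<mu>'" "linH \<kappa>'" "t \<in> carr DS"
  shows "conjg \<mu> \<kappa> (conjg \<mu>' \<kappa>' t) = conjg (\<mu>' \<circ> \<mu>) (\<kappa> \<circ> \<kappa>') t"
  using assms linH_app[of \<mu>' \<mu>] linH_app[of \<kappa> \<kappa>']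
  by (intro ev_ext) (auto simp: conjg_carr ev_conjg lin_app comp_def)

lemma conjg_bij:
  assumes "\<mu> \<in> Aut" "\<kappa> \<in> Aut"
  shows "bij_betw (conjg \<mu> \<kappa>) (carr DS) (carr DS)"
proof -
  note l = hopf_autD(1)[OF assms(1)] hopf_autD(1)[OF assms(2)]
    hopf_autD(1)[OF hopf_aut_inv[OF assms(1)]] hopf_autD(1)[OF hopf_aut_inv[OF assms(2)]]
  have c: "inverse_fun \<mu> \<circ> \<mu> = (\<lambda>x. x)" "\<mu> \<circ> inverse_fun \<mu> = (\<lambda>x. x)"
    "inverse_fun \<kappa> \<circ> \<kappa> = (\<lambda>x. x)" "\<kappa> \<circ> inverse_fun \<kappa> = (\<lambda>x. x)"
    by (simp_all add: fun_eq_iff hopf_autD(8,9)[OF assms(1)] hopf_autD(8,9)[OF assms(2)])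
  show ?thesis
    by (rule bij_betw_byWitness[where f' = "conjg (inverse_fun \<mu>) (inverse_fun \<kappa>)"])
      (auto simp: conjg_conjg conjg_carr l c conjg_id)
qed

text \<open>The two relations are what makes \<mu> intertwine the actions: it sends the argument
  \<open>S' (\<delta>' (\<kappa> c)) * x * \<gamma>' (\<kappa> a)\<close> of the target action to
  \<open>S' (\<delta> c) * \<mu> x * \<gamma> a\<close>, the argument of the source action at
  \<open>\<mu> x\<close>.\<close>

lemma conjg_mult:
  assumes aut: "\<mu> \<in> Aut" "\<kappa> \<in> Aut" "\<gamma> \<in> Aut" "\<delta> \<in> Aut"
      "\<gamma>' \<in> Aut" "\<delta>' \<in> Aut"
    and c: "\<And>x. \<mu> (\<gamma>' (\<kappa> x)) = \<gamma> x" "\<And>x. \<mu> (\<delta>' (\<kappa> x)) = \<delta> x"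
  shows "alg_iso (DT H (\<gamma>, \<delta>)) (DT H (\<gamma>', \<delta>')) (conjg \<mu> \<kappa>)"
proof -
  note l = hopf_autD(1)[OF aut(1)] hopf_autD(1)[OF aut(2)]
  note M = DT_mult_linear[OF aut(3,4)] DT_mult_linear[OF aut(5,6)]
  have pure: "conjg \<mu> \<kappa> (amult (DT H (\<gamma>, \<delta>)) (bt H p h) (bt H q k)) =
      amult (DT H (\<gamma>', \<delta>')) (bt H (p \<circ> \<mu>) (\<kappa> h)) (bt H (q \<circ> \<mu>) (\<kappa> k))" (is "?L = ?R")
    if p: "lin p" and q: "lin q" for p h q k
  proof (rule ev_ext)
    note pq = lin_comp[OF p l(1)] lin_comp[OF q l(1)]
    show "?L \<in> carr DS" "?R \<in> carr DS" using p q pq by (auto intro!: M conjg_carr[OF l])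
    fix x f assume f: "lin f"
    have "ev ?R x f = sw3 (\<lambda>a b c. conv (p \<circ> \<mu>) (act \<gamma>' \<delta>' (q \<circ> \<mu>) a c) x * f (b * \<kappa> k)) (\<kappa> h)"
      by (simp add: DT_mult(2)[OF aut(5,6)] pq f ev_cross aut)
    also have "\<dots> = sw3 (\<lambda>a b c. conv (p \<circ> \<mu>) (act \<gamma>' \<delta>' (q \<circ> \<mu>) (\<kappa> a) (\<kappa> c)) x * f (\<kappa> b * \<kappa> k)) h"
      by (rule sw3_aut[OF aut(2)]) (intro lin_intros conv_linear act_linear pq aut lin_app[OF f])+
    also have "\<dots> = sw3 (\<lambda>a b c. conv p (act \<gamma> \<delta> q a c) (\<mu> x) * f (\<kappa> (b * k))) h"
    proof (rule sw3_cong)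
      fix a b c
      have A: "act \<gamma>' \<delta>' (q \<circ> \<mu>) (\<kappa> a) (\<kappa> c) = act \<gamma> \<delta> q a c \<circ> \<mu>"
        by (simp add: act_def fun_eq_iff hopf_autD(3)[OF aut(1)] c hopf_autD(7)[OF aut(1), symmetric])
      show "conv (p \<circ> \<mu>) (act \<gamma>' \<delta>' (q \<circ> \<mu>) (\<kappa> a) (\<kappa> c)) x * f (\<kappa> b * \<kappa> k) =
          conv p (act \<gamma> \<delta> q a c) (\<mu> x) * f (\<kappa> (b * k))"
        unfolding A conv_aut[OF aut(1) p lin_act[OF q], symmetric] by (simp add: hopf_autD(3)[OF aut(2)])
    qed
    also have "\<dots> = ev ?L x f"
      using p q f l by (simp add: ev_conjg M DT_mult(2)[OF aut(3,4)] ev_cross aut lin_comp)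
    finally show "ev ?L x f = ev ?R x f" ..
  qed
  have 1: "conjg \<mu> \<kappa> (amult (DT H (\<gamma>, \<delta>)) (bt H p h) y) =
      amult (DT H (\<gamma>', \<delta>')) (bt H (p \<circ> \<mu>) (\<kappa> h)) (conjg \<mu> \<kappa> y)" if p: "lin p" and y: "y \<in> carr DS" for p h y
    by (rule DS_eqI[OF linear_map_comp[OF M(1) conjg_linear[OF l]] linear_map_comp[OF conjg_linear[OF l] M(4)] y])
      (auto simp: p pure conjg_bt l lin_comp)
  have mult: "conjg \<mu> \<kappa> (amult (DT H (\<gamma>, \<delta>)) x y) = amult (DT H (\<gamma>', \<delta>')) (conjg \<mu> \<kappa> x) (conjg \<mu> \<kappa> y)"
    if x: "x \<in> carr DS" and y: "y \<in> carr DS" for x y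
    by (rule DS_eqI[OF linear_map_comp[OF M(2) conjg_linear[OF l]] linear_map_comp[OF conjg_linear[OF l] M(5)] x])
      (auto simp: y 1 conjg_bt l conjg_carr)
  have "\<epsilon> \<circ> \<mu> = \<epsilon>" by (simp add: fun_eq_iff hopf_autD(5)[OF aut(1)])
  thus ?thesis
    unfolding alg_iso_def alg_hom_def using conjg_bij[OF aut(1,2)] conjg_linear[OF l] mult
    by (simp add: conjg_bt l lin_counit hopf_autD(4)[OF aut(2)])
qed

section \<open>The counit\<close>

lemma DT_counit_eq: "t \<in> carr DS \<Longrightarrow> DT_counit H t = ev t 1 \<epsilon>"
  unfolding DT_counit_def ev_def
  using tlift_apply[OF ks_dual ks_alg kspace_ground _ linear_map_ident(1)]
    bilinear_map_ground_mult[OF linear_map_dual_eval lin_counit[unfolded lin_def]] by blast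

text \<open>Evaluating the twisted product at 1 produces \<open>q (S' h3 h1)\<close> times the
  counit of h2. With both automorphisms trivial this collapses, by
  \<open>S' h2 h1 = \<epsilon> h\<close>, to the product of the counits.\<close>

lemma counit_alg_hom: "alg_hom (DT H (id, id)) ground (DT_counit H)"
proof -
  note id = hopf_aut_id hopf_aut_id
  note M = DT_mult_linear[OF id]
  have lin: "linear_map DS ground (DT_counit H)"
    by (subst linear_map_cong[OF ks_DS DT_counit_eq]) (auto intro: ev_linear)
  have pure: "DT_counit H (amult (DT H (id, id)) (bt H p h) (bt H q l)) =
      DT_counit H (bt H p h) * DT_counit H (bt H q l)" if p: "lin p" and q: "lin q" for p h q l
  proof -
    have "DT_counit H (amult (DT H (id, id)) (bt H p h) (bt H q l)) =
        sw3 (\<lambda>a b c. conv p (act id id q a c) 1 * \<epsilon> (b * l)) h"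
      using p q lin_counit by (simp add: DT_counit_eq M DT_mult(2)[OF id] ev_cross)
    also have "\<dots> = sw (\<lambda>a t. sw (\<lambda>b c. \<epsilon> b * (p 1 * q (S' c * a) * \<epsilon> l)) t) h"
      unfolding sw3_def by (simp add: conv_one p q lin_act) (simp add: act_def ac_simps)
    also have "\<dots> = sw (\<lambda>a t. p 1 * q (S' t * a) * \<epsilon> l) h"
      by (rule sw_cong, rule sw_counit_left) (intro lin_intros lin_app[OF q])
    also have "\<dots> = \<epsilon> h * (p 1 * q 1 * \<epsilon> l)"
      by (rule sw_antipode'_leftI[where g = "\<lambda>z. p 1 * q z * \<epsilon> l"]) (auto intro!: lin_intros q)
    also have "\<dots> = DT_counit H (bt H p h) * DT_counit H (bt H q l)"
      using p q lin_counit by (simp add: DT_counit_eq)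
    finally show ?thesis .
  qed
  have 1: "DT_counit H (amult (DT H (id, id)) (bt H p h) y) = DT_counit H (bt H p h) * DT_counit H y"
    if p: "lin p" and y: "y \<in> carr DS" for p h y
    by (rule DS_eqI[OF linear_map_comp[OF M(1) lin] linear_map_times(2)[OF lin] y])
      (auto simp: p pure)
  have "DT_counit H (amult (DT H (id, id)) x y) = DT_counit H x * DT_counit H y"
    if x: "x \<in> carr DS" and y: "y \<in> carr DS" for x y
    by (rule DS_eqI[OF linear_map_comp[OF M(2) lin] linear_map_times(1)[OF lin] x])
      (auto simp: y 1)
  thus ?thesis
    unfolding alg_hom_def using lin lin_counit by (simp add: DT_counit_eq)
qed

section \<open>Coassociativity, counit axioms and conjugation of the comultiplication\<close>

lemma tmap_apply:
  assumes V: "is_kspace V" and W: "is_kspace W" and V': "is_kspace V'" and W': "is_kspace W'"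
    and f: "linear_map V V' f" and g: "linear_map W W' g" and t: "t \<in> carr (tensor V W)"
  shows "tmap V W V' W' f g t \<in> carr (tensor V' W')"
    and "bilinear_map V' W' ground B \<Longrightarrow> tmap V W V' W' f g t B = t (\<lambda>v w. B (f v) (g w))"
proof -
  note T = kspace_tensor[OF V' W']
  have b: "bilinear_map V W (tensor V' W') (\<lambda>v w. tens V' W' (f v) (g w))"
    by (rule bilinear_map_comp[OF tens_bilinear[OF V' W'] f g])
  show "tmap V W V' W' f g t \<in> carr (tensor V' W')"
    unfolding tmap_def by (rule tlift_carr[OF V W T b t])
  assume "bilinear_map V' W' ground B"
  thus "tmap V W V' W' f g t B = t (\<lambda>v w. B (f v) (g w))"
    unfolding tmap_def
    using tlift_apply[OF V W T b tensor_apply_linear t, of B] by (simp add: tens_apply)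
qed

text \<open>Rebracketing in terms of evaluations: the first two pairs are read by
  \<open>ev2\<close>, the third by \<open>ev\<close>. It suffices to take a pure tensor of s and c,
  where the claim is linear in s and is checked on pure tensors once more.\<close>

lemma tassoc_DS:
  assumes T: "T \<in> carr (tensor DS2 DS)"
  shows "tassoc DS DS DS T \<in> carr DS3"
    and "ev3 (tassoc DS DS DS T) x f y g z k = T (\<lambda>s c. ev2 s x f y g * ev c z k)"
proof -
  note B2 = tens_bilinear[OF ks_DS ks_DS] and B3 = tens_bilinear[OF ks_DS ks_DS2]
  let ?F = "\<lambda>t w. tlift DS DS (\<lambda>u v. tens DS DS2 u (tens DS DS v w)) t"
  have b: "bilinear_map DS DS DS3 (\<lambda>u v. tens DS DS2 u (tens DS DS v w))"
    if "w \<in> carr DS" for w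
    by (rule bilinear_map_comp[OF B3 linear_map_ident(1) bilinear_mapD(1)[OF B2 that]])
  have F: "bilinear_map DS2 DS DS3 ?F"
    by (rule tlift_bilinear[OF ks_DS ks_DS ks_DS3(1) ks_DS b])
      (auto intro: linear_map_comp[OF bilinear_mapD(2)[OF B2] bilinear_mapD(2)[OF B3]])
  show "tassoc DS DS DS T \<in> carr DS3"
    unfolding tassoc_def by (rule tlift_carr[OF ks_DS2 ks_DS ks_DS3(1) F T])
  have l: "linear_map (tensor DS2 DS) ground (\<lambda>T. ev3 (tassoc DS DS DS T) x f y g z k)"
    unfolding tassoc_def
    by (rule linear_map_comp[OF tlift_linear[OF F ks_DS2 ks_DS ks_DS3(1)] ev3_linear])
  have bl: "bilinear_map DS2 DS ground (\<lambda>s c. ev2 s x f y g * ev c z k)"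
    by (rule bilinear_map_ground_mult[OF ev2_linear ev_linear])
  show "ev3 (tassoc DS DS DS T) x f y g z k = T (\<lambda>s c. ev2 s x f y g * ev c z k)"
  proof (rule tensor_linear_eqI[OF ks_DS2 ks_DS l tensor_apply_linear _ T])
    fix s c assume s: "s \<in> carr DS2" and c: "c \<in> carr DS"
    have "ev3 (?F s c) x f y g z k = s (\<lambda>u v. ev u x f * (ev v y g * ev c z k))"
      using tlift_apply[OF ks_DS ks_DS ks_DS3(1) b[OF c] ev3_linear s] by simp
    also have "\<dots> = ev2 s x f y g * ev c z k"
      by (rule tensor_linear_eqI[OF ks_DS ks_DS tensor_apply_linear linear_map_times(1)[OF ev2_linear] _ s])
        (simp add: tens_apply bilinear_map_ground_mult ev_linear linear_map_times)
    finally show "ev3 (tassoc DS DS DS (tens DS2 DS s c)) x f y g z k =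
        tens DS2 DS s c (\<lambda>s c. ev2 s x f y g * ev c z k)"
      unfolding tassoc_def by (simp add: tlift_tens[OF F ks_DS3(1) s c] tens_apply[OF bl])
  qed
qed

lemma tassoc_DT [simp]: "tassoc (DT H a) (DT H b) (DT H c) = tassoc DS DS DS"
  by (simp add: tassoc_def fun_eq_iff)

lemma tmap_DT [simp]:
  "tmap (DT H a) (DT H b) (DT H a') (DT H b') f g = tmap DS DS DS DS f g"
  "tmap (DT H a) (DT H b) (tensor V W) (DT H b') f' g = tmap DS DS (tensor V W) DS f' g"
  "tmap (DT H a) (DT H b) (DT H a') (tensor V W) f g' = tmap DS DS DS (tensor V W) f g'"
  by (simp_all add: tmap_def fun_eq_iff)

text \<open>Both sides evaluate t at \<open>z * y * x\<close> against a threefold convolution, so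
  associativity in H and of convolution gives the claim. The three hypotheses compare the
  automorphisms that reach the first, second and third tensor factor.\<close>

lemma comul_coassoc:
  assumes aut: "\<gamma> \<in> Aut" "\<tau> \<in> Aut" "\<gamma>' \<in> Aut" "\<tau>' \<in> Aut"
      "\<gamma>2 \<in> Aut" "\<tau>2 \<in> Aut" "\<gamma>3 \<in> Aut" "\<tau>3 \<in> Aut"
    and c: "\<And>x. \<gamma> (\<gamma>' x) = \<gamma>2 x" "\<And>x. \<tau> (\<gamma>' x) = \<gamma>3 (\<tau>2 x)" "\<And>x. \<tau>' x = \<tau>3 (\<tau>2 x)"
    and t: "t \<in> carr DS"
  shows "tassoc DS DS DS (tmap DS DS DS2 DS (comul \<gamma> \<tau>) id (comul \<gamma>' \<tau>' t)) =
    tmap DS DS DS DS2 id (comul \<gamma>3 \<tau>3) (comul \<gamma>2 \<tau>2 t)" (is "?L = ?R")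
proof -
  note l = aut[THEN hopf_autD(1)]
  note D = comul_linear[OF l(1,2)] comul_linear[OF l(3,4)] comul_linear[OF l(5,6)] comul_linear[OF l(7,8)]
  note tm1 = tmap_apply[OF ks_DS ks_DS ks_DS2 ks_DS D(1) linear_map_ident(2) linear_mapD(1)[OF D(2) t]]
  note tm2 = tmap_apply[OF ks_DS ks_DS ks_DS ks_DS2 linear_map_ident(2) D(4) linear_mapD(1)[OF D(3) t]]
  show ?thesis
  proof (rule ev3_ext)
    show "?L \<in> carr DS3" by (rule tassoc_DS(1)[OF tm1(1)])
    show "?R \<in> carr DS3" by (rule tm2(1))
    fix x f y g z k assume f: "lin f" and g: "lin g" and k: "lin k"
    have E: "conv (conv (f \<circ> \<gamma>) (g \<circ> \<tau>) \<circ> \<gamma>') (k \<circ> \<tau>') =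
        conv (f \<circ> \<gamma>2) (conv (g \<circ> \<gamma>3) (k \<circ> \<tau>3) \<circ> \<tau>2)"
    proof -
      have "f \<circ> \<gamma> \<circ> \<gamma>' = f \<circ> \<gamma>2" "g \<circ> \<tau> \<circ> \<gamma>' = g \<circ> \<gamma>3 \<circ> \<tau>2" "k \<circ> \<tau>' = k \<circ> \<tau>3 \<circ> \<tau>2"
        by (simp_all add: fun_eq_iff c)
      thus ?thesis
        using aut f g k l by (simp add: conv_aut conv_assoc lin_comp)
    qed
    note bl = bilinear_map_ground_mult[OF ev2_linear ev_linear] bilinear_map_ground_mult[OF ev_linear ev2_linear]
    have "ev3 ?L x f y g z k = comul \<gamma>' \<tau>' t (\<lambda>v w. ev2 (comul \<gamma> \<tau> v) x f y g * ev w z k)"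
      by (simp add: tassoc_DS(2)[OF tm1(1)] tm1(2)[OF bl(1)])
    also have "\<dots> = ev2 (comul \<gamma>' \<tau>' t) (y * x) (conv (f \<circ> \<gamma>) (g \<circ> \<tau>)) z k"
      unfolding ev2_def[of "comul \<gamma>' \<tau>' t"]
      by (rule tensor_apply_cong[OF linear_mapD(1)[OF D(2) t]])
        (auto intro!: bilinear_map_ground_mult ev_linear linear_map_comp[OF D(1) ev2_linear]
          simp: ev2_comul l f g)
    also have "\<dots> = ev t (z * (y * x)) (conv (conv (f \<circ> \<gamma>) (g \<circ> \<tau>) \<circ> \<gamma>') (k \<circ> \<tau>'))"
      by (rule ev2_comul) (simp_all add: l f g k t lin_conv lin_comp)
    also have "\<dots> = ev2 (comul \<gamma>2 \<tau>2 t) x f (z * y) (conv (g \<circ> \<gamma>3) (k \<circ> \<tau>3))"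
      unfolding E by (subst ev2_comul) (simp_all add: l f g k t lin_conv lin_comp mult.assoc)
    also have "\<dots> = comul \<gamma>2 \<tau>2 t (\<lambda>v w. ev v x f * ev2 (comul \<gamma>3 \<tau>3 w) y g z k)"
      unfolding ev2_def[of "comul \<gamma>2 \<tau>2 t"]
      by (rule tensor_apply_cong[OF linear_mapD(1)[OF D(3) t]])
        (auto intro!: bilinear_map_ground_mult ev_linear linear_map_comp[OF D(4) ev2_linear]
          simp: ev2_comul l g k)
    also have "\<dots> = ev3 ?R x f y g z k"
      unfolding ev3_def by (simp add: tm2(2)[OF bl(2)])
    finally show "ev3 ?L x f y g z k = ev3 ?R x f y g z k" .
  qed
qed

text \<open>The counit is evaluation at (1, \<epsilon>). Putting this pair into one factor of
  \<open>ev2_comul\<close> leaves evaluation of t at x against f composed with the automorphism of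
  the other factor, because automorphisms preserve \<epsilon> and \<epsilon> is the unit for
  convolution.\<close>

lemma comul_counit:
  assumes aut: "\<gamma> \<in> Aut" "\<tau> \<in> Aut" and t: "t \<in> carr DS"
  shows "(\<And>x. \<gamma> x = x) \<Longrightarrow> tlift DS DS (\<lambda>y z. scl DS (DT_counit H z) y) (comul \<gamma> \<tau> t) = t"
    and "(\<And>x. \<tau> x = x) \<Longrightarrow> tlift DS DS (\<lambda>y z. scl DS (DT_counit H y) z) (comul \<gamma> \<tau> t) = t"
proof -
  note l = aut[THEN hopf_autD(1)]
  note Dt = linear_mapD(1)[OF comul_linear[OF l] t]
  have cl: "linear_map DS ground (DT_counit H)"
    using counit_alg_hom by (simp add: alg_hom_def)
  have b: "bilinear_map DS DS DS (\<lambda>y z. scl DS (DT_counit H z) y)"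
    "bilinear_map DS DS DS (\<lambda>y z. scl DS (DT_counit H y) z)"
    by (intro bilinear_mapI linear_map_scl linear_map_scl_scalar linear_map_ident ks_DS cl; assumption)+
  have e: "\<epsilon> \<circ> \<gamma> = \<epsilon>" "\<epsilon> \<circ> \<tau> = \<epsilon>" by (simp_all add: fun_eq_iff hopf_autD(5)[OF aut(1)] hopf_autD(5)[OF aut(2)])
  have s: "ev (scl DS c y) x f = c * ev y x f" for c y x f
    by (simp add: ev_def)
  show "tlift DS DS (\<lambda>y z. scl DS (DT_counit H z) y) (comul \<gamma> \<tau> t) = t" if "\<And>x. \<gamma> x = x"
  proof (rule ev_ext[OF tlift_carr[OF ks_DS ks_DS ks_DS b(1) Dt] t])
    fix x f assume f: "lin f"
    have fg: "f \<circ> \<gamma> = f" using that by (simp add: fun_eq_iff)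
    have "ev (tlift DS DS (\<lambda>y z. scl DS (DT_counit H z) y) (comul \<gamma> \<tau> t)) x f =
        comul \<gamma> \<tau> t (\<lambda>y z. DT_counit H z * ev y x f)"
      using tlift_apply[OF ks_DS ks_DS ks_DS b(1) ev_linear Dt] by (simp add: s)
    also have "\<dots> = ev2 (comul \<gamma> \<tau> t) x f 1 \<epsilon>"
      unfolding ev2_def
      by (rule tensor_apply_cong[OF Dt])
        (auto simp: DT_counit_eq intro!: bilinear_mapI ev_linear linear_map_times cl)
    also have "\<dots> = ev t x f"
      using l f t lin_counit by (simp add: ev2_comul fg e conv_counit)
    finally show "ev (tlift DS DS (\<lambda>y z. scl DS (DT_counit H z) y) (comul \<gamma> \<tau> t)) x f = ev t x f" .
  qed
  show "tlift DS DS (\<lambda>y z. scl DS (DT_counit H y) z) (comul \<gamma> \<tau> t) = t" if "\<And>x. \<tau> x = x"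
  proof (rule ev_ext[OF tlift_carr[OF ks_DS ks_DS ks_DS b(2) Dt] t])
    fix x f assume f: "lin f"
    have fg: "f \<circ> \<tau> = f" using that by (simp add: fun_eq_iff)
    have "ev (tlift DS DS (\<lambda>y z. scl DS (DT_counit H y) z) (comul \<gamma> \<tau> t)) x f =
        comul \<gamma> \<tau> t (\<lambda>y z. DT_counit H y * ev z x f)"
      using tlift_apply[OF ks_DS ks_DS ks_DS b(2) ev_linear Dt] by (simp add: s)
    also have "\<dots> = ev2 (comul \<gamma> \<tau> t) 1 \<epsilon> x f"
      unfolding ev2_def
      by (rule tensor_apply_cong[OF Dt])
        (auto simp: DT_counit_eq intro!: bilinear_mapI ev_linear linear_map_times cl)
    also have "\<dots> = ev t x f"
      using l f t lin_counit by (simp add: ev2_comul fg e conv_counit)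
    finally show "ev (tlift DS DS (\<lambda>y z. scl DS (DT_counit H y) z) (comul \<gamma> \<tau> t)) x f = ev t x f" .
  qed
qed

text \<open>The dual side of conjugation depends on the conjugating element alone, hence a single
  \<mu>, whereas its H side also depends on the component it starts from, hence three maps \<kappa>,
  \<kappa>', \<kappa>''. The evaluation points agree because \<mu> is multiplicative.\<close>

lemma conjg_comul:
  assumes aut: "\<mu> \<in> Aut" "\<kappa> \<in> Aut" "\<kappa>' \<in> Aut" "\<kappa>'' \<in> Aut"
      "\<gamma> \<in> Aut" "\<tau> \<in> Aut" "\<gamma>' \<in> Aut" "\<tau>' \<in> Aut"
    and c: "\<And>x. \<kappa> (\<gamma> x) = \<gamma>' (\<kappa>'' x)" "\<And>x. \<kappa>' (\<tau> x) = \<tau>' (\<kappa>'' x)" and t: "t \<in> carr DS"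
  shows "tmap DS DS DS DS (conjg \<mu> \<kappa>) (conjg \<mu> \<kappa>') (comul \<gamma> \<tau> t) = comul \<gamma>' \<tau>' (conjg \<mu> \<kappa>'' t)"
proof -
  note l = aut[THEN hopf_autD(1)]
  note D = comul_linear[OF l(5,6)] comul_linear[OF l(7,8)]
  note P = conjg_linear[OF l(1,2)] conjg_linear[OF l(1,3)] conjg_linear[OF l(1,4)]
  note tm = tmap_apply[OF ks_DS ks_DS ks_DS ks_DS P(1,2) linear_mapD(1)[OF D(1) t]]
  show ?thesis
  proof (rule ev2_ext[OF tm(1) linear_mapD(1)[OF D(2) linear_mapD(1)[OF P(3) t]]])
    fix x f y g assume f: "lin f" and g: "lin g"
    have E: "conv (f \<circ> \<kappa> \<circ> \<gamma>) (g \<circ> \<kappa>' \<circ> \<tau>) = conv (f \<circ> \<gamma>') (g \<circ> \<tau>') \<circ> \<kappa>''"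
    proof -
      have "f \<circ> \<kappa> \<circ> \<gamma> = f \<circ> \<gamma>' \<circ> \<kappa>''" "g \<circ> \<kappa>' \<circ> \<tau> = g \<circ> \<tau>' \<circ> \<kappa>''"
        by (simp_all add: fun_eq_iff c)
      thus ?thesis by (simp add: conv_aut[OF aut(4)] lin_comp l f g)
    qed
    have "ev2 (tmap DS DS DS DS (conjg \<mu> \<kappa>) (conjg \<mu> \<kappa>') (comul \<gamma> \<tau> t)) x f y g =
        comul \<gamma> \<tau> t (\<lambda>a b. ev (conjg \<mu> \<kappa> a) x f * ev (conjg \<mu> \<kappa>' b) y g)"
      unfolding ev2_def by (rule tm(2)) (intro bilinear_map_ground_mult ev_linear)
    also have "\<dots> = ev2 (comul \<gamma> \<tau> t) (\<mu> x) (f \<circ> \<kappa>) (\<mu> y) (g \<circ> \<kappa>')"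
      unfolding ev2_def
      by (rule tensor_apply_cong[OF linear_mapD(1)[OF D(1) t]])
        (auto intro!: bilinear_map_ground_mult ev_linear linear_map_comp[OF P(1) ev_linear]
          linear_map_comp[OF P(2) ev_linear] simp: ev_conjg l f g)
    also have "\<dots> = ev t (\<mu> (y * x)) (conv (f \<circ> \<kappa> \<circ> \<gamma>) (g \<circ> \<kappa>' \<circ> \<tau>))"
      by (simp add: ev2_comul l lin_comp f g t hopf_autD(3)[OF aut(1)])
    also have "\<dots> = ev2 (comul \<gamma>' \<tau>' (conjg \<mu> \<kappa>'' t)) x f y g"
      unfolding E by (simp add: ev2_comul ev_conjg l lin_comp lin_conv f g t conjg_carr)
    finally show "ev2 (tmap DS DS DS DS (conjg \<mu> \<kappa>) (conjg \<mu> \<kappa>') (comul \<gamma> \<tau> t)) x f y g =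
        ev2 (comul \<gamma>' \<tau>' (conjg \<mu> \<kappa>'' t)) x f y g" .
  qed
qed

section \<open>Antipode\<close>

lemma tlift_comul:
  assumes l: "linH \<gamma>" "linH \<tau>" and p: "lin p" and U: "is_kspace U" and F: "bilinear_map DS DS U F"
  shows "tlift DS DS F (comul \<gamma> \<tau> (bt H p h)) =
    (\<Sum>e\<in>E. sw (\<lambda>h1 h2. F (bt H (p \<leftharpoonup> e) (\<gamma> h1)) (bt H (co e) (\<tau> h2))) h)"
  unfolding comul_bt[OF l p]
  by (subst linear_of_sum_sw[OF ks_DS2 tlift_linear[OF F ks_DS ks_DS U]])
    (simp_all add: tens_carr lin_ract lin_co p tlift_tens[OF F U])

text \<open>The pair (\<alpha>, \<beta>) indexes the component in which the value lies, that is, the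
  inverse of the index of the argument; \<sigma> is the automorphism applied after S.\<close>

definition antip :: "('h \<Rightarrow> 'h) \<Rightarrow> ('h \<Rightarrow> 'h) \<Rightarrow> ('h \<Rightarrow> 'h) \<Rightarrow> ('k, 'h) dcp \<Rightarrow> ('k, 'h) dcp" where
  "antip \<alpha> \<beta> \<sigma> = tlift (dual H) (alg H) (\<lambda>p h. amult (DT H (\<alpha>, \<beta>)) (bt H \<epsilon> (\<sigma> (S h))) (bt H (p \<circ> S') 1))"

lemma antip:
  assumes ab: "\<alpha> \<in> Aut" "\<beta> \<in> Aut" and s: "linH \<sigma>"
  shows "linear_map DS DS (antip \<alpha> \<beta> \<sigma>)"
    and "lin p \<Longrightarrow> antip \<alpha> \<beta> \<sigma> (bt H p h) = amult (DT H (\<alpha>, \<beta>)) (bt H \<epsilon> (\<sigma> (S h))) (bt H (p \<circ> S') 1)"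
proof -
  note M = DT_mult_linear[OF ab]
  have B: "bilinear_map (dual H) (alg H) DS (\<lambda>p h. amult (DT H (\<alpha>, \<beta>)) (bt H \<epsilon> (\<sigma> (S h))) (bt H (p \<circ> S') 1))"
  proof (rule bilinear_mapI)
    have "linear_map (dual H) DS (\<lambda>p. bt H (p \<circ> S') 1)"
      by (intro linear_map_bt1 linear_map_dualI) (auto simp: linear_map_dual_eval lin_comp linH_antipode')
    from linear_map_comp[OF this M(1)]
    show "linear_map (dual H) DS (\<lambda>p. amult (DT H (\<alpha>, \<beta>)) (bt H \<epsilon> (\<sigma> (S h))) (bt H (p \<circ> S') 1))" for h
      by (simp add: lin_counit)
    have "linear_map (alg H) DS (\<lambda>h. bt H \<epsilon> (\<sigma> (S h)))"
      using s linH_antipode by (intro linear_map_bt2 lin_counit) (simp add: linH_def[symmetric] linH_app)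
    from linear_map_comp[OF this M(2)]
    show "linear_map (alg H) DS (\<lambda>h. amult (DT H (\<alpha>, \<beta>)) (bt H \<epsilon> (\<sigma> (S h))) (bt H (p \<circ> S') 1))"
      if "p \<in> carr (dual H)" for p
      using that by (simp add: lin_comp linH_antipode')
  qed
  show "linear_map DS DS (antip \<alpha> \<beta> \<sigma>)"
    unfolding antip_def by (rule tlift_linear[OF B]) auto
  show "antip \<alpha> \<beta> \<sigma> (bt H p h) = amult (DT H (\<alpha>, \<beta>)) (bt H \<epsilon> (\<sigma> (S h))) (bt H (p \<circ> S') 1)" if "lin p"
    unfolding antip_def bt_def[of H p h] using that by (subst tlift_tens[OF B]) auto
qed

lemma ev_scl [simp]: "ev (scl DS c t) x f = c * ev t x f"
  by (simp add: ev_def)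

lemma scl_carr [simp]: "t \<in> carr DS \<Longrightarrow> scl DS c t \<in> carr DS"
  by (rule kspace_closed(3)[OF ks_DS])

lemma ev_sum: "(\<And>i. i \<in> I \<Longrightarrow> F i \<in> carr DS) \<Longrightarrow> ev (\<Sum>i\<in>I. F i) x f = (\<Sum>i\<in>I. ev (F i) x f)"
  by (rule linear_map_sum[OF ks_DS ev_linear])

lemma ev_sw: "(\<And>a b. F a b \<in> carr DS) \<Longrightarrow> ev (sw (\<lambda>a b. F a b) h) x f = sw (\<lambda>a b. ev (F a b) x f) h"
  by (rule linear_of_sw[OF ks_DS ev_linear])

text \<open>By the relation on \<sigma>, each summand is
  \<open>\<epsilon> \<bowtie> \<tau> (S h1)\<close> times a pure functional times
  \<open>\<epsilon> \<bowtie> \<tau> h2\<close>. Summing over \<open>E\<close> collapses the middle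
  factor to p(1) \<epsilon> through \<open>x2 S' x1 = \<epsilon> x\<close>; then the outer factors
  meet and \<open>S h1 h2\<close> cancels.\<close>

lemma antip_left:
  assumes ab: "\<alpha> \<in> Aut" "\<beta> \<in> Aut"
    and aut: "\<gamma> \<in> Aut" "\<tau> \<in> Aut" "\<sigma> \<in> Aut"
    and c: "\<And>x. \<sigma> (\<gamma> x) = \<tau> x" and x: "x \<in> carr DS"
  shows "tlift DS DS (\<lambda>y z. amult (DT H (\<alpha>, \<beta>)) (antip \<alpha> \<beta> \<sigma> y) z) (comul \<gamma> \<tau> x) =
    scl DS (DT_counit H x) (bt H \<epsilon> 1)"
proof -
  let ?m = "amult (DT H (\<alpha>, \<beta>))"
  note l = aut[THEN hopf_autD(1)]
  note M = DT_mult_linear[OF ab] and MU = DT_mult_bt_unit[OF ab] and antip = antip[OF ab l(3)]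
  have F: "bilinear_map DS DS DS (\<lambda>y z. ?m (antip \<alpha> \<beta> \<sigma> y) z)"
    using bilinear_map_comp[OF DT_mult(1)[OF ab] antip(1) linear_map_ident(1)] .
  have cl: "linear_map DS ground (DT_counit H)"
    using counit_alg_hom by (simp add: alg_hom_def)
  have "tlift DS DS (\<lambda>y z. ?m (antip \<alpha> \<beta> \<sigma> y) z) (comul \<gamma> \<tau> (bt H p h)) =
      scl DS (DT_counit H (bt H p h)) (bt H \<epsilon> 1)" if p: "lin p" for p h
  proof -
    let ?c = "\<lambda>e. conv ((p \<leftharpoonup> e) \<circ> S') (co e)"
    \<comment> \<open>Multiplication from both sides is linear in the middle factor, so the sum over
      \<open>E\<close> can be taken there.\<close>
    let ?G = "\<lambda>h1 h2 t. ?m (bt H \<epsilon> (\<tau> (S h1))) (?m t (bt H \<epsilon> (\<tau> h2)))"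
    have lin: "lin ((p \<leftharpoonup> e) \<circ> S')" "lin (?c e)" for e
      by (simp_all add: lin_conv lin_comp lin_ract lin_co linH_antipode' p)
    have G: "linear_map DS DS (?G h1 h2)" for h1 h2
      by (rule linear_map_comp[OF M(2) M(1)]) (simp_all add: lin_counit)
    have ce: "(\<Sum>e\<in>E. bt H (?c e) 1) = scl DS (p 1) (bt H \<epsilon> 1)"
    proof (rule ev_ext)
      fix x f assume f: "lin f"
      have "(\<Sum>e\<in>E. ?c e x) = sw (\<lambda>x1 x2. p (x2 * S' x1)) x"
        unfolding conv_def sw_sum by (simp add: sum_co_ract p)
      also have "\<dots> = \<epsilon> x * p 1"
        by (rule sw_antipode'_rightI[OF p refl])
      finally show "ev (\<Sum>e\<in>E. bt H (?c e) 1) x f = ev (scl DS (p 1) (bt H \<epsilon> 1)) x f"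
        by (simp add: ev_sum lin f lin_counit sum_distrib_right[symmetric])
    qed (simp_all add: lin lin_counit kspace_closed(4)[OF ks_DS])
    have "?m (antip \<alpha> \<beta> \<sigma> (bt H (p \<leftharpoonup> e) (\<gamma> h1))) (bt H (co e) (\<tau> h2)) = ?G h1 h2 (bt H (?c e) 1)" for e h1 h2
    proof -
      have "\<sigma> (S (\<gamma> h1)) = \<tau> (S h1)"
        by (simp add: hopf_autD(6)[OF aut(1)] c)
      hence "?m (antip \<alpha> \<beta> \<sigma> (bt H (p \<leftharpoonup> e) (\<gamma> h1))) (bt H (co e) (\<tau> h2)) =
          ?m (?m (bt H \<epsilon> (\<tau> (S h1))) (bt H ((p \<leftharpoonup> e) \<circ> S') 1)) (bt H (co e) (\<tau> h2))"
        by (simp add: antip(2) lin_ract p)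
      also have "\<dots> = ?m (bt H \<epsilon> (\<tau> (S h1))) (?m (bt H ((p \<leftharpoonup> e) \<circ> S') 1) (bt H (co e) (\<tau> h2)))"
        by (rule DT_assoc[OF ab]) (simp_all add: lin lin_counit lin_co)
      also have "\<dots> = ?G h1 h2 (bt H (?c e) 1)"
        by (simp add: MU lin lin_co)
      finally show ?thesis .
    qed
    hence "tlift DS DS (\<lambda>y z. ?m (antip \<alpha> \<beta> \<sigma> y) z) (comul \<gamma> \<tau> (bt H p h)) =
        sw (\<lambda>h1 h2. \<Sum>e\<in>E. ?G h1 h2 (bt H (?c e) 1)) h"
      by (simp add: tlift_comul[OF l(1,2) p ks_DS F] sw_sum)
    also have "\<dots> = sw (\<lambda>h1 h2. scl DS (p 1) (bt H \<epsilon> (\<tau> (S h1 * h2)))) h"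
    proof (rule sw_cong)
      fix h1 h2
      have "(\<Sum>e\<in>E. ?G h1 h2 (bt H (?c e) 1)) = ?G h1 h2 (\<Sum>e\<in>E. bt H (?c e) 1)"
        by (rule linear_map_sum[OF ks_DS G, symmetric]) (simp add: lin)
      also have "\<dots> = scl DS (p 1) (?G h1 h2 (bt H \<epsilon> 1))"
        unfolding ce by (rule linear_mapD(3)[OF G]) (simp add: lin_counit)
      also have "?G h1 h2 (bt H \<epsilon> 1) = bt H \<epsilon> (\<tau> (S h1 * h2))"
        by (simp add: MU lin_counit conv_counit hopf_autD(3)[OF aut(2)])
      finally show "(\<Sum>e\<in>E. ?G h1 h2 (bt H (?c e) 1)) = scl DS (p 1) (bt H \<epsilon> (\<tau> (S h1 * h2)))" .
    qed
    also have "\<dots> = scl DS (DT_counit H (bt H p h)) (bt H \<epsilon> 1)"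
    proof (rule ev_ext)
      fix x f assume f: "lin f"
      have "sw (\<lambda>h1 h2. p 1 * (\<epsilon> x * f (\<tau> (S h1 * h2)))) h = \<epsilon> h * (p 1 * (\<epsilon> x * f (\<tau> 1)))"
        by (rule sw_antipode_left) (intro lin_intros lin_app[OF f] l)
      thus "ev (sw (\<lambda>h1 h2. scl DS (p 1) (bt H \<epsilon> (\<tau> (S h1 * h2)))) h) x f =
          ev (scl DS (DT_counit H (bt H p h)) (bt H \<epsilon> 1)) x f"
        by (simp add: ev_sw f p lin_counit DT_counit_eq hopf_autD(4)[OF aut(2)])
    qed (simp_all add: sw_carr lin_counit)
    finally show ?thesis .
  qed
  thus ?thesis
    by (intro DS_eqI[where g = "\<lambda>x. scl DS (DT_counit H x) (bt H \<epsilon> 1)",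
          OF linear_map_comp[OF comul_linear[OF l(1,2)] tlift_linear[OF F ks_DS ks_DS ks_DS]] _ x]
        linear_map_scl_scalar ks_DS cl) (auto simp: lin_counit)
qed

text \<open>Here the H parts are adjacent from the start and cancel first, as
  \<open>h1 S h2\<close>. The functionals then multiply without crossing and collapse through
  \<open>S' x2 x1 = \<epsilon> x\<close>, the other identity for \<open>S'\<close>.\<close>

lemma antip_right:
  assumes ab: "\<alpha> \<in> Aut" "\<beta> \<in> Aut"
    and aut: "\<gamma> \<in> Aut" "\<tau> \<in> Aut" "\<sigma> \<in> Aut"
    and c: "\<And>x. \<sigma> (\<tau> x) = \<gamma> x" and x: "x \<in> carr DS"
  shows "tlift DS DS (\<lambda>y z. amult (DT H (\<alpha>, \<beta>)) y (antip \<alpha> \<beta> \<sigma> z)) (comul \<gamma> \<tau> x) =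
    scl DS (DT_counit H x) (bt H \<epsilon> 1)"
proof -
  let ?m = "amult (DT H (\<alpha>, \<beta>))"
  note l = aut[THEN hopf_autD(1)]
  note M = DT_mult_linear[OF ab] and MU = DT_mult_bt_unit[OF ab] and antip = antip[OF ab l(3)]
  have F: "bilinear_map DS DS DS (\<lambda>y z. ?m y (antip \<alpha> \<beta> \<sigma> z))"
    using bilinear_map_comp[OF DT_mult(1)[OF ab] linear_map_ident(1) antip(1)] .
  have cl: "linear_map DS ground (DT_counit H)"
    using counit_alg_hom by (simp add: alg_hom_def)
  have "tlift DS DS (\<lambda>y z. ?m y (antip \<alpha> \<beta> \<sigma> z)) (comul \<gamma> \<tau> (bt H p h)) =
      scl DS (DT_counit H (bt H p h)) (bt H \<epsilon> 1)" if p: "lin p" for p h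
  proof -
    let ?z = "\<lambda>e. bt H (co e \<circ> S') 1"
    have lin: "lin (co e \<circ> S')" "lin (p \<leftharpoonup> e)" for e
      by (simp_all add: lin_comp lin_ract lin_co linH_antipode' p)
    have z: "?z e \<in> carr DS" for e by (simp add: lin)
    have "?m (bt H (p \<leftharpoonup> e) (\<gamma> h1)) (antip \<alpha> \<beta> \<sigma> (bt H (co e) (\<tau> h2))) =
        ?m (bt H (p \<leftharpoonup> e) (\<gamma> (h1 * S h2))) (?z e)" for e h1 h2
    proof -
      have "\<sigma> (S (\<tau> h2)) = \<gamma> (S h2)"
        by (simp add: hopf_autD(6)[OF aut(2)] c)
      hence "?m (bt H (p \<leftharpoonup> e) (\<gamma> h1)) (antip \<alpha> \<beta> \<sigma> (bt H (co e) (\<tau> h2))) =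
          ?m (bt H (p \<leftharpoonup> e) (\<gamma> h1)) (?m (bt H \<epsilon> (\<gamma> (S h2))) (?z e))"
        by (simp add: antip(2) lin_co)
      also have "\<dots> = ?m (?m (bt H (p \<leftharpoonup> e) (\<gamma> h1)) (bt H \<epsilon> (\<gamma> (S h2)))) (?z e)"
        by (rule DT_assoc[OF ab, symmetric]) (simp_all add: lin lin_counit)
      also have "\<dots> = ?m (bt H (p \<leftharpoonup> e) (\<gamma> (h1 * S h2))) (?z e)"
        by (simp add: MU lin hopf_autD(3)[OF aut(1)])
      finally show ?thesis .
    qed
    hence "tlift DS DS (\<lambda>y z. ?m y (antip \<alpha> \<beta> \<sigma> z)) (comul \<gamma> \<tau> (bt H p h)) =
        (\<Sum>e\<in>E. sw (\<lambda>h1 h2. ?m (bt H (p \<leftharpoonup> e) (\<gamma> (h1 * S h2))) (?z e)) h)"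
      by (simp add: tlift_comul[OF l(1,2) p ks_DS F])
    also have "\<dots> = (\<Sum>e\<in>E. scl DS (\<epsilon> h) (bt H (conv (p \<leftharpoonup> e) (co e \<circ> S')) 1))"
    proof (rule sum.cong[OF refl])
      fix e
      have "sw (\<lambda>h1 h2. ?m (bt H (p \<leftharpoonup> e) (\<gamma> (h1 * S h2))) (?z e)) h =
          ?m (sw (\<lambda>h1 h2. bt H (p \<leftharpoonup> e) (\<gamma> (h1 * S h2))) h) (?z e)"
        by (rule linear_of_sw[OF ks_DS M(2)[OF z], symmetric]) (simp add: lin)
      also have "sw (\<lambda>h1 h2. bt H (p \<leftharpoonup> e) (\<gamma> (h1 * S h2))) h = scl DS (\<epsilon> h) (bt H (p \<leftharpoonup> e) 1)"
      proof (rule ev_ext)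
        fix x f assume f: "lin f"
        have "sw (\<lambda>h1 h2. (p \<leftharpoonup> e) x * f (\<gamma> (h1 * S h2))) h = \<epsilon> h * ((p \<leftharpoonup> e) x * f (\<gamma> 1))"
          by (rule sw_antipode_right) (intro lin_intros lin_app[OF f] l)
        thus "ev (sw (\<lambda>h1 h2. bt H (p \<leftharpoonup> e) (\<gamma> (h1 * S h2))) h) x f =
            ev (scl DS (\<epsilon> h) (bt H (p \<leftharpoonup> e) 1)) x f"
          by (simp add: ev_sw f lin hopf_autD(4)[OF aut(1)])
      qed (simp_all add: sw_carr lin)
      also have "?m (scl DS (\<epsilon> h) (bt H (p \<leftharpoonup> e) 1)) (?z e) = scl DS (\<epsilon> h) (?m (bt H (p \<leftharpoonup> e) 1) (?z e))"
        by (rule linear_mapD(3)[OF M(2)[OF z]]) (simp add: lin)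
      also have "?m (bt H (p \<leftharpoonup> e) 1) (?z e) = bt H (conv (p \<leftharpoonup> e) (co e \<circ> S')) 1"
        by (simp add: MU lin)
      finally show "sw (\<lambda>h1 h2. ?m (bt H (p \<leftharpoonup> e) (\<gamma> (h1 * S h2))) (?z e)) h =
          scl DS (\<epsilon> h) (bt H (conv (p \<leftharpoonup> e) (co e \<circ> S')) 1)" .
    qed
    also have "\<dots> = scl DS (DT_counit H (bt H p h)) (bt H \<epsilon> 1)"
    proof (rule ev_ext)
      fix x f assume f: "lin f"
      have "(\<Sum>e\<in>E. conv (p \<leftharpoonup> e) (co e \<circ> S') x) = sw (\<lambda>x1 x2. p (S' x2 * x1)) x"
        unfolding conv_def sw_sum by (simp add: sum_co_ract p)
      also have "\<dots> = \<epsilon> x * p 1"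
        by (rule sw_antipode'_leftI[OF p refl])
      finally show "ev (\<Sum>e\<in>E. scl DS (\<epsilon> h) (bt H (conv (p \<leftharpoonup> e) (co e \<circ> S')) 1)) x f =
          ev (scl DS (DT_counit H (bt H p h)) (bt H \<epsilon> 1)) x f"
        by (simp add: ev_sum lin lin_conv f lin_counit DT_counit_eq p sum_distrib_right[symmetric]
            sum_distrib_left[symmetric])
    qed (simp_all add: lin lin_conv lin_counit kspace_closed(4)[OF ks_DS])
    finally show ?thesis .
  qed
  thus ?thesis
    by (intro DS_eqI[where g = "\<lambda>x. scl DS (DT_counit H x) (bt H \<epsilon> 1)",
          OF linear_map_comp[OF comul_linear[OF l(1,2)] tlift_linear[OF F ks_DS ks_DS ks_DS]] _ x]
        linear_map_scl_scalar ks_DS cl) (auto simp: lin_counit)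
qed

section \<open>The universal R-matrix\<close>

definition Rmat :: "('h \<Rightarrow> 'h) \<Rightarrow> ((('k, 'h) dcp \<Rightarrow> ('k, 'h) dcp \<Rightarrow> 'k) \<Rightarrow> 'k)" where
  "Rmat \<rho> = (\<Sum>e\<in>E. tens DS DS (bt H \<epsilon> (\<rho> e)) (bt H (co e) 1))"

lemma DT_R_eq: "DT_R H E (\<alpha>, \<beta>) (\<gamma>, \<delta>) = Rmat (inverse_fun \<beta>)"
  by (simp add: DT_R_def Rmat_def)

lemma bt_carrs [simp]: "bt H \<epsilon> h \<in> carr DS" "bt H (co e) h \<in> carr DS"
  by (simp_all add: lin_counit lin_co)

lemma Rmat_carr [simp]: "Rmat \<rho> \<in> carr DS2"
  unfolding Rmat_def by (intro kspace_closed(4)[OF ks_DS2] tens_carr) auto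

lemma Rmat_apply:
  "bilinear_map DS DS ground B \<Longrightarrow> Rmat \<rho> B = (\<Sum>e\<in>E. B (bt H \<epsilon> (\<rho> e)) (bt H (co e) 1))"
  by (simp add: Rmat_def sum_fun_apply tens_apply)

lemma linear_Rmat:
  "linear_map DS2 U F \<Longrightarrow> F (Rmat \<rho>) = (\<Sum>e\<in>E. F (tens DS DS (bt H \<epsilon> (\<rho> e)) (bt H (co e) 1)))"
  unfolding Rmat_def by (rule linear_map_sum[OF ks_DS2]) (simp_all add: tens_carr)

lemma tlift_Rmat:
  "bilinear_map DS DS U F \<Longrightarrow> is_kspace U \<Longrightarrow> tlift DS DS F (Rmat \<rho>) = (\<Sum>e\<in>E. F (bt H \<epsilon> (\<rho> e)) (bt H (co e) 1))"
  by (subst linear_Rmat[OF tlift_linear]) (auto simp: tlift_tens)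

lemma lin_expand': "lin f \<Longrightarrow> (\<Sum>e\<in>E. f e * co e h) = f h"
  using lin_expand[of f h] by (simp add: mult.commute)

text \<open>Convolution splits y into two legs, and the coordinates expand these along
  \<open>E\<close>; linearity of \<open>F\<close> reassembles the expansions.\<close>

lemma sum_conv_co:
  assumes F: "\<And>b. lin (\<lambda>a. F a b)" "\<And>a. lin (\<lambda>b. F a b)"
  shows "(\<Sum>e\<in>E. \<Sum>d\<in>E. F e d * conv (co e) (co d) y) = sw (\<lambda>a b. F a b) y"
proof -
  have "(\<Sum>e\<in>E. \<Sum>d\<in>E. F e d * (co e a * co d b)) = F a b" for a b
  proof -
    have "(\<Sum>e\<in>E. \<Sum>d\<in>E. F e d * (co e a * co d b)) = (\<Sum>e\<in>E. (\<Sum>d\<in>E. F e d * co d b) * co e a)"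
      by (simp add: sum_distrib_right sum_distrib_left ac_simps)
    thus ?thesis by (simp add: lin_expand' F)
  qed
  thus ?thesis unfolding conv_def sw_times sw_sum by simp
qed

text \<open>The first factors multiply in H and the second ones by convolution, so the product
  evaluates to \<epsilon>(x) g(1) times the sum of \<open>f (\<rho> y1 * \<rho>' y2)\<close>. When
  one of the two maps is the other preceded by S, hypothesis \<open>c\<close> is an antipode
  identity.\<close>

lemma Rmat_inverse:
  assumes aut: "\<alpha> \<in> Aut" "\<beta> \<in> Aut" "\<gamma> \<in> Aut" "\<delta> \<in> Aut"
    and l: "linH \<rho>" "linH \<rho>'"
    and c: "\<And>y f. lin f \<Longrightarrow> sw (\<lambda>a b. f (\<rho> a * \<rho>' b)) y = \<epsilon> y * f 1"
  shows "amult (talg (DT H (\<alpha>, \<beta>)) (DT H (\<gamma>, \<delta>))) (Rmat \<rho>) (Rmat \<rho>') = tens DS DS (bt H \<epsilon> 1) (bt H \<epsilon> 1)"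
proof (rule ev2_ext)
  let ?m = "amult (talg (DT H (\<alpha>, \<beta>)) (DT H (\<gamma>, \<delta>)))"
  note T = talg_DT[OF aut]
  note MU = DT_mult_bt_unit[OF aut(1,2)] DT_mult_bt_unit[OF aut(3,4)]
  show "?m (Rmat \<rho>) (Rmat \<rho>') \<in> carr DS2"
    using bilinear_mapD(3)[OF T(1)] by simp
  show "tens DS DS (bt H \<epsilon> 1) (bt H \<epsilon> 1) \<in> carr DS2"
    by (simp add: tens_carr)
  fix x f y g assume f: "lin f" and g: "lin g"
  have "?m (Rmat \<rho>) (Rmat \<rho>') =
      (\<Sum>e\<in>E. \<Sum>d\<in>E. tens DS DS (bt H \<epsilon> (\<rho> e * \<rho>' d)) (bt H (conv (co e) (co d)) 1))"
    unfolding Rmat_def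
    by (subst bilinear_map_sum_sum[OF ks_DS2 ks_DS2 T(1)])
      (simp_all add: tens_carr T(2) MU lin_counit lin_co)
  hence "ev2 (?m (Rmat \<rho>) (Rmat \<rho>')) x f y g =
      (\<Sum>e\<in>E. \<Sum>d\<in>E. \<epsilon> x * f (\<rho> e * \<rho>' d) * (conv (co e) (co d) y * g 1))"
    by (simp add: linear_map_sum[OF ks_DS2 ev2_linear] tens_carr lin_conv lin_counit lin_co f g
        kspace_closed(4)[OF ks_DS2])
  also have "\<dots> = (\<Sum>e\<in>E. \<Sum>d\<in>E. (\<epsilon> x * g 1 * f (\<rho> e * \<rho>' d)) * conv (co e) (co d) y)"
    by (simp add: ac_simps)
  also have "\<dots> = sw (\<lambda>a b. \<epsilon> x * g 1 * f (\<rho> a * \<rho>' b)) y"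
    by (rule sum_conv_co) (intro lin_intros lin_app[OF f] l[THEN linH_app])+
  also have "\<dots> = ev2 (tens DS DS (bt H \<epsilon> 1) (bt H \<epsilon> 1)) x f y g"
    by (simp add: sw_times(2)[symmetric] c f g lin_counit)
  finally show "ev2 (?m (Rmat \<rho>) (Rmat \<rho>')) x f y g = ev2 (tens DS DS (bt H \<epsilon> 1) (bt H \<epsilon> 1)) x f y g" .
qed

lemma Rmat_invertible:
  assumes aut: "\<alpha> \<in> Aut" "\<beta> \<in> Aut" "\<gamma> \<in> Aut" "\<delta> \<in> Aut" "\<rho> \<in> Aut"
  shows "amult (talg (DT H (\<alpha>, \<beta>)) (DT H (\<gamma>, \<delta>))) (Rmat \<rho>) (Rmat (\<lambda>x. \<rho> (S x))) = tens DS DS (bt H \<epsilon> 1) (bt H \<epsilon> 1)"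
    and "amult (talg (DT H (\<alpha>, \<beta>)) (DT H (\<gamma>, \<delta>))) (Rmat (\<lambda>x. \<rho> (S x))) (Rmat \<rho>) = tens DS DS (bt H \<epsilon> 1) (bt H \<epsilon> 1)"
proof -
  note l = hopf_autD(1)[OF aut(5)] linH_app[OF hopf_autD(1)[OF aut(5)] linH_antipode]
  note r = hopf_autD(3,4)[OF aut(5)]
  have f: "lin (\<lambda>x. f (\<rho> x))" if "lin f" for f using lin_app[OF that l(1)] .
  show "amult (talg (DT H (\<alpha>, \<beta>)) (DT H (\<gamma>, \<delta>))) (Rmat \<rho>) (Rmat (\<lambda>x. \<rho> (S x))) = tens DS DS (bt H \<epsilon> 1) (bt H \<epsilon> 1)"
    using sw_antipode_right[OF f] by (intro Rmat_inverse aut l) (simp add: r(1)[symmetric] r(2))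
  show "amult (talg (DT H (\<alpha>, \<beta>)) (DT H (\<gamma>, \<delta>))) (Rmat (\<lambda>x. \<rho> (S x))) (Rmat \<rho>) = tens DS DS (bt H \<epsilon> 1) (bt H \<epsilon> 1)"
    using sw_antipode_left[OF f] by (intro Rmat_inverse aut l) (simp add: r(1)[symmetric] r(2))
qed

text \<open>The four-leg form of \<open>sw_contract\<close>: the neighbouring legs c and v cancel
  and two legs survive.\<close>

lemma sw_contract2:
  assumes K: "\<And>b z. lin (\<lambda>a. K a b z)" "\<And>a z. lin (\<lambda>b. K a b z)" "\<And>a b. lin (\<lambda>z. K a b z)"
  shows "sw (\<lambda>u v. sw3 (\<lambda>a b c. K a b (v * S' c)) u) h = sw (\<lambda>a b. K a b 1) h"
proof -
  note L = K lin_intros lin_sw3 lin_sw3_arg lin_app[OF K(3)]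
  have "sw (\<lambda>u v. sw3 (\<lambda>a b c. K a b (v * S' c)) u) h =
      sw (\<lambda>a t. sw (\<lambda>s v. sw (\<lambda>b c. K a b (v * S' c)) s) t) h"
    unfolding sw3_def by (rule sw_coassoc) (intro L)+
  also have "\<dots> = sw (\<lambda>a t. K a t 1) h"
  proof (rule sw_cong)
    fix a t
    have "sw (\<lambda>s v. sw (\<lambda>b c. K a b (v * S' c)) s) t = sw (\<lambda>b s. sw (\<lambda>c v. K a b (v * S' c)) s) t"
      by (rule sw_coassoc) (intro L)+
    also have "\<dots> = sw (\<lambda>b s. \<epsilon> s * K a b 1) t"
      by (rule sw_cong, rule sw_antipode'_rightI[OF K(3) refl])
    also have "\<dots> = K a t 1"
      by (rule sw_counit_rightI[OF K(2) refl])
    finally show "sw (\<lambda>s v. sw (\<lambda>b c. K a b (v * S' c)) s) t = K a t 1" .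
  qed
  finally show ?thesis .
qed

text \<open>Both sides reduce to the expression \<open>?N\<close>, but the cancellation happens in
  different places: on the left among the legs of y, where the sum over \<open>E\<close> in R has
  split the point of evaluation, and on the right among the legs of h. The relations on the
  automorphisms make the two cancellations possible and their results equal.\<close>

lemma Rmat_comult:
  assumes aut: "\<alpha> \<in> Aut" "\<beta> \<in> Aut" "\<gamma> \<in> Aut" "\<delta> \<in> Aut"
    and aut2: "\<rho> \<in> Aut" "\<tau> \<in> Aut" "\<tau>1 \<in> Aut" "\<mu> \<in> Aut" "\<kappa> \<in> Aut"
    and c: "\<And>x. \<beta> (\<rho> x) = x" "\<And>x. \<rho> (\<delta> (\<tau> x)) = \<tau>1 x" "\<And>x. \<mu> x = \<alpha> (\<rho> x)"
      "\<And>x. \<kappa> (\<alpha> x) = \<tau> x" "\<And>x. \<gamma> (\<tau> x) = \<beta> (\<gamma> x)" "\<And>x. \<rho> (\<beta> x) = x"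
    and x: "x \<in> carr DS"
  shows "amult (talg (DT H (\<alpha>, \<beta>)) (DT H (\<gamma>, \<delta>))) (Rmat \<rho>) (comul \<gamma> \<tau> x) =
    amult (talg (DT H (\<alpha>, \<beta>)) (DT H (\<gamma>, \<delta>)))
      (tflip DS DS (tmap DS DS DS DS (conjg \<mu> \<kappa>) id (comul \<alpha> \<tau>1 x))) (Rmat \<rho>)"
proof -
  let ?m = "amult (talg (DT H (\<alpha>, \<beta>)) (DT H (\<gamma>, \<delta>)))"
  let ?A = "\<lambda>x. ?m (Rmat \<rho>) (comul \<gamma> \<tau> x)"
  let ?B = "\<lambda>x. ?m (tflip DS DS (tmap DS DS DS DS (conjg \<mu> \<kappa>) id (comul \<alpha> \<tau>1 x))) (Rmat \<rho>)"
  note l = aut[THEN hopf_autD(1)] and l2 = aut2[THEN hopf_autD(1)]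
  note T = talg_DT[OF aut] and ab = aut(1,2) and cd = aut(3,4)
  note MU = DT_mult_bt_unit[OF ab] DT_mult_bt_unit[OF cd]
  note DL = comul_linear[OF l(3) l2(2)] comul_linear[OF l(1) l2(3)]
  note P = conjg_linear[OF l2(4,5)]
  note B2 = tens_bilinear[OF ks_DS ks_DS]
  have fb: "bilinear_map DS DS DS2 (\<lambda>v w. tens DS DS w v)"
    using bilinear_mapD(1)[OF B2] bilinear_mapD(2)[OF B2] by (intro bilinear_mapI) auto
  have tb: "bilinear_map DS DS DS2 (\<lambda>v w. tens DS DS (conjg \<mu> \<kappa> v) w)"
    using bilinear_map_comp[OF B2 P linear_map_ident(1)] .
  have tl: "linear_map DS2 DS2 (tmap DS DS DS DS (conjg \<mu> \<kappa>) id)"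
    unfolding tmap_def using tlift_linear[OF tb] by simp
  have fl: "linear_map DS2 DS2 (tflip DS DS)"
    unfolding tflip_def by (rule tlift_linear[OF fb]) auto
  have linA: "linear_map DS DS2 ?A"
    by (rule linear_map_comp[OF DL(1) bilinear_mapD(2)[OF T(1) Rmat_carr]])
  have linB: "linear_map DS DS2 ?B"
    by (rule linear_map_comp[OF linear_map_comp[OF linear_map_comp[OF DL(2) tl] fl] bilinear_mapD(1)[OF T(1) Rmat_carr]])
  show ?thesis
  proof (rule DS_eqI[OF linA linB x])
    fix p h assume p: "lin p"
    note linp = lin_ract[OF p] lin_co lin_counit
    have linp\<mu>: "lin ((p \<leftharpoonup> d) \<circ> \<mu>)" for d by (simp add: lin_comp linp l2)
    show "?A (bt H p h) = ?B (bt H p h)"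
    proof (rule ev2_ext)
      show "?A (bt H p h) \<in> carr DS2" "?B (bt H p h) \<in> carr DS2"
        using linear_mapD(1)[OF linA] linear_mapD(1)[OF linB] p by auto
      fix x f y g assume f: "lin f" and g: "lin g"
      note L = lin_intros lin_app[OF p] lin_app[OF f] lin_app[OF g] lin_sw3 lin_sw3_arg
        l[THEN linH_app] l2[THEN linH_app]
      let ?N = "sw (\<lambda>h1 h2. sw (\<lambda>a b. p (x * \<alpha> (\<rho> a)) * f (\<rho> b * \<gamma> h1) * g (\<tau> h2)) y) h"

      let ?u = "\<lambda>e d h1 h2. tens DS DS (cross \<alpha> \<beta> \<epsilon> (\<rho> e) (p \<leftharpoonup> d) (\<gamma> h1)) (bt H (conv (co e) (co d)) (\<tau> h2))"
      have u: "?u e d h1 h2 \<in> carr DS2" for e d h1 h2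
        by (simp add: tens_carr linp lin_conv ab)
      have "?A (bt H p h) = (\<Sum>e\<in>E. \<Sum>d\<in>E. sw (\<lambda>h1 h2. ?u e d h1 h2) h)"
      proof -
        have Dc: "comul \<gamma> \<tau> (bt H p h) \<in> carr DS2" using linear_mapD(1)[OF DL(1)] p by simp
        have "?A (bt H p h) = (\<Sum>e\<in>E. ?m (tens DS DS (bt H \<epsilon> (\<rho> e)) (bt H (co e) 1)) (comul \<gamma> \<tau> (bt H p h)))"
          by (rule linear_Rmat[OF bilinear_mapD(1)[OF T(1) Dc]])
        also have "\<dots> = (\<Sum>e\<in>E. \<Sum>d\<in>E. sw (\<lambda>h1 h2. ?u e d h1 h2) h)"
          unfolding comul_bt[OF l(3) l2(2) p]
          by (rule sum.cong[OF refl])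
            (subst linear_of_sum_sw[OF ks_DS2 bilinear_mapD(2)[OF T(1)]],
              simp_all add: tens_carr linp T(2) DT_mult(2)[OF ab] MU)
        finally show ?thesis .
      qed
      hence "ev2 (?A (bt H p h)) x f y g = (\<Sum>e\<in>E. \<Sum>d\<in>E. sw (\<lambda>h1 h2. ev2 (?u e d h1 h2) x f y g) h)"
        by (simp add: linear_map_sum[OF ks_DS2 ev2_linear] u sw_carr kspace_closed(4)[OF ks_DS2]
            linear_of_sw[OF ks_DS2 ev2_linear])
      also have "\<dots> = (\<Sum>e\<in>E. \<Sum>d\<in>E. sw (\<lambda>h1 h2. (sw3 (\<lambda>a b c. p (d * (S' c * x * \<alpha> (\<rho> a))) *
          f (\<rho> b * \<gamma> h1)) e * g (\<tau> h2)) * conv (co e) (co d) y) h)"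
      proof -
        have "ev (cross \<alpha> \<beta> \<epsilon> (\<rho> e) (p \<leftharpoonup> d) (\<gamma> h1)) x f =
            sw3 (\<lambda>a b c. p (d * (S' c * x * \<alpha> (\<rho> a))) * f (\<rho> b * \<gamma> h1)) e" for e d h1
        proof -
          have "ev (cross \<alpha> \<beta> \<epsilon> (\<rho> e) (p \<leftharpoonup> d) (\<gamma> h1)) x f =
              sw3 (\<lambda>a b c. act \<alpha> \<beta> (p \<leftharpoonup> d) a c x * f (b * \<gamma> h1)) (\<rho> e)"
            by (simp add: ev_cross ab linp f conv_counit lin_act)
          also have "\<dots> = sw3 (\<lambda>a b c. act \<alpha> \<beta> (p \<leftharpoonup> d) (\<rho> a) (\<rho> c) x * f (\<rho> b * \<gamma> h1)) e"
            by (rule sw3_aut[OF aut2(1)]) (intro L act_linear ab linp)+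
          also have "\<dots> = sw3 (\<lambda>a b c. p (d * (S' c * x * \<alpha> (\<rho> a))) * f (\<rho> b * \<gamma> h1)) e"
            by (simp add: act_def ract_def c)
          finally show ?thesis .
        qed
        thus ?thesis by (simp add: linp lin_conv g ac_simps)
      qed
      also have "\<dots> = sw (\<lambda>h1 h2. sw (\<lambda>u v. sw3 (\<lambda>a b c. p (v * (S' c * x * \<alpha> (\<rho> a))) *
          f (\<rho> b * \<gamma> h1)) u * g (\<tau> h2)) y) h"
        unfolding sw_sum by (rule sw_cong, rule sum_conv_co) (intro L)+
      also have "\<dots> = ?N"
      proof (rule sw_cong)
        fix h1 h2
        \<comment> \<open>The summand is written as an explicit function of \<open>v * S' c\<close>,
          the shape that \<open>sw_contract2\<close> expects.\<close>
        have "sw (\<lambda>u v. sw3 (\<lambda>a b c. (\<lambda>a b z. p (z * x * \<alpha> (\<rho> a)) * f (\<rho> b * \<gamma> h1) * g (\<tau> h2)) a b (v * S' c)) u) y =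
            sw (\<lambda>a b. (\<lambda>a b z. p (z * x * \<alpha> (\<rho> a)) * f (\<rho> b * \<gamma> h1) * g (\<tau> h2)) a b 1) y"
          by (rule sw_contract2) (intro L)+
        thus "sw (\<lambda>u v. sw3 (\<lambda>a b c. p (v * (S' c * x * \<alpha> (\<rho> a))) * f (\<rho> b * \<gamma> h1)) u * g (\<tau> h2)) y =
            sw (\<lambda>a b. p (x * \<alpha> (\<rho> a)) * f (\<rho> b * \<gamma> h1) * g (\<tau> h2)) y"
          by (simp add: sw3_times mult.assoc)
      qed
      finally have A: "ev2 (?A (bt H p h)) x f y g = ?N" .

      let ?v = "\<lambda>d e h1 h2. tens DS DS (bt H (co d) (\<tau>1 h2 * \<rho> e))
        (cross \<gamma> \<delta> ((p \<leftharpoonup> d) \<circ> \<mu>) (\<tau> h1) (co e) 1)"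
      have v: "?v d e h1 h2 \<in> carr DS2" for d e h1 h2
        by (simp add: tens_carr linp linp\<mu> cd)
      have "?B (bt H p h) = (\<Sum>d\<in>E. sw (\<lambda>h1 h2. \<Sum>e\<in>E. ?v d e h1 h2) h)"
      proof -
        let ?w = "\<lambda>d h1 h2. tens DS DS (bt H (co d) (\<tau>1 h2)) (bt H ((p \<leftharpoonup> d) \<circ> \<mu>) (\<tau> h1))"
        have "tmap DS DS DS DS (conjg \<mu> \<kappa>) id (comul \<alpha> \<tau>1 (bt H p h)) =
            (\<Sum>d\<in>E. sw (\<lambda>h1 h2. tens DS DS (bt H ((p \<leftharpoonup> d) \<circ> \<mu>) (\<tau> h1)) (bt H (co d) (\<tau>1 h2))) h)"
          unfolding tmap_def
          by (subst tlift_comul[OF l(1) l2(3) p ks_DS2]) (simp_all add: tb conjg_bt l2 linp c)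
        hence "tflip DS DS (tmap DS DS DS DS (conjg \<mu> \<kappa>) id (comul \<alpha> \<tau>1 (bt H p h))) = (\<Sum>d\<in>E. sw (\<lambda>h1 h2. ?w d h1 h2) h)"
          by (simp add: linear_of_sum_sw[OF ks_DS2 fl] tens_carr linp linp\<mu>)
            (simp add: tflip_def tlift_tens[OF fb ks_DS2] linp linp\<mu>)
        hence "?B (bt H p h) = (\<Sum>d\<in>E. sw (\<lambda>h1 h2. ?m (?w d h1 h2) (Rmat \<rho>)) h)"
          by (simp add: linear_of_sum_sw[OF ks_DS2 bilinear_mapD(1)[OF T(1) Rmat_carr]] tens_carr linp linp\<mu>)
        moreover have "?m (?w d h1 h2) (Rmat \<rho>) = (\<Sum>e\<in>E. ?v d e h1 h2)" for d h1 h2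
          by (subst linear_Rmat[OF bilinear_mapD(2)[OF T(1)]])
            (simp_all add: tens_carr linp linp\<mu> T(2) DT_mult(2)[OF cd] MU)
        ultimately show ?thesis by simp
      qed
      hence "ev2 (?B (bt H p h)) x f y g = (\<Sum>d\<in>E. sw (\<lambda>h1 h2. \<Sum>e\<in>E. ev2 (?v d e h1 h2) x f y g) h)"
        by (simp add: linear_of_sum_sw[OF ks_DS2 ev2_linear] linear_map_sum[OF ks_DS2 ev2_linear] v
            kspace_closed(4)[OF ks_DS2])
      also have "\<dots> = (\<Sum>d\<in>E. sw (\<lambda>h1 h2. \<Sum>e\<in>E. sw3 (\<lambda>a b c. sw (\<lambda>y1 y2.
          p (d * \<mu> y1) * co d x * (f (\<tau>1 h2 * \<rho> e) * co e (S' (\<delta> (\<tau> c)) * y2 * \<gamma> (\<tau> a))) * g (\<tau> b)) y) h1) h)"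
      proof -
        have "ev (cross \<gamma> \<delta> ((p \<leftharpoonup> d) \<circ> \<mu>) (\<tau> h1) (co e) 1) y g = sw3 (\<lambda>a b c. sw (\<lambda>y1 y2.
          p (d * \<mu> y1) * co e (S' (\<delta> (\<tau> c)) * y2 * \<gamma> (\<tau> a)) * g (\<tau> b)) y) h1" for d e h1
        proof -
          have "ev (cross \<gamma> \<delta> ((p \<leftharpoonup> d) \<circ> \<mu>) (\<tau> h1) (co e) 1) y g =
              sw3 (\<lambda>a b c. conv ((p \<leftharpoonup> d) \<circ> \<mu>) (act \<gamma> \<delta> (co e) a c) y * g b) (\<tau> h1)"
            by (simp add: ev_cross cd linp linp\<mu> g)
          also have "\<dots> = sw3 (\<lambda>a b c. conv ((p \<leftharpoonup> d) \<circ> \<mu>) (act \<gamma> \<delta> (co e) (\<tau> a) (\<tau> c)) y * g (\<tau> b)) h1"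
            by (rule sw3_aut[OF aut2(2)]) (intro L conv_linear act_linear cd linp g)+
          finally show ?thesis
            by (simp add: conv_def act_def ract_def sw_times)
        qed
        thus ?thesis by (simp add: linp f g sw3_times sw_times ac_simps)
      qed
      also have "\<dots> = sw (\<lambda>h1 h2. sw3 (\<lambda>a b c. sw (\<lambda>y1 y2. \<Sum>d\<in>E. \<Sum>e\<in>E.
          p (d * \<mu> y1) * co d x * (f (\<tau>1 h2 * \<rho> e) * co e (S' (\<delta> (\<tau> c)) * y2 * \<gamma> (\<tau> a))) * g (\<tau> b)) y) h1) h"
        by (simp only: sw_sum sw3_sum)
      \<comment> \<open>The dual bases put x back into \<open>p\<close> and the twisted argument
        back into \<open>f\<close>. As \<tau>1 is the composite of \<rho>, \<delta> and \<tau>, the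
        legs h2 and c meet as \<open>h2 * S' c\<close>.\<close>
      also have "\<dots> = sw (\<lambda>h1 h2. sw3 (\<lambda>a b c. sw (\<lambda>y1 y2.
          p (x * \<mu> y1) * f (\<rho> (\<delta> (\<tau> (h2 * S' c)) * y2 * \<gamma> (\<tau> a))) * g (\<tau> b)) y) h1) h"
      proof -
        have "(\<Sum>d\<in>E. \<Sum>e\<in>E. p (d * \<mu> y1) * co d x * (f (\<tau>1 h2 * \<rho> e) * co e (S' (\<delta> (\<tau> c)) * y2 * \<gamma> (\<tau> a))) * g (\<tau> b)) =
          p (x * \<mu> y1) * f (\<rho> (\<delta> (\<tau> (h2 * S' c)) * y2 * \<gamma> (\<tau> a))) * g (\<tau> b)" for y1 y2 h2 a b c
        proof -
          have 1: "(\<Sum>d\<in>E. p (d * \<mu> y1) * co d x) = p (x * \<mu> y1)"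
            by (rule lin_expand') (intro L)
          have 2: "(\<Sum>e\<in>E. f (\<tau>1 h2 * \<rho> e) * co e z) = f (\<tau>1 h2 * \<rho> z)" for z
            by (rule lin_expand') (intro L)
          show ?thesis
            unfolding sum_distrib_right[symmetric] sum_product[symmetric] 1 2
            by (simp add: c(2)[symmetric] hopf_autD(3)[OF aut2(1)] hopf_autD(3)[OF aut2(2)]
                hopf_autD(3)[OF aut(4)] hopf_autD(7)[OF aut2(2)] hopf_autD(7)[OF aut(4)] mult.assoc)
        qed
        thus ?thesis by simp
      qed
      also have "\<dots> = sw (\<lambda>a b. (\<lambda>a b z. sw (\<lambda>y1 y2.
          p (x * \<mu> y1) * f (\<rho> (\<delta> (\<tau> z) * y2 * \<gamma> (\<tau> a))) * g (\<tau> b)) y) a b 1) h"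
        by (rule sw_contract2) (intro L)+
      also have "\<dots> = ?N"
        by (simp add: hopf_autD(4)[OF aut2(2)] hopf_autD(4)[OF aut(4)] c(3,5,6) hopf_autD(3)[OF aut2(1)])
      finally show "ev2 (?A (bt H p h)) x f y g = ev2 (?B (bt H p h)) x f y g"
        using A by simp
    qed
  qed
qed

section \<open>R-matrix identities in threefold tensor products\<close>

lemma talg3_DT:
  assumes aut: "\<alpha> \<in> Aut" "\<beta> \<in> Aut" "\<gamma> \<in> Aut" "\<delta> \<in> Aut"
    "\<mu> \<in> Aut" "\<nu> \<in> Aut"
  defines "m \<equiv> amult (talg (DT H (\<alpha>, \<beta>)) (talg (DT H (\<gamma>, \<delta>)) (DT H (\<mu>, \<nu>))))"
  shows "bilinear_map DS3 DS3 DS3 m"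
    and "a \<in> carr DS \<Longrightarrow> b \<in> carr DS \<Longrightarrow> c \<in> carr DS \<Longrightarrow> a' \<in> carr DS \<Longrightarrow> b' \<in> carr DS \<Longrightarrow> c' \<in> carr DS \<Longrightarrow>
      m (tens DS DS2 a (tens DS DS b c)) (tens DS DS2 a' (tens DS DS b' c')) =
      tens DS DS2 (amult (DT H (\<alpha>, \<beta>)) a a')
        (tens DS DS (amult (DT H (\<gamma>, \<delta>)) b b') (amult (DT H (\<mu>, \<nu>)) c c'))"
proof -
  let ?BC = "talg (DT H (\<gamma>, \<delta>)) (DT H (\<mu>, \<nu>))"
  note T = talg_DT[OF aut(3-6)]
  have ks: "is_kspace ?BC" by (subst space_congs(1)[of _ DS2]) auto
  have b: "bilinear_map ?BC ?BC ?BC (amult ?BC)"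
    using T(1) by (simp add: bilinear_map_def linear_map_def)
  have t: "tens (DT H (\<alpha>, \<beta>)) ?BC = tens DS DS2" "tensor (DT H (\<alpha>, \<beta>)) ?BC = DS3"
    by (rule tens_congs; simp)+
  note T3 = talg_mult[of "DT H (\<alpha>, \<beta>)" ?BC, OF _ _ ks b, simplified t, simplified, OF DT_mult(1)[OF aut(1,2)]]
  show "bilinear_map DS3 DS3 DS3 m"
    using T3(1) unfolding m_def by (simp add: bilinear_map_def linear_map_def t)
  show "m (tens DS DS2 a (tens DS DS b c)) (tens DS DS2 a' (tens DS DS b' c')) =
      tens DS DS2 (amult (DT H (\<alpha>, \<beta>)) a a')
        (tens DS DS (amult (DT H (\<gamma>, \<delta>)) b b') (amult (DT H (\<mu>, \<nu>)) c c'))"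
    if "a \<in> carr DS" "b \<in> carr DS" "c \<in> carr DS" "a' \<in> carr DS" "b' \<in> carr DS" "c' \<in> carr DS"
    unfolding m_def using T3(2) that by (simp add: tens_carr T(2))
qed

lemma legs_DT [simp]:
  "leg12 (DT H a) (DT H b) (DT H c) = tlift DS DS (\<lambda>x y. tens DS DS2 x (tens DS DS y (bt H \<epsilon> 1)))"
  "leg13 (DT H a) (DT H b) (DT H c) = tlift DS DS (\<lambda>x z. tens DS DS2 x (tens DS DS (bt H \<epsilon> 1) z))"
  "leg23 (DT H a) (DT H b) (DT H c) = tlift DS DS (\<lambda>y z. tens DS DS2 (bt H \<epsilon> 1) (tens DS DS y z))"
  by (simp_all add: leg12_def leg13_def leg23_def fun_eq_iff)

lemma legs_bilinear:
  "bilinear_map DS DS DS3 (\<lambda>x y. tens DS DS2 x (tens DS DS y (bt H \<epsilon> 1)))"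
  "bilinear_map DS DS DS3 (\<lambda>x z. tens DS DS2 x (tens DS DS (bt H \<epsilon> 1) z))"
  "bilinear_map DS DS DS3 (\<lambda>y z. tens DS DS2 (bt H \<epsilon> 1) (tens DS DS y z))"
proof -
  note B2 = tens_bilinear[OF ks_DS ks_DS] and B3 = tens_bilinear[OF ks_DS ks_DS2]
  show "bilinear_map DS DS DS3 (\<lambda>x y. tens DS DS2 x (tens DS DS y (bt H \<epsilon> 1)))"
    by (rule bilinear_map_comp[OF B3 linear_map_ident(1) bilinear_mapD(1)[OF B2]]) simp
  show "bilinear_map DS DS DS3 (\<lambda>x z. tens DS DS2 x (tens DS DS (bt H \<epsilon> 1) z))"
    by (rule bilinear_map_comp[OF B3 linear_map_ident(1) bilinear_mapD(2)[OF B2]]) simp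
  show "bilinear_map DS DS DS3 (\<lambda>y z. tens DS DS2 (bt H \<epsilon> 1) (tens DS DS y z))"
    by (rule bilinear_map_post[OF B2 bilinear_mapD(2)[OF B3]]) simp
qed

text \<open>Both sides evaluate to \<epsilon>(x) g(1) k(1) f(\<rho>(z y)): on the left because the
  comultiplication reverses the order of the points, on the right because the factor in legs 1 and 3
  stands before the one in legs 1 and 2. Multiplicativity of \<rho> joins them.\<close>

lemma Rmat_comult_right:
  assumes aut: "\<alpha> \<in> Aut" "\<beta> \<in> Aut" "\<alpha>' \<in> Aut" "\<beta>' \<in> Aut"
    "\<gamma> \<in> Aut" "\<delta> \<in> Aut" "\<tau> \<in> Aut" "\<rho> \<in> Aut"
  shows "tmap DS DS DS DS2 id (comul \<gamma> \<tau>) (Rmat \<rho>) =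
    amult (talg (DT H (\<alpha>, \<beta>)) (talg (DT H (\<alpha>', \<beta>')) (DT H (\<gamma>, \<delta>))))
      (tlift DS DS (\<lambda>x z. tens DS DS2 x (tens DS DS (bt H \<epsilon> 1) z)) (Rmat \<rho>))
      (tlift DS DS (\<lambda>x y. tens DS DS2 x (tens DS DS y (bt H \<epsilon> 1))) (Rmat \<rho>))"
    (is "?L = amult ?A ?R13 ?R12")
proof (rule ev3_ext)
  let ?m = "amult ?A"
  note T = talg3_DT[OF aut(1-6)] and l = aut[THEN hopf_autD(1)]
  note D = comul_linear[OF l(5,7)]
  note tm = tmap_apply[OF ks_DS ks_DS ks_DS ks_DS2 linear_map_ident(2) D Rmat_carr]
  have legs: "?R13 \<in> carr DS3" "?R12 \<in> carr DS3"
    by (intro tlift_carr[OF ks_DS ks_DS ks_DS3(1)] legs_bilinear Rmat_carr)+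
  show "?L \<in> carr DS3" by (rule tm(1))
  show "?m ?R13 ?R12 \<in> carr DS3"
    using bilinear_mapD(3)[OF T(1)] legs by blast
  fix x f y g z k assume f: "lin f" and g: "lin g" and k: "lin k"
  note L = lin_intros lin_app[OF f] l[THEN linH_app]
  have "ev3 ?L x f y g z k = (\<Sum>e\<in>E. \<epsilon> x * f (\<rho> e) * (co e (z * y) * (g 1 * k 1)))"
  proof -
    have "ev3 ?L x f y g z k = Rmat \<rho> (\<lambda>v w. ev v x f * ev2 (comul \<gamma> \<tau> w) y g z k)"
      unfolding ev3_def by (subst tm(2)) (simp_all add: bilinear_map_ground_mult ev_linear ev2_linear)
    also have "\<dots> = (\<Sum>e\<in>E. ev (bt H \<epsilon> (\<rho> e)) x f * ev2 (comul \<gamma> \<tau> (bt H (co e) 1)) y g z k)"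
      by (rule Rmat_apply) (intro bilinear_map_ground_mult ev_linear linear_map_comp[OF D ev2_linear])
    finally show ?thesis
      by (simp add: ev2_comul l f g k lin_counit lin_co lin_conv lin_comp conv_one hopf_autD(4)[OF aut(5)]
          hopf_autD(4)[OF aut(7)])
  qed
  also have "\<dots> = (\<Sum>e\<in>E. (\<epsilon> x * (g 1 * k 1) * f (\<rho> e)) * co e (z * y))"
    by (simp add: ac_simps)
  also have "\<dots> = \<epsilon> x * (g 1 * k 1) * f (\<rho> (z * y))"
    by (rule lin_expand') (intro L)
  also have "\<dots> = (\<Sum>d\<in>E. (\<epsilon> x * (g 1 * k 1) * f (\<rho> z * \<rho> d)) * co d y)"
    unfolding hopf_autD(3)[OF aut(8)] by (rule lin_expand'[symmetric]) (intro L)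
  also have "\<dots> = (\<Sum>d\<in>E. (\<Sum>e\<in>E. (\<epsilon> x * (g 1 * k 1) * f (\<rho> e * \<rho> d)) * co e z) * co d y)"
  proof -
    have "(\<Sum>e\<in>E. (\<epsilon> x * (g 1 * k 1) * f (\<rho> e * \<rho> d)) * co e z) = \<epsilon> x * (g 1 * k 1) * f (\<rho> z * \<rho> d)" for d
      by (rule lin_expand') (intro L)
    thus ?thesis by simp
  qed
  also have "\<dots> = (\<Sum>e\<in>E. \<Sum>d\<in>E. \<epsilon> x * f (\<rho> e * \<rho> d) * (co d y * g 1 * (co e z * k 1)))"
    unfolding sum_distrib_right by (subst sum.swap) (simp add: ac_simps)
  also have "\<dots> = ev3 (?m ?R13 ?R12) x f y g z k"
  proof -
    have "?m ?R13 ?R12 = (\<Sum>e\<in>E. \<Sum>d\<in>E. tens DS DS2 (bt H \<epsilon> (\<rho> e * \<rho> d))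
        (tens DS DS (bt H (co d) 1) (bt H (co e) 1)))"
      unfolding tlift_Rmat[OF legs_bilinear(2) ks_DS3(1)] tlift_Rmat[OF legs_bilinear(1) ks_DS3(1)]
      by (subst bilinear_map_sum_sum[OF ks_DS3(1) ks_DS3(1) T(1)])
        (simp_all add: tens_carr T(2) DT_mult_bt_unit aut lin_counit lin_co conv_counit)
    thus ?thesis
      by (simp add: linear_map_sum[OF ks_DS3(1) ev3_linear] tens_carr kspace_closed(4)[OF ks_DS3(1)]
          lin_counit lin_co f g k)
  qed
  finally show "ev3 ?L x f y g z k = ev3 (?m ?R13 ?R12) x f y g z k" .
qed

text \<open>Both sides evaluate to \<epsilon>(x) \<epsilon>(y) k(1) times the sum of
  \<open>f (\<rho> (\<mu> z1)) * g (\<sigma> z2)\<close>. On the right \<mu> stems from the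
  conjugation in the third factor; on the left it appears through the first relation, once the
  coproduct has passed through \<rho>'.\<close>

lemma Rmat_comult_left:
  assumes aut: "\<alpha> \<in> Aut" "\<beta> \<in> Aut" "\<gamma> \<in> Aut" "\<delta> \<in> Aut"
    "\<alpha>' \<in> Aut" "\<beta>' \<in> Aut" "\<tau> \<in> Aut" "\<rho> \<in> Aut" "\<rho>' \<in> Aut"
    "\<sigma> \<in> Aut" "\<mu> \<in> Aut" "\<kappa> \<in> Aut"
    and c: "\<And>x. \<gamma> (\<rho>' x) = \<rho> (\<mu> x)" "\<And>x. \<tau> (\<rho>' x) = \<sigma> x"
  shows "tassoc DS DS DS (tmap DS DS DS2 DS (comul \<gamma> \<tau>) id (Rmat \<rho>')) =
    amult (talg (DT H (\<alpha>, \<beta>)) (talg (DT H (\<gamma>, \<delta>)) (DT H (\<alpha>', \<beta>'))))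
      (tlift DS DS (\<lambda>x z. tens DS DS2 x (tens DS DS (bt H \<epsilon> 1) z))
        (tmap DS DS DS DS id (conjg \<mu> \<kappa>) (Rmat \<rho>)))
      (tlift DS DS (\<lambda>y z. tens DS DS2 (bt H \<epsilon> 1) (tens DS DS y z)) (Rmat \<sigma>))"
    (is "?L = amult ?A ?R13 ?R23")
proof (rule ev3_ext)
  let ?m = "amult ?A"
  note T = talg3_DT[OF aut(1-6)] and l = aut[THEN hopf_autD(1)]
  note D = comul_linear[OF l(3,7)] and P = conjg_linear[OF l(11,12)]
  note tm = tmap_apply[OF ks_DS ks_DS ks_DS2 ks_DS D linear_map_ident(2) Rmat_carr]
  note tm' = tmap_apply(1)[OF ks_DS ks_DS ks_DS ks_DS linear_map_ident(2) P Rmat_carr]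
  have legs: "?R13 \<in> carr DS3" "?R23 \<in> carr DS3"
    by (intro tlift_carr[OF ks_DS ks_DS ks_DS3(1)] legs_bilinear Rmat_carr tm')+
  show "?L \<in> carr DS3" by (rule tassoc_DS(1)[OF tm(1)])
  show "?m ?R13 ?R23 \<in> carr DS3"
    using bilinear_mapD(3)[OF T(1)] legs by blast
  fix x f y g z k assume f: "lin f" and g: "lin g" and k: "lin k"
  note L = lin_intros lin_app[OF f] lin_app[OF g] l[THEN linH_app]
  have E: "conv (f \<circ> \<gamma>) (g \<circ> \<tau>) (\<rho>' z) = sw (\<lambda>a b. f (\<rho> (\<mu> a)) * g (\<sigma> b)) z"
    unfolding conv_def by (subst sw_aut[OF aut(9)]) (auto intro!: lin_times lin_app[OF f] lin_app[OF g] l simp: c)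
  have "ev3 ?L x f y g z k = (\<Sum>e\<in>E. (\<epsilon> x * \<epsilon> y * k 1 * conv (f \<circ> \<gamma>) (g \<circ> \<tau>) (\<rho>' e)) * co e z)"
  proof -
    have "ev3 ?L x f y g z k = Rmat \<rho>' (\<lambda>v w. ev2 (comul \<gamma> \<tau> v) x f y g * ev w z k)"
      unfolding tassoc_DS(2)[OF tm(1)] by (subst tm(2)) (simp_all add: bilinear_map_ground_mult ev_linear ev2_linear)
    also have "\<dots> = (\<Sum>e\<in>E. ev2 (comul \<gamma> \<tau> (bt H \<epsilon> (\<rho>' e))) x f y g * ev (bt H (co e) 1) z k)"
      by (rule Rmat_apply) (intro bilinear_map_ground_mult ev_linear linear_map_comp[OF D ev2_linear])
    finally show ?thesis
      by (simp add: ev2_comul l f g k lin_counit lin_co lin_conv lin_comp ac_simps)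
  qed
  also have "\<dots> = \<epsilon> x * \<epsilon> y * k 1 * conv (f \<circ> \<gamma>) (g \<circ> \<tau>) (\<rho>' z)"
    by (rule lin_expand') (intro lin_times lin_app[OF lin_conv] lin_comp f g l)
  also have "\<dots> =
      (\<Sum>e\<in>E. \<Sum>d\<in>E. \<epsilon> x * f (\<rho> e) * (\<epsilon> y * g (\<sigma> d) * (conv (co e \<circ> \<mu>) (co d) z * k 1)))"
  proof -
    have "(\<Sum>e\<in>E. \<Sum>d\<in>E. (f (\<rho> e) * co e (\<mu> a)) * (g (\<sigma> d) * co d b)) = f (\<rho> (\<mu> a)) * g (\<sigma> b)" for a b
    proof -
      have "(\<Sum>e\<in>E. f (\<rho> e) * co e w) = f (\<rho> w)" "(\<Sum>d\<in>E. g (\<sigma> d) * co d w) = g (\<sigma> w)" for w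
        by (rule lin_expand'; intro L)+
      thus ?thesis by (simp add: sum_product[symmetric])
    qed
    hence "sw (\<lambda>a b. f (\<rho> (\<mu> a)) * g (\<sigma> b)) z =
        (\<Sum>e\<in>E. \<Sum>d\<in>E. f (\<rho> e) * g (\<sigma> d) * conv (co e \<circ> \<mu>) (co d) z)"
      unfolding conv_def sw_times sw_sum by (simp add: ac_simps)
    thus ?thesis unfolding E by (simp add: sum_distrib_left ac_simps)
  qed
  also have "\<dots> = ev3 (?m ?R13 ?R23) x f y g z k"
  proof -
    have lm: "lin (co e \<circ> \<mu>)" for e by (simp add: lin_comp lin_co l)
    have bm: "bilinear_map DS DS DS2 (\<lambda>v w. tens DS DS (id v) (conjg \<mu> \<kappa> w))"
      by (rule bilinear_map_comp[OF tens_bilinear[OF ks_DS ks_DS] linear_map_ident(2) P])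
    have "tmap DS DS DS DS id (conjg \<mu> \<kappa>) (Rmat \<rho>) = (\<Sum>e\<in>E. tens DS DS (bt H \<epsilon> (\<rho> e)) (bt H (co e \<circ> \<mu>) 1))"
      unfolding tmap_def
      by (subst tlift_Rmat[OF bm ks_DS2]) (simp add: conjg_bt l lin_co hopf_autD(4)[OF aut(12)])
    hence "?R13 = (\<Sum>e\<in>E. tens DS DS2 (bt H \<epsilon> (\<rho> e)) (tens DS DS (bt H \<epsilon> 1) (bt H (co e \<circ> \<mu>) 1)))"
      by (simp add: linear_map_sum[OF ks_DS2 tlift_linear[OF legs_bilinear(2) ks_DS ks_DS ks_DS3(1)]]
          tens_carr lm tlift_tens[OF legs_bilinear(2) ks_DS3(1)])
    hence "?m ?R13 ?R23 = (\<Sum>e\<in>E. \<Sum>d\<in>E. tens DS DS2 (bt H \<epsilon> (\<rho> e))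
        (tens DS DS (bt H \<epsilon> (\<sigma> d)) (bt H (conv (co e \<circ> \<mu>) (co d)) 1)))"
      unfolding tlift_Rmat[OF legs_bilinear(3) ks_DS3(1)]
      by (simp add: bilinear_map_sum_sum[OF ks_DS3(1) ks_DS3(1) T(1)]
          tens_carr T(2) DT_mult_bt_unit aut lin_counit lin_co conv_counit lm)
    thus ?thesis
      by (simp add: linear_map_sum[OF ks_DS3(1) ev3_linear] tens_carr kspace_closed(4)[OF ks_DS3(1)]
          lin_counit lin_co lin_conv lm f g k)
  qed
  finally show "ev3 ?L x f y g z k = ev3 (?m ?R13 ?R23) x f y g z k" .
qed

text \<open>R is determined by its values \<epsilon>(x) g(1) f(\<rho> y). Conjugation moves the
  points by \<mu> and composes the functionals with \<kappa> and \<kappa>'; automorphisms preserve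
  \<epsilon> and 1, so only \<rho> changes, into the composite of \<kappa>, \<rho> and
  \<mu>.\<close>

lemma Rmat_conj:
  assumes aut: "\<mu> \<in> Aut" "\<kappa> \<in> Aut" "\<kappa>' \<in> Aut" "\<rho> \<in> Aut" "\<rho>' \<in> Aut"
    and c: "\<And>x. \<kappa> (\<rho> (\<mu> x)) = \<rho>' x"
  shows "tmap DS DS DS DS (conjg \<mu> \<kappa>) (conjg \<mu> \<kappa>') (Rmat \<rho>) = Rmat \<rho>'"
proof -
  note l = aut[THEN hopf_autD(1)]
  note P = conjg_linear[OF l(1,2)] conjg_linear[OF l(1,3)]
  note tm = tmap_apply[OF ks_DS ks_DS ks_DS ks_DS P Rmat_carr]
  have Rmat: "ev2 (Rmat \<sigma>) x f y g = \<epsilon> x * g 1 * f (\<sigma> y)" if "lin f" "lin g" "linH \<sigma>" for \<sigma> x f y g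
  proof -
    have "ev2 (Rmat \<sigma>) x f y g = (\<Sum>e\<in>E. (\<epsilon> x * g 1 * f (\<sigma> e)) * co e y)"
      unfolding ev2_def using that
      by (subst Rmat_apply) (simp_all add: bilinear_map_ground_mult ev_linear lin_counit lin_co ac_simps)
    also have "\<dots> = \<epsilon> x * g 1 * f (\<sigma> y)"
      by (rule lin_expand') (intro lin_times lin_app[OF that(1)] that(3))
    finally show ?thesis .
  qed
  show ?thesis
  proof (rule ev2_ext[OF tm(1) Rmat_carr])
    fix x f y g assume f: "lin f" and g: "lin g"
    have "ev2 (tmap DS DS DS DS (conjg \<mu> \<kappa>) (conjg \<mu> \<kappa>') (Rmat \<rho>)) x f y g =
        Rmat \<rho> (\<lambda>a b. ev (conjg \<mu> \<kappa> a) x f * ev (conjg \<mu> \<kappa>' b) y g)"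
      unfolding ev2_def by (rule tm(2)) (intro bilinear_map_ground_mult ev_linear)
    also have "\<dots> = ev2 (Rmat \<rho>) (\<mu> x) (f \<circ> \<kappa>) (\<mu> y) (g \<circ> \<kappa>')"
      unfolding ev2_def
      by (rule tensor_apply_cong[OF Rmat_carr])
        (auto intro!: bilinear_map_ground_mult ev_linear linear_map_comp[OF P(1) ev_linear]
          linear_map_comp[OF P(2) ev_linear] simp: ev_conjg l f g)
    also have "\<dots> = ev2 (Rmat \<rho>') x f y g"
      by (simp add: Rmat lin_comp f g l c hopf_autD(5)[OF aut(1)] hopf_autD(4)[OF aut(3)])
    finally show "ev2 (tmap DS DS DS DS (conjg \<mu> \<kappa>) (conjg \<mu> \<kappa>') (Rmat \<rho>)) x f y g = ev2 (Rmat \<rho>') x f y g" .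
  qed
qed

section \<open>The quasitriangular T-coalgebra\<close>

lemma comul_alg_hom:
  assumes aut: "\<alpha> \<in> Aut" "\<beta> \<in> Aut" "\<gamma> \<in> Aut" "\<delta> \<in> Aut"
    and \<tau>: "\<tau> \<in> Aut" "\<And>x. \<gamma> (\<tau> x) = \<beta> (\<gamma> x)"
  shows "alg_hom (DT H (\<alpha> \<circ> \<gamma>, \<delta> \<circ> \<tau>)) (talg (DT H (\<alpha>, \<beta>)) (DT H (\<gamma>, \<delta>))) (comul \<gamma> \<tau>)"
proof -
  note l = hopf_autD(1)[OF aut(3)] hopf_autD(1)[OF \<tau>(1)]
  note D = comul_linear[OF l]
  note M = DT_mult_linear[OF hopf_aut_comp[OF aut(1,3)] hopf_aut_comp[OF aut(4) \<tau>(1)]]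
  note T = talg_DT(1)[OF aut]
  let ?m = "amult (DT H (\<alpha> \<circ> \<gamma>, \<delta> \<circ> \<tau>))" and ?n = "amult (talg (DT H (\<alpha>, \<beta>)) (DT H (\<gamma>, \<delta>)))"
  have c: "comul \<gamma> \<tau> t \<in> carr DS2" if "t \<in> carr DS" for t
    by (rule linear_mapD(1)[OF D that])
  have 1: "comul \<gamma> \<tau> (?m (bt H p h) y) = ?n (comul \<gamma> \<tau> (bt H p h)) (comul \<gamma> \<tau> y)"
    if p: "lin p" and y: "y \<in> carr DS" for p h y
    by (rule DS_eqI[OF linear_map_comp[OF M(1) D] linear_map_comp[OF D bilinear_mapD(2)[OF T]] y])
      (simp_all add: p c comul_mult_bt[OF aut \<tau>])
  have 2: "comul \<gamma> \<tau> (?m x y) = ?n (comul \<gamma> \<tau> x) (comul \<gamma> \<tau> y)" if x: "x \<in> carr DS" and y: "y \<in> carr DS" for x y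
    by (rule DS_eqI[OF linear_map_comp[OF M(2) D] linear_map_comp[OF D bilinear_mapD(1)[OF T]] x])
      (simp_all add: y c 1)
  have "comul \<gamma> \<tau> (bt H \<epsilon> 1) = tens DS DS (bt H \<epsilon> 1) (bt H \<epsilon> 1)"
    by (rule ev2_ext) (simp_all add: c tens_carr ev2_comul l lin_counit lin_conv lin_comp conv_one
        hopf_autD(4)[OF aut(3)] hopf_autD(4)[OF \<tau>(1)])
  thus ?thesis
    unfolding alg_hom_def using D 2 by (simp add: linear_map_def)
qed

text \<open>The variants with a trailing \<open>f\<close> cancel inside compositions that
  \<open>comp_assoc\<close> has nested to the right.\<close>

lemma aut_cancel:
  assumes "\<alpha> \<in> Aut"
  shows "\<alpha> \<circ> inverse_fun \<alpha> = id" "inverse_fun \<alpha> \<circ> \<alpha> = id"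
    "\<alpha> \<circ> (inverse_fun \<alpha> \<circ> f) = f" "inverse_fun \<alpha> \<circ> (\<alpha> \<circ> f) = f"
  by (simp_all add: fun_eq_iff hopf_autD(8,9)[OF assms])

lemmas aut_simps = inverse_aut comp_assoc aut_cancel

lemma DT_antipode_eq:
  assumes "\<alpha> \<in> Aut" "\<beta> \<in> Aut"
  shows "DT_antipode H (\<alpha>, \<beta>) = antip (inverse_fun \<alpha>) (\<alpha> \<circ> inverse_fun \<beta> \<circ> inverse_fun \<alpha>) (\<alpha> \<circ> \<beta>)"
  using assms by (simp add: DT_antipode_def antip_def)

lemma T_coalgebra_DT:
  "T_coalgebra (aut_group H) (DT H) (DT_comult H) (DT_counit H) (DT_antipode H) (DT_conj H)"
proof (intro T_coalgebra.intro T_coalgebra_axioms.intro group_aut)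
  let ?G = "aut_group H"
  have pt: "f x = g x" if "f = g" for f g :: "'h \<Rightarrow> 'h" and x using that by simp
  {
    fix a assume "a \<in> carrier ?G"
    thus "kalgebra (DT H a)" by (auto intro: kalgebra_DT)
  next
    fix a b assume "a \<in> carrier ?G" "b \<in> carrier ?G"
    then obtain \<alpha> \<beta> \<gamma> \<delta> where ab: "a = (\<alpha>, \<beta>)" "b = (\<gamma>, \<delta>)"
      and aut: "\<alpha> \<in> Aut" "\<beta> \<in> Aut" "\<gamma> \<in> Aut" "\<delta> \<in> Aut" by auto
    let ?t = "inverse_fun \<gamma> \<circ> \<beta> \<circ> \<gamma>"
    have "alg_hom (DT H (\<alpha> \<circ> \<gamma>, \<delta> \<circ> ?t)) (talg (DT H (\<alpha>, \<beta>)) (DT H (\<gamma>, \<delta>))) (comul \<gamma> ?t)"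
      by (rule comul_alg_hom) (simp_all add: aut hopf_autD(8)[OF aut(3)])
    thus "alg_hom (DT H (a \<otimes>\<^bsub>?G\<^esub> b)) (talg (DT H a) (DT H b)) (DT_comult H a b)"
      by (simp add: ab DT_comult_eq comp_assoc)
  next
    show "alg_hom (DT H \<one>\<^bsub>?G\<^esub>) ground (DT_counit H)"
      using counit_alg_hom by simp
  next
    fix a b c x assume "a \<in> carrier ?G" "b \<in> carrier ?G" "c \<in> carrier ?G"
      and x: "x \<in> carr (DT H (a \<otimes>\<^bsub>?G\<^esub> b \<otimes>\<^bsub>?G\<^esub> c))"
    then obtain \<alpha> \<beta> \<gamma> \<delta> \<mu> \<nu> where abc: "a = (\<alpha>, \<beta>)" "b = (\<gamma>, \<delta>)" "c = (\<mu>, \<nu>)"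
      and aut: "\<alpha> \<in> Aut" "\<beta> \<in> Aut" "\<gamma> \<in> Aut" "\<delta> \<in> Aut"
        "\<mu> \<in> Aut" "\<nu> \<in> Aut" by auto
    show "tassoc (DT H a) (DT H b) (DT H c)
        (tmap (DT H (a \<otimes>\<^bsub>?G\<^esub> b)) (DT H c) (tensor (DT H a) (DT H b)) (DT H c) (DT_comult H a b) id
          (DT_comult H (a \<otimes>\<^bsub>?G\<^esub> b) c x)) =
      tmap (DT H a) (DT H (b \<otimes>\<^bsub>?G\<^esub> c)) (DT H a) (tensor (DT H b) (DT H c)) id (DT_comult H b c)
        (DT_comult H a (b \<otimes>\<^bsub>?G\<^esub> c) x)"
      unfolding abc
      by (simp add: DT_comult_eq del: comp_apply, rule comul_coassoc)
        (use x aut in \<open>auto simp: aut_simps intro!: pt[unfolded comp_def] simp: aut[THEN hopf_autD(8)] aut[THEN hopf_autD(9)]\<close>)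
  next
    fix a x assume "a \<in> carrier ?G" and x: "x \<in> carr (DT H a)"
    then obtain \<alpha> \<beta> where a: "a = (\<alpha>, \<beta>)" and aut: "\<alpha> \<in> Aut" "\<beta> \<in> Aut" by auto
    show "tlift (DT H a) (DT H \<one>\<^bsub>?G\<^esub>) (\<lambda>y z. scl (DT H a) (DT_counit H z) y) (DT_comult H a \<one>\<^bsub>?G\<^esub> x) = x"
      using x aut by (simp add: a DT_comult_eq inverse_aut comul_counit(1))
    show "tlift (DT H \<one>\<^bsub>?G\<^esub>) (DT H a) (\<lambda>y z. scl (DT H a) (DT_counit H y) z) (DT_comult H \<one>\<^bsub>?G\<^esub> a x) = x"
      using x aut by (simp add: a DT_comult_eq inverse_aut comul_counit(2) aut_cancel)
  next
    fix a assume "a \<in> carrier ?G"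
    then obtain \<alpha> \<beta> where a: "a = (\<alpha>, \<beta>)" and aut: "\<alpha> \<in> Aut" "\<beta> \<in> Aut" by auto
    have "linear_map DS DS (antip (inverse_fun \<alpha>) (\<alpha> \<circ> inverse_fun \<beta> \<circ> inverse_fun \<alpha>) (\<alpha> \<circ> \<beta>))"
      by (rule antip(1)) (simp_all add: aut hopf_autD(1)[of "\<alpha> \<circ> \<beta>"])
    thus "linear_map (DT H a) (DT H (inv\<^bsub>?G\<^esub> a)) (DT_antipode H a)"
      by (simp add: a aut DT_antipode_eq)
  next
    fix a x assume "a \<in> carrier ?G" and x: "x \<in> carr (DT H \<one>\<^bsub>?G\<^esub>)"
    then obtain \<alpha> \<beta> where a: "a = (\<alpha>, \<beta>)" and aut: "\<alpha> \<in> Aut" "\<beta> \<in> Aut" by auto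
    \<comment> \<open>The antipode indexed by the inverse of \<open>a\<close> has its values in the
      component of \<open>a\<close>, hence the parameters \<alpha> and \<beta>; the automorphism it
      applies is the composite of the two entries of the inverse index.\<close>
    have S: "DT_antipode H (inv\<^bsub>?G\<^esub> a) = antip \<alpha> \<beta> (inverse_fun \<beta> \<circ> inverse_fun \<alpha>)"
      using aut by (simp add: a DT_antipode_eq aut_simps)
    note ap = hopf_autD(8,9)[OF aut(1)] hopf_autD(8,9)[OF aut(2)]
    show "tlift (DT H (inv\<^bsub>?G\<^esub> a)) (DT H a) (\<lambda>y z. amult (DT H a) (DT_antipode H (inv\<^bsub>?G\<^esub> a) y) z)
        (DT_comult H (inv\<^bsub>?G\<^esub> a) a x) = scl (DT H a) (DT_counit H x) (aunit (DT H a))"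
      unfolding S using x aut
      by (simp add: a DT_comult_eq aut_simps antip_left ap)
    show "tlift (DT H a) (DT H (inv\<^bsub>?G\<^esub> a)) (\<lambda>y z. amult (DT H a) y (DT_antipode H (inv\<^bsub>?G\<^esub> a) z))
        (DT_comult H a (inv\<^bsub>?G\<^esub> a) x) = scl (DT H a) (DT_counit H x) (aunit (DT H a))"
      unfolding S using x aut
      by (simp add: a DT_comult_eq aut_simps antip_right ap)
  next
    fix a b assume "a \<in> carrier ?G" "b \<in> carrier ?G"
    then obtain \<alpha> \<beta> \<gamma> \<delta> where ab: "b = (\<alpha>, \<beta>)" "a = (\<gamma>, \<delta>)"
      and aut: "\<alpha> \<in> Aut" "\<beta> \<in> Aut" "\<gamma> \<in> Aut" "\<delta> \<in> Aut" by auto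
    note ap = aut[THEN hopf_autD(8)] aut[THEN hopf_autD(9)]
    show "alg_iso (DT H a) (DT H (b \<otimes>\<^bsub>?G\<^esub> a \<otimes>\<^bsub>?G\<^esub> inv\<^bsub>?G\<^esub> b)) (DT_conj H b a)"
      using aut by (simp add: ab DT_conj_eq, intro conjg_mult) (simp_all add: aut_simps ap)
  next
    fix a b c x assume "a \<in> carrier ?G" "b \<in> carrier ?G" "c \<in> carrier ?G" and x: "x \<in> carr (DT H a)"
    then obtain \<alpha> \<beta> \<gamma> \<delta> \<mu> \<nu> where abc: "a = (\<alpha>, \<beta>)" "b = (\<gamma>, \<delta>)" "c = (\<mu>, \<nu>)"
      and aut: "\<alpha> \<in> Aut" "\<beta> \<in> Aut" "\<gamma> \<in> Aut" "\<delta> \<in> Aut"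
        "\<mu> \<in> Aut" "\<nu> \<in> Aut" by auto
    show "DT_conj H (b \<otimes>\<^bsub>?G\<^esub> c) a x =
        DT_conj H b (c \<otimes>\<^bsub>?G\<^esub> a \<otimes>\<^bsub>?G\<^esub> inv\<^bsub>?G\<^esub> c) (DT_conj H c a x)"
      using x aut by (simp add: abc DT_conj_eq conjg_conjg hopf_autD(1) aut_simps)
  next
    fix a b c x assume "a \<in> carrier ?G" "b \<in> carrier ?G" "c \<in> carrier ?G"
      and x: "x \<in> carr (DT H (a \<otimes>\<^bsub>?G\<^esub> c))"
    then obtain \<alpha> \<beta> \<gamma> \<delta> \<mu> \<nu> where abc: "a = (\<alpha>, \<beta>)" "b = (\<mu>, \<nu>)" "c = (\<gamma>, \<delta>)"
      and aut: "\<alpha> \<in> Aut" "\<beta> \<in> Aut" "\<gamma> \<in> Aut" "\<delta> \<in> Aut"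
        "\<mu> \<in> Aut" "\<nu> \<in> Aut" by auto
    note ap = aut[THEN hopf_autD(8)] aut[THEN hopf_autD(9)]
    show "tmap (DT H a) (DT H c) (DT H (b \<otimes>\<^bsub>?G\<^esub> a \<otimes>\<^bsub>?G\<^esub> inv\<^bsub>?G\<^esub> b)) (DT H (b \<otimes>\<^bsub>?G\<^esub> c \<otimes>\<^bsub>?G\<^esub> inv\<^bsub>?G\<^esub> b))
        (DT_conj H b a) (DT_conj H b c) (DT_comult H a c x) =
      DT_comult H (b \<otimes>\<^bsub>?G\<^esub> a \<otimes>\<^bsub>?G\<^esub> inv\<^bsub>?G\<^esub> b) (b \<otimes>\<^bsub>?G\<^esub> c \<otimes>\<^bsub>?G\<^esub> inv\<^bsub>?G\<^esub> b) (DT_conj H b (a \<otimes>\<^bsub>?G\<^esub> c) x)"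
      using x aut by (simp add: abc DT_conj_eq DT_comult_eq, intro conjg_comul) (simp_all add: aut_simps ap)
  next
    fix b x assume "b \<in> carrier ?G" and x: "x \<in> carr (DT H \<one>\<^bsub>?G\<^esub>)"
    then obtain \<alpha> \<beta> where b: "b = (\<alpha>, \<beta>)" and aut: "\<alpha> \<in> Aut" "\<beta> \<in> Aut" by auto
    \<comment> \<open>The trivial factors are kept so that \<open>?k\<close> is literally what
      \<open>DT_conj_eq\<close> produces at the unit (id, id).\<close>
    let ?k = "\<alpha> \<circ> inverse_fun id \<circ> inverse_fun \<beta> \<circ> id" and ?m = "\<beta> \<circ> inverse_fun \<alpha>"
    have km: "?k \<in> Aut" "?m \<in> Aut" using aut by (simp_all add: inverse_aut)
    have "\<epsilon> \<circ> ?k = \<epsilon>" by (rule ext) (simp only: comp_apply[of \<epsilon>] hopf_autD(5)[OF km(1)])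
    thus "DT_counit H (DT_conj H b \<one>\<^bsub>?G\<^esub> x) = DT_counit H x"
      using x hopf_autD(4)[OF km(2)] hopf_autD(1)[OF km(1)] hopf_autD(1)[OF km(2)]
      by (simp only: b aut_group_simps DT_conj_eq DT_simps DT_counit_eq conjg_carr ev_conjg lin_counit)
  }
qed

lemma quasitriangular_DT:
  "quasitriangular_T_coalgebra (aut_group H) (DT H)
    (DT_comult H) (DT_counit H) (DT_antipode H) (DT_conj H) (DT_R H E)"
proof (intro quasitriangular_T_coalgebra.intro quasitriangular_T_coalgebra_axioms.intro T_coalgebra_DT)
  let ?G = "aut_group H"
  fix a b assume "a \<in> carrier ?G" "b \<in> carrier ?G"
  then obtain \<alpha> \<beta> \<gamma> \<delta> where ab: "a = (\<alpha>, \<beta>)" "b = (\<gamma>, \<delta>)"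
    and aut: "\<alpha> \<in> Aut" "\<beta> \<in> Aut" "\<gamma> \<in> Aut" "\<delta> \<in> Aut" by auto
  note ap = aut[THEN hopf_autD(8)] aut[THEN hopf_autD(9)]
  show "DT_R H E a b \<in> carr (talg (DT H a) (DT H b)) \<and>
      (\<exists>R' \<in> carr (talg (DT H a) (DT H b)).
         amult (talg (DT H a) (DT H b)) (DT_R H E a b) R' = aunit (talg (DT H a) (DT H b)) \<and>
         amult (talg (DT H a) (DT H b)) R' (DT_R H E a b) = aunit (talg (DT H a) (DT H b)))"
    using Rmat_invertible[OF aut hopf_aut_inv[OF aut(2)]]
    \<comment> \<open>The witness is the usual inverse, with S applied to the first leg of R: S is
      inserted before \<open>inverse_fun \<beta>\<close>.\<close>
    by (auto simp: ab DT_R_eq intro!: bexI[of _ "Rmat (\<lambda>x. inverse_fun \<beta> (S x))"])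
  fix x assume x: "x \<in> carr (DT H (a \<otimes>\<^bsub>?G\<^esub> b))"
  show "amult (talg (DT H a) (DT H b)) (DT_R H E a b) (DT_comult H a b x) =
      amult (talg (DT H a) (DT H b))
        (tflip (DT H b) (DT H a)
          (tmap (DT H (a \<otimes>\<^bsub>?G\<^esub> b \<otimes>\<^bsub>?G\<^esub> inv\<^bsub>?G\<^esub> a)) (DT H a) (DT H b) (DT H a)
            (DT_conj H (inv\<^bsub>?G\<^esub> a) (a \<otimes>\<^bsub>?G\<^esub> b \<otimes>\<^bsub>?G\<^esub> inv\<^bsub>?G\<^esub> a)) id
            (DT_comult H (a \<otimes>\<^bsub>?G\<^esub> b \<otimes>\<^bsub>?G\<^esub> inv\<^bsub>?G\<^esub> a) a x)))
        (DT_R H E a b)"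
  proof -
    have "tflip (DT H b) (DT H a) = tflip DS DS" by (simp add: tflip_def fun_eq_iff)
    thus ?thesis using x aut
      \<comment> \<open>Matching fixes the automorphism parameters; what remains are memberships in
        \<open>Aut\<close> and the relations that the group law supplies.\<close>
      by (simp add: ab DT_conj_eq DT_comult_eq DT_R_eq, intro Rmat_comult) (simp_all add: aut_simps ap)
  qed
next
  let ?G = "aut_group H"
  fix a b c assume "a \<in> carrier ?G" "b \<in> carrier ?G" "c \<in> carrier ?G"
  then obtain \<alpha> \<beta> \<gamma> \<delta> \<mu> \<nu> where abc: "a = (\<alpha>, \<beta>)" "b = (\<gamma>, \<delta>)" "c = (\<mu>, \<nu>)"
    and aut: "\<alpha> \<in> Aut" "\<beta> \<in> Aut" "\<gamma> \<in> Aut" "\<delta> \<in> Aut"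
      "\<mu> \<in> Aut" "\<nu> \<in> Aut" by auto
  note ap = aut[THEN hopf_autD(8)] aut[THEN hopf_autD(9)]
  show "tmap (DT H a) (DT H (b \<otimes>\<^bsub>?G\<^esub> c)) (DT H a) (tensor (DT H b) (DT H c)) id (DT_comult H b c) (DT_R H E a (b \<otimes>\<^bsub>?G\<^esub> c)) =
      amult (talg (DT H a) (talg (DT H b) (DT H c)))
        (leg13 (DT H a) (DT H b) (DT H c) (DT_R H E a c)) (leg12 (DT H a) (DT H b) (DT H c) (DT_R H E a b))"
    using aut by (simp add: abc DT_comult_eq DT_R_eq, intro Rmat_comult_right) simp_all
  show "tassoc (DT H a) (DT H b) (DT H c)
        (tmap (DT H (a \<otimes>\<^bsub>?G\<^esub> b)) (DT H c) (tensor (DT H a) (DT H b)) (DT H c) (DT_comult H a b) id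
          (DT_R H E (a \<otimes>\<^bsub>?G\<^esub> b) c)) =
      amult (talg (DT H a) (talg (DT H b) (DT H c)))
        (leg13 (DT H a) (DT H b) (DT H c)
          (tmap (DT H a) (DT H (b \<otimes>\<^bsub>?G\<^esub> c \<otimes>\<^bsub>?G\<^esub> inv\<^bsub>?G\<^esub> b)) (DT H a) (DT H c) id
            (DT_conj H (inv\<^bsub>?G\<^esub> b) (b \<otimes>\<^bsub>?G\<^esub> c \<otimes>\<^bsub>?G\<^esub> inv\<^bsub>?G\<^esub> b))
            (DT_R H E a (b \<otimes>\<^bsub>?G\<^esub> c \<otimes>\<^bsub>?G\<^esub> inv\<^bsub>?G\<^esub> b))))
        (leg23 (DT H a) (DT H b) (DT H c) (DT_R H E b c))"
    using aut by (simp add: abc DT_comult_eq DT_conj_eq DT_R_eq, intro Rmat_comult_left) (simp_all add: aut_simps ap)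
  show "tmap (DT H a) (DT H c) (DT H (b \<otimes>\<^bsub>?G\<^esub> a \<otimes>\<^bsub>?G\<^esub> inv\<^bsub>?G\<^esub> b)) (DT H (b \<otimes>\<^bsub>?G\<^esub> c \<otimes>\<^bsub>?G\<^esub> inv\<^bsub>?G\<^esub> b))
        (DT_conj H b a) (DT_conj H b c) (DT_R H E a c) =
      DT_R H E (b \<otimes>\<^bsub>?G\<^esub> a \<otimes>\<^bsub>?G\<^esub> inv\<^bsub>?G\<^esub> b) (b \<otimes>\<^bsub>?G\<^esub> c \<otimes>\<^bsub>?G\<^esub> inv\<^bsub>?G\<^esub> b)"
    using aut by (simp add: abc DT_conj_eq DT_R_eq, intro Rmat_conj) (simp_all add: aut_simps ap)
qed

end

theorem theorem3p9:
  fixes H :: "('k::field, 'h::ring_1) hopf" and E :: "'h set"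
  assumes "hopf_algebra H"
    and "finite_dimensional_vector_space (hscl H) E"
    and "bij (antipode H)"
  shows "quasitriangular_T_coalgebra (aut_group H) (DT H)
           (DT_comult H) (DT_counit H) (DT_antipode H) (DT_conj H) (DT_R H E)"
  by (rule fin_dim_hopf.quasitriangular_DT, rule fin_dim_hopf.intro) (rule assms)+

end
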